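(* Let $\underline W\in\underline{\mathcal S}'$ satisfy axioms A1)–A7) listed in the context, with a Hilbert seminorm $\underline p$ in A5) that is Sobolev dominated, and let $((\mathcal H,\langle\cdot,\cdot\rangle,\Omega),\eta,\mathsf U,\phi)$ be the associated quantum field theory with indefinite metric. Let $\mathsf U(t)=\mathsf U(\{\Lambda(t),0\})$, $t\in\mathbb R$, where $\Lambda(t)$ is the Lorentz boost $x\mapsto(x^0\cosh t+x^1\sinh t,\ x^0\sinh t+x^1\cosh t,\ x^2,\dots,x^{d-1})$, and let $\mathsf A$ be the generator of the one-parameter group $\{\mathsf U(t)\}_{t\in\mathbb R}$ of $\eta$-unitary operators on $\mathcal D$. Then $\mathsf A$ has a dense domain $\mathcal D^{\rm anal.}$ of entire analytic vectors, i.e. the set $\mathcal D^{\rm anal.}$ of entire analytic vectors of $\mathsf A$ is dense in $\mathcal H$. In particular, $\{\mathsf U(t)\}_{t\in\mathbb R}$ on $\mathcal D^{\rm anal.}$ has a well-defined additive extension to $\mathsf U(z)$, $z\in\mathbb C$ (additive in $z$ meaning $\mathsf U(z_1)\mathsf U(z_2)=\mathsf U(z_1+z_2)$ for all $z_1,z_2\in\mathbb C$), given by $\mathsf U(z)=\sum_{n=0}^\infty \frac{(iz)^n}{n!}\mathsf A^n$, and $\mathsf U(z)^{[*]}=\mathsf U(-\bar z)$ holds on this domain.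
   Context: **Borchers algebra.** Fix $d\ge2$ and Minkowski space $\mathbb R^d$ with $x\cdot y=x^0y^0-\sum_{j=1}^{d-1}x^jy^j$. Let $\mathcal S_0=\mathbb C$, $\mathcal S_n=\mathcal S(\mathbb R^{dn},\mathbb C)$ (Schwartz functions) and $\underline{\mathcal S}=\bigoplus_{n\ge0}\mathcal S_n$ (finite sequences $\underline f=(f_0,f_1,\dots)$) with the locally convex direct sum topology, product $(\underline f\otimes\underline h)_n=\sum_{j+l=n}f_j\otimes h_l$, unit $\mathbf 1=(1,0,\dots)$, and involution $f_l^*(x_1,\dots,x_l)=\overline{f_l(x_l,\dots,x_1)}$. $\underline{\mathcal S}'$ is the topological dual. The proper orthochronous Poincaré group $P_+^\uparrow$ acts by continuous $*$-automorphisms $\underline\alpha_{\{\Lambda,a\}}$, $(\underline\alpha_{\{\Lambda,a\}}f_n)(x_1,\dots,x_n)=f_n(\Lambda^{-1}(x_1-a),\dots,\Lambda^{-1}(x_n-a))$. $I_{\rm sp}$ is the left ideal generated by all $\int_{\mathbb R^d}\underline\alpha_{\{1,a\}}(\underline f)h(a)\,da$ with $\underline f\in\underline{\mathcal S}$, $h\in\mathcal S_1$, $\operatorname{supp}\hat h\cap\bar V_0^+=\emptyset$, where $\hat h(k)=\int e^{ik\cdot a}h(a)\,da$ and $\bar V_0^+=\{k:k^0\ge0,\ k\cdot k\ge0\}$. $I_{\rm loc}$ is the two-sided ideal generated by $(0,0,f_1\otimes h_1-h_1\otimes f_1,0,\dots)$ with $f_1,h_1\in\mathcal S_1$ having space-like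 separated supports. **Axioms for $\underline W$.** A1) $\underline W\in\underline{\mathcal S}'$, $W_0=1$. A2) $\underline W\circ\underline\alpha_{\{\Lambda,a\}}=\underline W$ for all $\{\Lambda,a\}\in P_+^\uparrow$. A3) $I_{\rm sp}\subseteq\ker\underline W$. A4) $I_{\rm loc}\subseteq\ker\underline W$. A5) There is a Hilbert seminorm $\underline p$ on $\underline{\mathcal S}$ (one coming from a positive semidefinite sesquilinear form) with $|\underline W(\underline f^*\otimes\underline g)|\le\underline p(\underline f)\underline p(\underline g)$ for all $\underline f,\underline g$. A6) $\lim_{t\to\infty}\underline W(\underline f\otimes\underline\alpha_{\{1,ta\}}(\underline g))=\underline W(\underline f)\underline W(\underline g)$ for all $\underline f,\underline g$ and space-like $a$. A7) $\underline W(\underline f^* )=\overline{\underline W(\underline f)}$. The seminorm $\underline p$ is *Sobolev dominated* if it is continuous in the topology of $\underline{\mathcal S}$. **Associated QFT with indefinite metric.** If $\underline p$ is not a norm, replace it by $\sqrt{\underline p^2+\underline p_1^2}$, with $\underline p_1$ a Hilbert norm on $\underline{\mathcal S}$ that is a direct sum of Sobolev Hilbert norms on the $\mathcal S_n$. Let $\mathcal H_1$ be the completion of $\underline{\mathcal S}$ in $\underline p$; extend $\langle\underline f,\underline g\rangle=\underline W(\underline f^*\otimes\underline g)$ continuously to $\mathcal H_1$. Let $\mathcal K_0=\{v\in\mathcal H_1:\langle w,v\rangle=0\ \forall w\in\mathcal H_1\}$, $\mathcal H_2=\mathcal H_1/\mathcal K_0$ (quotient Hilbert space, scalar product $(\cdot,\cdot)_2$)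 with quotient map $\pi$; $\langle\cdot,\cdot\rangle$ descends to $\mathcal H_2$ and equals $(\cdot,\eta_2\cdot)_2$ for an injective self-adjoint contraction $\eta_2$. Set $\mathcal D=\pi(\underline{\mathcal S})$, $\Omega=\pi(\mathbf 1)$, $(\cdot,\cdot)=(\cdot,|\eta_2|\cdot)_2$, let $\mathcal H$ be the completion of $\mathcal D$ in $\|\cdot\|=(\cdot,\cdot)^{1/2}$ and $\eta=\operatorname{sign}(\eta_2)$ extended to $\mathcal H$, so that $\eta=\eta^*$, $\eta^2=1$ and $\langle\cdot,\cdot\rangle=(\cdot,\eta\,\cdot)$; passing if necessary to a topologically equivalent scalar product and corresponding metric operator for the same $\langle\cdot,\cdot\rangle$, $\eta$ is chosen so that $\eta\Omega=\Omega$. On $\mathcal D$ one has the well-defined operators $\phi(\underline f)\pi(\underline g)=\pi(\underline f\otimes\underline g)$ and $\mathsf U(\Lambda,a)\pi(\underline g)=\pi(\underline\alpha_{\{\Lambda,a\}}(\underline g))$. The $\eta$-adjoint is $\mathsf L^{[*]}=\eta\mathsf L^*\eta$ (restricted to the domain in question). $\mathsf U$ is $\eta$-unitary: $\mathsf U^{[*]}=\mathsf U^{-1}$ on $\mathcal D$. **Generator and analytic vectors.** $\mathcal D(\mathsf A)$ is the set of $\Psi\in\mathcal D$ such that $\mathsf A\Psi:=\lim_{t\to0,t\ne0}(it)^{-1}(\mathsf U(t)-1)\Psi$ exists strongly in $\mathcal H$; $(\mathsf A,\mathcal D(\mathsf A))$ is the generator. A vector $\Psi\in\mathcal D(\mathsf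 A)$ is *entire analytic* for $\mathsf A$ if $\mathsf A^n\Psi\in\mathcal D(\mathsf A)$ for all $n\in\mathbb N$ and $\sum_{n\ge0}\frac{z^n}{n!}\mathsf A^n\Psi$ converges strongly in $\mathcal H$ for all $z\in\mathbb C$. $\mathcal D^{\rm anal.}$ is the set of all entire analytic vectors. The series defining $\mathsf U(z)$ is understood in the sense of strong convergence on vectors of $\mathcal D^{\rm anal.}$.
   Formalization: U(z₂)Ψ can leave D^anal, so U(z₁)U(z₂)=U(z₁+z₂) is stated where U(z₂)Ψ lies in D^anal (in particular on a dense set of Ψ with U(z)Ψ in D^anal for all z), and on all of D^anal with U(z₁) replaced by its closure. *)

theory Defs
  imports "HOL-Analysis.Analysis"
begin

section \<open>Complex Hilbert spaces\<close>

text \<open>The inner product is antilinear in the first and linear in the second argument.\<close>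

class complex_hilbert_space = banach +
  fixes scaleC :: "complex \<Rightarrow> 'a \<Rightarrow> 'a" (infixr "*\<^sub>C" 75)
    and cinner :: "'a \<Rightarrow> 'a \<Rightarrow> complex"
  assumes scaleC_add_right: "c *\<^sub>C (x + y) = c *\<^sub>C x + c *\<^sub>C y"
    and scaleC_add_left: "(b + c) *\<^sub>C x = b *\<^sub>C x + c *\<^sub>C x"
    and scaleC_scaleC: "b *\<^sub>C (c *\<^sub>C x) = (b * c) *\<^sub>C x"
    and scaleC_of_real: "complex_of_real r *\<^sub>C x = r *\<^sub>R x"
    and cinner_add_right: "cinner x (y + z) = cinner x y + cinner x z"
    and cinner_scaleC_right: "cinner x (c *\<^sub>C y) = c * cinner x y"
    and cinner_commute: "cinner y x = cnj (cinner x y)"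
    and cinner_self: "cinner x x = complex_of_real ((norm x)\<^sup>2)"

definition clinear :: "('a::complex_hilbert_space \<Rightarrow> 'b::complex_hilbert_space) \<Rightarrow> bool" where
  "clinear T \<longleftrightarrow> (\<forall>x y. T (x + y) = T x + T y) \<and> (\<forall>c x. T (c *\<^sub>C x) = c *\<^sub>C T x)"

definition bounded_clinear :: "('a::complex_hilbert_space \<Rightarrow> 'b::complex_hilbert_space) \<Rightarrow> bool" where
  "bounded_clinear T \<longleftrightarrow> clinear T \<and> (\<exists>C. \<forall>x. norm (T x) \<le> C * norm x)"

text \<open>\<open>T\<close> is the absolute value of the bounded self-adjoint operator \<open>S\<close>, i.e. the positive
  square root of \<open>S\<^sup>* S = S\<^sup>2\<close>.\<close>

definition is_operator_abs ::
  "('a::complex_hilbert_space \<Rightarrow> 'a) \<Rightarrow> ('a \<Rightarrow> 'a) \<Rightarrow> bool" where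
  "is_operator_abs S T \<longleftrightarrow> bounded_clinear T \<and>
     (\<forall>x. cinner x (T x) \<in> \<real> \<and> 0 \<le> Re (cinner x (T x))) \<and> (\<forall>x. T (T x) = S (S x))"

text \<open>The sign of an injective bounded self-adjoint operator \<open>S\<close>: since the range of \<open>\<bar>S\<bar>\<close> is
  dense, \<open>sign(S)\<close> is the unique bounded operator with \<open>sign(S) \<bar>S\<bar> = S\<close>.\<close>

definition is_operator_sign ::
  "('a::complex_hilbert_space \<Rightarrow> 'a) \<Rightarrow> ('a \<Rightarrow> 'a) \<Rightarrow> bool" where
  "is_operator_sign S V \<longleftrightarrow> bounded_clinear V \<and>
     (\<exists>T. is_operator_abs S T \<and> (\<forall>x. V (T x) = S x))"

text \<open>A complex scalar product that induces the given Hilbert space topology.\<close>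

definition equivalent_scalar_product ::
  "('a::complex_hilbert_space \<Rightarrow> 'a \<Rightarrow> complex) \<Rightarrow> bool" where
  "equivalent_scalar_product ip \<longleftrightarrow>
     (\<forall>x y z. ip x (y + z) = ip x y + ip x z) \<and>
     (\<forall>c x y. ip x (c *\<^sub>C y) = c * ip x y) \<and>
     (\<forall>x y. ip y x = cnj (ip x y)) \<and>
     (\<exists>c C. 0 < c \<and> (\<forall>x. c * norm x \<le> sqrt (Re (ip x x)) \<and> sqrt (Re (ip x x)) \<le> C * norm x))"

text \<open>Adjoint, with respect to the scalar product \<open>ip\<close>, of an operator \<open>L\<close> with dense domain \<open>M\<close>;
  outside \<open>M\<close> the function \<open>L\<close> is irrelevant.\<close>

definition adjoint_dom ::
  "('a \<Rightarrow> 'a \<Rightarrow> complex) \<Rightarrow> 'a set \<Rightarrow> ('a \<Rightarrow> 'a) \<Rightarrow> 'a set" where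
  "adjoint_dom ip M L = {w. \<exists>u. \<forall>v\<in>M. ip w (L v) = ip u v}"

definition adjoint_op ::
  "('a \<Rightarrow> 'a \<Rightarrow> complex) \<Rightarrow> 'a set \<Rightarrow> ('a \<Rightarrow> 'a) \<Rightarrow> 'a \<Rightarrow> 'a" where
  "adjoint_op ip M L w = (THE u. \<forall>v\<in>M. ip w (L v) = ip u v)"

text \<open>The \<open>\<eta>\<close>-adjoint \<open>\<eta> L\<^sup>* \<eta>\<close> and its natural domain.\<close>

definition eta_adjoint_dom ::
  "('a \<Rightarrow> 'a \<Rightarrow> complex) \<Rightarrow> ('a \<Rightarrow> 'a) \<Rightarrow> 'a set \<Rightarrow> ('a \<Rightarrow> 'a) \<Rightarrow> 'a set" where
  "eta_adjoint_dom ip \<eta> M L = {w. \<eta> w \<in> adjoint_dom ip M L}"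

definition eta_adjoint ::
  "('a \<Rightarrow> 'a \<Rightarrow> complex) \<Rightarrow> ('a \<Rightarrow> 'a) \<Rightarrow> 'a set \<Rightarrow> ('a \<Rightarrow> 'a) \<Rightarrow> 'a \<Rightarrow> 'a" where
  "eta_adjoint ip \<eta> M L w = \<eta> (adjoint_op ip M L (\<eta> w))"

definition op_graph :: "'a set \<Rightarrow> ('a \<Rightarrow> 'a) \<Rightarrow> ('a \<times> 'a) set" where
  "op_graph M L = (\<lambda>v. (v, L v)) ` M"

section \<open>Generators and entire analytic vectors\<close>

definition generator_dom ::
  "'a::complex_hilbert_space set \<Rightarrow> (real \<Rightarrow> 'a \<Rightarrow> 'a) \<Rightarrow> 'a set" where
  "generator_dom D U =
     {v \<in> D. \<exists>w. ((\<lambda>t. (1 / (\<i> * complex_of_real t)) *\<^sub>C (U t v - v)) \<longlongrightarrow> w) (at 0)}"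

definition generator :: "(real \<Rightarrow> 'a::complex_hilbert_space \<Rightarrow> 'a) \<Rightarrow> 'a \<Rightarrow> 'a" where
  "generator U v = Lim (at 0) (\<lambda>t. (1 / (\<i> * complex_of_real t)) *\<^sub>C (U t v - v))"

definition entire_analytic_vectors ::
  "'a::complex_hilbert_space set \<Rightarrow> ('a \<Rightarrow> 'a) \<Rightarrow> 'a set" where
  "entire_analytic_vectors M A =
     {v. (\<forall>n. (A ^^ n) v \<in> M) \<and> (\<forall>z::complex. summable (\<lambda>n. (z ^ n / fact n) *\<^sub>C (A ^^ n) v))}"

definition exp_series :: "('a::complex_hilbert_space \<Rightarrow> 'a) \<Rightarrow> complex \<Rightarrow> 'a \<Rightarrow> 'a" where
  "exp_series A z v = (\<Sum>n. ((\<i> * z) ^ n / fact n) *\<^sub>C (A ^^ n) v)"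

section \<open>Minkowski space and the Poincare group\<close>

text \<open>Space-time of dimension \<open>d = CARD('s) + 1 \<ge> 2\<close>: the index \<open>None\<close> is the time direction,
  the indices \<open>Some j\<close> are the spatial directions.\<close>

type_synonym 's minkowski = "real ^ 's option"

definition mink :: "'s::finite minkowski \<Rightarrow> 's minkowski \<Rightarrow> real" where
  "mink x y = x $ None * y $ None - (\<Sum>j\<in>UNIV. x $ Some j * y $ Some j)"

definition spacelike :: "'s::finite minkowski \<Rightarrow> bool" where
  "spacelike x \<longleftrightarrow> mink x x < 0"

definition forward_cone :: "'s::finite minkowski set" where
  "forward_cone = {k. 0 \<le> k $ None \<and> 0 \<le> mink k k}"

definition proper_orthochronous_lorentz :: "(real ^ 's::finite option ^ 's option) set" where
  "proper_orthochronous_lorentz =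
     {L. (\<forall>x y. mink (L *v x) (L *v y) = mink x y) \<and> det L = 1 \<and> 1 \<le> L $ None $ None}"

definition boost :: "'s::finite \<Rightarrow> real \<Rightarrow> real ^ 's option ^ 's option" where
  "boost j t = matrix (\<lambda>x. \<chi> \<mu>.
     if \<mu> = None then x $ None * cosh t + x $ Some j * sinh t
     else if \<mu> = Some j then x $ None * sinh t + x $ Some j * cosh t
     else x $ \<mu>)"

section \<open>The Borchers algebra\<close>

text \<open>A finite sequence \<open>(f\<^sub>0, f\<^sub>1, \<dots>)\<close> of functions \<open>f\<^sub>n\<close> of \<open>n\<close> vectors is encoded as one function
  \<open>f\<close> on lists of vectors: \<open>f\<^sub>n (x\<^sub>1, \<dots>, x\<^sub>n) = f [x\<^sub>1, \<dots>, x\<^sub>n]\<close>.\<close>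

definition list_norm :: "'v::euclidean_space list \<Rightarrow> real" where
  "list_norm xs = sqrt (\<Sum>x\<leftarrow>xs. (norm x)\<^sup>2)"

text \<open>Partial derivative in the direction of the basis vector \<open>b\<close> of the \<open>i\<close>-th argument.\<close>

fun partial :: "nat \<times> 'v::euclidean_space \<Rightarrow> ('v list \<Rightarrow> complex) \<Rightarrow> 'v list \<Rightarrow> complex" where
  "partial (i, b) f xs = vector_derivative (\<lambda>t. f (xs[i := xs ! i + t *\<^sub>R b])) (at 0)"

definition partials ::
  "(nat \<times> 'v::euclidean_space) list \<Rightarrow> ('v list \<Rightarrow> complex) \<Rightarrow> 'v list \<Rightarrow> complex" where
  "partials js f = foldr partial js f"

text \<open>The multi-indices for functions of \<open>n\<close> arguments, as lists of single directions.\<close>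

definition directions :: "nat \<Rightarrow> (nat \<times> 'v::euclidean_space) list set" where
  "directions n = lists ({..<n} \<times> Basis)"

text \<open>The \<open>n\<close>-th component of \<open>f\<close> is infinitely often differentiable: all iterated partial
  derivatives exist and are continuous.\<close>

definition smooth_comp :: "nat \<Rightarrow> ('v::euclidean_space list \<Rightarrow> complex) \<Rightarrow> bool" where
  "smooth_comp n f \<longleftrightarrow> (\<forall>js \<in> directions n.
     continuous_on UNIV (\<lambda>x::nat \<Rightarrow> 'v. partials js f (map x [0..<n])) \<and>
     (\<forall>i<n. \<forall>b\<in>Basis. \<forall>xs. length xs = n \<longrightarrow>
        (\<lambda>t. partials js f (xs[i := xs ! i + t *\<^sub>R b])) differentiable (at 0)))"

definition schwartz_comp :: "nat \<Rightarrow> ('v::euclidean_space list \<Rightarrow> complex) \<Rightarrow> bool" where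
  "schwartz_comp n f \<longleftrightarrow> smooth_comp n f \<and>
     (\<forall>js \<in> directions n. \<forall>N::nat.
        bdd_above ((\<lambda>xs. (1 + list_norm xs) ^ N * cmod (partials js f xs)) ` {xs. length xs = n}))"

definition borchers :: "('v::euclidean_space list \<Rightarrow> complex) set" where
  "borchers = {f. (\<forall>n. schwartz_comp n f) \<and> (\<exists>N. \<forall>xs. N < length xs \<longrightarrow> f xs = 0)}"

text \<open>The space \<open>\<S>\<^sub>n\<close>, embedded in the direct sum.\<close>

definition borchers_comp :: "nat \<Rightarrow> ('v::euclidean_space list \<Rightarrow> complex) set" where
  "borchers_comp n = {f \<in> borchers. \<forall>xs. length xs \<noteq> n \<longrightarrow> f xs = 0}"

definition component ::
  "nat \<Rightarrow> ('v::euclidean_space list \<Rightarrow> complex) \<Rightarrow> 'v list \<Rightarrow> complex" where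
  "component n f = (\<lambda>xs. if length xs = n then f xs else 0)"

definition tensor ::
  "('v::euclidean_space list \<Rightarrow> complex) \<Rightarrow> ('v list \<Rightarrow> complex) \<Rightarrow> 'v list \<Rightarrow> complex" where
  "tensor f h = (\<lambda>xs. \<Sum>j\<le>length xs. f (take j xs) * h (drop j xs))"

definition unit_elem :: "'v::euclidean_space list \<Rightarrow> complex" where
  "unit_elem = (\<lambda>xs. if xs = [] then 1 else 0)"

definition star ::
  "('v::euclidean_space list \<Rightarrow> complex) \<Rightarrow> 'v list \<Rightarrow> complex" where
  "star f = (\<lambda>xs. cnj (f (rev xs)))"

definition poincare ::
  "real ^ 's::finite option ^ 's option \<Rightarrow> 's minkowski \<Rightarrow>
   ('s minkowski list \<Rightarrow> complex) \<Rightarrow> 's minkowski list \<Rightarrow> complex" where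
  "poincare L a f = (\<lambda>xs. f (map (\<lambda>x. matrix_inv L *v (x - a)) xs))"

subsection \<open>Topology\<close>

definition schwartz_norm :: "nat \<Rightarrow> nat \<Rightarrow> ('v::euclidean_space list \<Rightarrow> complex) \<Rightarrow> real" where
  "schwartz_norm n N f =
     (SUP (js, xs) \<in> {js \<in> directions n. length js \<le> N} \<times> {xs. length xs = n}.
        (1 + list_norm xs) ^ N * cmod (partials js f xs))"

definition borchers_seminorm :: "(('v::euclidean_space list \<Rightarrow> complex) \<Rightarrow> real) \<Rightarrow> bool" where
  "borchers_seminorm q \<longleftrightarrow>
     (\<forall>f\<in>borchers. 0 \<le> q f) \<and>
     (\<forall>c. \<forall>f\<in>borchers. q (\<lambda>xs. c * f xs) = cmod c * q f) \<and>
     (\<forall>f\<in>borchers. \<forall>g\<in>borchers. q (\<lambda>xs. f xs + g xs) \<le> q f + q g)"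

text \<open>Continuity of the restriction of a seminorm to the Frechet space \<open>\<S>\<^sub>n\<close>.\<close>

definition continuous_seminorm_on_comp ::
  "nat \<Rightarrow> (('v::euclidean_space list \<Rightarrow> complex) \<Rightarrow> real) \<Rightarrow> bool" where
  "continuous_seminorm_on_comp n q \<longleftrightarrow>
     (\<exists>C N. \<forall>f\<in>borchers_comp n. q f \<le> C * schwartz_norm n N f)"

text \<open>The locally convex direct sum topology, the finest locally convex topology for which all the
  inclusions \<open>\<S>\<^sub>n \<subseteq> \<S>\<close> are continuous, is generated by all the seminorms whose restrictions
  to every \<open>\<S>\<^sub>n\<close> are continuous.\<close>

definition direct_sum_seminorms :: "(('v::euclidean_space list \<Rightarrow> complex) \<Rightarrow> real) set" where
  "direct_sum_seminorms = {q. borchers_seminorm q \<and> (\<forall>n. continuous_seminorm_on_comp n q)}"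

definition borchers_open :: "('v::euclidean_space list \<Rightarrow> complex) set \<Rightarrow> bool" where
  "borchers_open U \<longleftrightarrow> U \<subseteq> borchers \<and>
     (\<forall>f\<in>U. \<exists>Q. finite Q \<and> Q \<subseteq> direct_sum_seminorms \<and>
        {g \<in> borchers. \<forall>q\<in>Q. q (\<lambda>xs. g xs - f xs) < 1} \<subseteq> U)"

definition borchers_topology :: "('v::euclidean_space list \<Rightarrow> complex) topology" where
  "borchers_topology = topology borchers_open"

lemma borchers_open_subset: "borchers_open U \<Longrightarrow> U \<subseteq> borchers"
  by (simp only: borchers_open_def)

lemma borchers_openE:
  assumes "borchers_open U" "f \<in> U"
  obtains Q where "finite Q" "Q \<subseteq> direct_sum_seminorms"
    "{g \<in> borchers. \<forall>q\<in>Q. q (\<lambda>xs. g xs - f xs) < 1} \<subseteq> U"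
proof -
  have "\<exists>Q. finite Q \<and> Q \<subseteq> direct_sum_seminorms \<and>
      {g \<in> borchers. \<forall>q\<in>Q. q (\<lambda>xs. g xs - f xs) < 1} \<subseteq> U"
    using assms(1) unfolding borchers_open_def by (elim conjE bspec[OF _ assms(2)])
  then show ?thesis by (elim exE conjE) (rule that)
qed

lemma istopology_borchers_open: "istopology borchers_open"
  unfolding istopology_def
proof (intro conjI allI impI)
  fix U V :: "('v::euclidean_space list \<Rightarrow> complex) set"
  assume U: "borchers_open U" and V: "borchers_open V"
  show "borchers_open (U \<inter> V)"
    unfolding borchers_open_def
  proof (intro conjI ballI)
    show "U \<inter> V \<subseteq> borchers" using borchers_open_subset[OF U] by (rule le_infI1)
  next
    fix f assume f: "f \<in> U \<inter> V"
    obtain Q where Q: "finite Q" "Q \<subseteq> direct_sum_seminorms"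
        "{g \<in> borchers. \<forall>q\<in>Q. q (\<lambda>xs. g xs - f xs) < 1} \<subseteq> U"
      by (rule borchers_openE[OF U IntD1[OF f]])
    obtain R where R: "finite R" "R \<subseteq> direct_sum_seminorms"
        "{g \<in> borchers. \<forall>q\<in>R. q (\<lambda>xs. g xs - f xs) < 1} \<subseteq> V"
      by (rule borchers_openE[OF V IntD2[OF f]])
    have "{g \<in> borchers. \<forall>q\<in>Q \<union> R. q (\<lambda>xs. g xs - f xs) < 1} \<subseteq> U \<inter> V"
    proof
      fix g assume g: "g \<in> {g \<in> borchers. \<forall>q\<in>Q \<union> R. q (\<lambda>xs. g xs - f xs) < 1}"
      have "g \<in> U" by (rule subsetD[OF Q(3)]) (use g in simp)
      moreover have "g \<in> V" by (rule subsetD[OF R(3)]) (use g in simp)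
      ultimately show "g \<in> U \<inter> V" by (rule IntI)
    qed
    moreover have "finite (Q \<union> R)" "Q \<union> R \<subseteq> direct_sum_seminorms"
      using Q(1,2) R(1,2) by simp_all
    ultimately show "\<exists>Q. finite Q \<and> Q \<subseteq> direct_sum_seminorms \<and>
        {g \<in> borchers. \<forall>q\<in>Q. q (\<lambda>xs. g xs - f xs) < 1} \<subseteq> U \<inter> V"
      by (intro exI[of _ "Q \<union> R"] conjI)
  qed
next
  fix \<K> :: "('v::euclidean_space list \<Rightarrow> complex) set set"
  assume K: "\<forall>K\<in>\<K>. borchers_open K"
  show "borchers_open (\<Union>\<K>)"
    unfolding borchers_open_def
  proof (intro conjI ballI)
    show "\<Union>\<K> \<subseteq> borchers" 
      by (rule Union_least) (rule borchers_open_subset, rule bspec[OF K])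
  next
    fix f assume "f \<in> \<Union>\<K>"
    then obtain K where K': "K \<in> \<K>" "f \<in> K" by (rule UnionE)
    obtain Q where Q: "finite Q" "Q \<subseteq> direct_sum_seminorms"
        "{g \<in> borchers. \<forall>q\<in>Q. q (\<lambda>xs. g xs - f xs) < 1} \<subseteq> K"
      by (rule borchers_openE[OF bspec[OF K K'(1)] K'(2)])
    have "K \<subseteq> \<Union>\<K>" using K'(1) by (rule Union_upper)
    with Q show "\<exists>Q. finite Q \<and> Q \<subseteq> direct_sum_seminorms \<and>
        {g \<in> borchers. \<forall>q\<in>Q. q (\<lambda>xs. g xs - f xs) < 1} \<subseteq> \<Union>\<K>"
      by (intro exI[of _ Q] conjI) (simp_all only: subset_trans)
  qed
qed

lemma openin_borchers_topology: "openin borchers_topology U \<longleftrightarrow> borchers_open U"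
  by (simp add: borchers_topology_def istopology_borchers_open)

lemma topspace_borchers_topology:
  "topspace borchers_topology = (borchers :: ('v::euclidean_space list \<Rightarrow> complex) set)"
proof (rule antisym)
  show "topspace borchers_topology \<subseteq> (borchers :: ('v list \<Rightarrow> complex) set)"
    by (rule borchers_open_subset) (simp only: openin_borchers_topology[symmetric] openin_topspace)
  have "borchers_open (borchers :: ('v list \<Rightarrow> complex) set)"
    unfolding borchers_open_def by (intro conjI ballI exI[of _ "{}"]) simp_all
  then show "(borchers :: ('v list \<Rightarrow> complex) set) \<subseteq> topspace borchers_topology"
    by (intro openin_subset) (simp only: openin_borchers_topology)
qed

definition borchers_linear :: "(('v::euclidean_space list \<Rightarrow> complex) \<Rightarrow> complex) \<Rightarrow> bool" where
  "borchers_linear W \<longleftrightarrow>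
     (\<forall>f\<in>borchers. \<forall>g\<in>borchers. W (\<lambda>xs. f xs + g xs) = W f + W g) \<and>
     (\<forall>c. \<forall>f\<in>borchers. W (\<lambda>xs. c * f xs) = c * W f)"

text \<open>The topological dual \<open>\<S>'\<close>.\<close>

definition borchers_dual :: "(('v::euclidean_space list \<Rightarrow> complex) \<Rightarrow> complex) set" where
  "borchers_dual = {W. borchers_linear W \<and> continuous_map borchers_topology euclidean W}"

text \<open>Seminorms coming from a positive semidefinite sesquilinear form.\<close>

definition hilbert_seminorm :: "(('v::euclidean_space list \<Rightarrow> complex) \<Rightarrow> real) \<Rightarrow> bool" where
  "hilbert_seminorm p \<longleftrightarrow> (\<exists>B.
     (\<forall>f\<in>borchers. borchers_linear (B f)) \<and>
     (\<forall>f\<in>borchers. borchers_linear (\<lambda>g. cnj (B g f))) \<and>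
     (\<forall>f\<in>borchers. B f f \<in> \<real> \<and> 0 \<le> Re (B f f) \<and> p f = sqrt (Re (B f f))))"

definition borchers_norm :: "(('v::euclidean_space list \<Rightarrow> complex) \<Rightarrow> real) \<Rightarrow> bool" where
  "borchers_norm p \<longleftrightarrow> borchers_seminorm p \<and> (\<forall>f\<in>borchers. p f = 0 \<longrightarrow> f = (\<lambda>xs. 0))"

definition sobolev_dominated :: "(('v::euclidean_space list \<Rightarrow> complex) \<Rightarrow> real) \<Rightarrow> bool" where
  "sobolev_dominated p \<longleftrightarrow> continuous_map borchers_topology euclidean p"

text \<open>A direct sum of Hilbert norms on the \<open>\<S>\<^sub>n\<close>, each of which is dominated by a Schwartz norm
  of finite order; all the scales of (weighted) Sobolev Hilbert norms are of this kind. Only finitely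
  many terms of the series are different from 0.\<close>

definition sobolev_direct_sum_norm :: "(('v::euclidean_space list \<Rightarrow> complex) \<Rightarrow> real) \<Rightarrow> bool" where
  "sobolev_direct_sum_norm r \<longleftrightarrow> hilbert_seminorm r \<and> borchers_norm r \<and>
     (\<forall>n. continuous_seminorm_on_comp n r) \<and>
     (\<forall>f\<in>borchers. (r f)\<^sup>2 = (\<Sum>n. (r (component n f))\<^sup>2))"

text \<open>The Hilbert norm \<open>q\<close> used in the construction: \<open>p\<close> itself if it is a norm, and otherwise
  \<open>p\<close> supplemented by a direct sum of Sobolev norms.\<close>

definition construction_norm ::
  "(('v::euclidean_space list \<Rightarrow> complex) \<Rightarrow> real) \<Rightarrow> (('v list \<Rightarrow> complex) \<Rightarrow> real) \<Rightarrow> bool" where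
  "construction_norm p q \<longleftrightarrow>
     (if borchers_norm p then \<forall>f\<in>borchers. q f = p f
      else \<exists>r. sobolev_direct_sum_norm r \<and> (\<forall>f\<in>borchers. q f = sqrt ((p f)\<^sup>2 + (r f)\<^sup>2)))"

subsection \<open>Ideals\<close>

definition borchers_subspace :: "('v::euclidean_space list \<Rightarrow> complex) set \<Rightarrow> bool" where
  "borchers_subspace J \<longleftrightarrow> J \<subseteq> borchers \<and> (\<lambda>xs. 0) \<in> J \<and>
     (\<forall>f\<in>J. \<forall>g\<in>J. (\<lambda>xs. f xs + g xs) \<in> J) \<and> (\<forall>c. \<forall>f\<in>J. (\<lambda>xs. c * f xs) \<in> J)"

definition left_ideal :: "('v::euclidean_space list \<Rightarrow> complex) set \<Rightarrow> bool" where
  "left_ideal J \<longleftrightarrow> borchers_subspace J \<and> (\<forall>f\<in>borchers. \<forall>g\<in>J. tensor f g \<in> J)"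

definition two_sided_ideal :: "('v::euclidean_space list \<Rightarrow> complex) set \<Rightarrow> bool" where
  "two_sided_ideal J \<longleftrightarrow> left_ideal J \<and> (\<forall>f\<in>borchers. \<forall>g\<in>J. tensor g f \<in> J)"

definition mink_fourier :: "('s::finite minkowski \<Rightarrow> complex) \<Rightarrow> 's minkowski \<Rightarrow> complex" where
  "mink_fourier h k = (LINT a|lborel. exp (\<i> * complex_of_real (mink k a)) * h a)"

definition supp :: "('v::topological_space \<Rightarrow> complex) \<Rightarrow> 'v set" where
  "supp h = closure {x. h x \<noteq> 0}"

text \<open>The \<open>\<S>\<close>-valued integral over translations is computed pointwise, since point evaluations
  are continuous on \<open>\<S>\<close>.\<close>

definition translation_smearing ::
  "('s::finite minkowski list \<Rightarrow> complex) \<Rightarrow> ('s minkowski \<Rightarrow> complex) \<Rightarrow>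
   's minkowski list \<Rightarrow> complex" where
  "translation_smearing f h = (\<lambda>xs. LINT a|lborel. poincare (mat 1) a f xs * h a)"

definition spectral_ideal :: "('s::finite minkowski list \<Rightarrow> complex) set" where
  "spectral_ideal = \<Inter> {J. left_ideal J \<and>
     {translation_smearing f (\<lambda>a. h [a]) | f h.
        f \<in> borchers \<and> h \<in> borchers_comp 1 \<and>
        supp (mink_fourier (\<lambda>a. h [a])) \<inter> forward_cone = {}} \<subseteq> J}"

definition locality_ideal :: "('s::finite minkowski list \<Rightarrow> complex) set" where
  "locality_ideal = \<Inter> {J. two_sided_ideal J \<and>
     {(\<lambda>xs. tensor f h xs - tensor h f xs) | f h.
        f \<in> borchers_comp 1 \<and> h \<in> borchers_comp 1 \<and>
        (\<forall>x \<in> supp (\<lambda>a. f [a]). \<forall>y \<in> supp (\<lambda>a. h [a]). spacelike (x - y))} \<subseteq> J}"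

section \<open>The associated quantum field theory with indefinite metric\<close>

text \<open>The completions are described up to isometric isomorphism, by a linear map into a Hilbert
  space that has a dense range and is isometric for the given norm: \<open>\<iota>\<close> is the completion \<open>\<H>\<^sub>1\<close>
  of the Borchers algebra, \<open>\<pi>\<close> is the quotient map \<open>\<H>\<^sub>1 \<rightarrow> \<H>\<^sub>2\<close>, and \<open>J\<close> is the canonical map
  from \<open>\<H>\<^sub>2\<close> (which contains \<open>\<D>\<close>) into the completion \<open>\<H>\<close> of \<open>\<D>\<close>. The scalar product of the
  type \<open>'h\<close> is the one of this completion, \<open>\<eta>\<^sub>0\<close> is the extension of \<open>sign(\<eta>\<^sub>2)\<close>, and
  \<open>ip\<close> and \<open>\<eta>\<close> are the final scalar product of \<open>\<H>\<close> and its metric operator.\<close>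

locale indefinite_metric_qft =
  fixes W :: "('v::euclidean_space list \<Rightarrow> complex) \<Rightarrow> complex"
    and p q :: "('v list \<Rightarrow> complex) \<Rightarrow> real"
    and \<iota> :: "('v list \<Rightarrow> complex) \<Rightarrow> 'h1::complex_hilbert_space"
    and form1 :: "'h1 \<Rightarrow> 'h1 \<Rightarrow> complex"
    and \<pi> :: "'h1 \<Rightarrow> 'h2::complex_hilbert_space"
    and \<eta>\<^sub>2 abs_\<eta>\<^sub>2 sign_\<eta>\<^sub>2 :: "'h2 \<Rightarrow> 'h2"
    and J :: "'h2 \<Rightarrow> 'h::complex_hilbert_space"
    and \<eta>\<^sub>0 :: "'h \<Rightarrow> 'h"
    and ip :: "'h \<Rightarrow> 'h \<Rightarrow> complex"
    and \<eta> :: "'h \<Rightarrow> 'h"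
  assumes q: "construction_norm p q"
    and \<iota>_add: "\<And>f g. f \<in> borchers \<Longrightarrow> g \<in> borchers \<Longrightarrow> \<iota> (\<lambda>xs. f xs + g xs) = \<iota> f + \<iota> g"
    and \<iota>_scale: "\<And>c f. f \<in> borchers \<Longrightarrow> \<iota> (\<lambda>xs. c * f xs) = c *\<^sub>C \<iota> f"
    and \<iota>_isometric: "\<And>f. f \<in> borchers \<Longrightarrow> norm (\<iota> f) = q f"
    and \<iota>_dense: "closure (\<iota> ` borchers) = UNIV"
    and form1_continuous: "continuous_on UNIV (\<lambda>(v, w). form1 v w)"
    and form1_extends: "\<And>f g. f \<in> borchers \<Longrightarrow> g \<in> borchers \<Longrightarrow>
           form1 (\<iota> f) (\<iota> g) = W (tensor (star f) g)"
    and \<pi>_linear: "clinear \<pi>"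
    and \<pi>_surj: "surj \<pi>"
    and \<pi>_kernel: "{v. \<pi> v = 0} = {v. \<forall>w. form1 w v = 0}"
    and \<pi>_quotient_norm: "\<And>v. norm (\<pi> v) = infdist v {u. \<forall>w. form1 w u = 0}"
    and \<eta>\<^sub>2: "\<And>v w. form1 v w = cinner (\<pi> v) (\<eta>\<^sub>2 (\<pi> w))"
    and abs_\<eta>\<^sub>2: "is_operator_abs \<eta>\<^sub>2 abs_\<eta>\<^sub>2"
    and sign_\<eta>\<^sub>2: "is_operator_sign \<eta>\<^sub>2 sign_\<eta>\<^sub>2"
    and J_linear: "clinear J"
    and J_isometric: "\<And>v w. cinner (J v) (J w) = cinner v (abs_\<eta>\<^sub>2 w)"
    and J_dense: "closure (J ` \<pi> ` \<iota> ` borchers) = UNIV"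
    and \<eta>\<^sub>0_bounded: "bounded_clinear \<eta>\<^sub>0"
    and \<eta>\<^sub>0_extends: "\<And>v. \<eta>\<^sub>0 (J v) = J (sign_\<eta>\<^sub>2 v)"
    and ip: "equivalent_scalar_product ip"
    and \<eta>_metric: "\<And>v w. ip v (\<eta> w) = cinner v (\<eta>\<^sub>0 w)"
    and \<eta>_selfadjoint: "\<And>v w. ip (\<eta> v) w = ip v (\<eta> w)"
    and \<eta>_involution: "\<And>v. \<eta> (\<eta> v) = v"
    and \<eta>_vacuum: "\<eta> (J (\<pi> (\<iota> unit_elem))) = J (\<pi> (\<iota> unit_elem))"

text \<open>With \<open>V f \<in> \<H>\<close> denoting the vector given by the class of \<open>f\<close>, so that \<open>\<D>\<close> is the image of
  \<open>V\<close>, the operator \<open>U(\<Lambda>, a)\<close> on \<open>\<D>\<close> sends \<open>V g\<close> to \<open>V (\<alpha>\<^bsub>{\<Lambda>,a}\<^esub> g)\<close>.\<close>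

definition poincare_rep ::
  "(('s::finite minkowski list \<Rightarrow> complex) \<Rightarrow> 'h) \<Rightarrow>
   real ^ 's option ^ 's option \<Rightarrow> 's minkowski \<Rightarrow> 'h \<Rightarrow> 'h" where
  "poincare_rep V L a v = V (poincare L a (inv_into borchers V v))"

end

theory Submission
  imports Defs "HOL-Complex_Analysis.Cauchy_Integral_Formula"
begin

text \<open>The analytic vectors are the classes of the regularised test functions
  \<open>\<Phi> f g = \<integral> g(t) \<alpha>\<^sub>t(f) dt\<close>, where \<open>\<alpha>\<^sub>t\<close> are the boosts and \<open>g\<close> is an entire function that decays
  faster than any exponential on horizontal strips. The integral is again a Schwartz function, and
  its Schwartz norms are bounded by integrals of \<open>\<bar>g(t)\<bar> exp(K \<bar>t\<bar>)\<close>. As \<open>U(t)\<close> translates \<open>g\<close>, the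
  generator differentiates it, and Cauchy's inequalities show that \<open>U(z)\<close> maps \<open>\<Phi> f g\<close> to
  \<open>\<Phi> f (g(\<cdot> - z))\<close>; narrow Gaussians \<open>g\<close> give density. All other claims are tested against these
  vectors with the form \<open>\<langle>v, w\<rangle>\<close>, which is nondegenerate and for which the generator is symmetric:
  \<open>\<langle>w, U(z) v\<rangle> = \<langle>U(-z\<^sup>*) w, v\<rangle>\<close>. That this form is the one induced by \<open>W\<close> requires
  \<open>\<bar>\<eta>\<^sub>2\<bar> sign(\<eta>\<^sub>2) = \<eta>\<^sub>2\<close>, i.e. that the sign commutes with the absolute value.\<close>

section \<open>Complex Hilbert spaces\<close>

text \<open>The boosts preserve only the indefinite form. No bound on the operators
  \<open>U t\<close> is at hand, so neither Stone's theorem nor isometry estimates apply. Norms of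
  vectors are controlled only by Sobolev domination, that is by one Schwartz norm in each degree,
  and Schwartz norms grow along boost orbits like exp (K |t|) with K depending on the vector; this
  is why the smearing weight has to beat every exponential. Identities between vectors beyond the
  smeared ones are obtained weakly, by moving the group to the other side of the form. A second
  obstacle is that \<open>Uc z \<Psi>\<close> is not known to be analytic again, so on all analytic
  vectors the group law cannot be a plain composition on one domain. It is shown where the composite
  stays in the domain, and in general through the closure of the operator; the smeared vectors, a
  dense set on which every \<open>Uc z\<close> acts, serve as test vectors for both.\<close>

lemma cinner_add_left: "cinner (x + y) z = cinner x z + cinner (y::'a::complex_hilbert_space) z"
  by (metis cinner_add_right cinner_commute complex_cnj_add)

lemma cinner_scaleC_left: "cinner (c *\<^sub>C x) (y::'a::complex_hilbert_space) = cnj c * cinner x y"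
  by (metis cinner_scaleC_right cinner_commute complex_cnj_mult)

lemma scaleC_minus_one: "(-1) *\<^sub>C x = - (x::'a::complex_hilbert_space)"
  using scaleC_of_real[of "-1" x] by simp

lemma cinner_minus_right: "cinner x (- y) = - cinner x (y::'a::complex_hilbert_space)"
  using cinner_scaleC_right[of x "-1" y] by (simp add: scaleC_minus_one)

lemma cinner_minus_left: "cinner (- x) y = - cinner x (y::'a::complex_hilbert_space)"
  using cinner_scaleC_left[of "-1" x y] by (simp add: scaleC_minus_one)

lemma cinner_diff_right: "cinner x (y - z) = cinner x y - cinner x (z::'a::complex_hilbert_space)"
  using cinner_add_right[of x y "- z"] by (simp add: cinner_minus_right)

lemma cinner_diff_left: "cinner (x - y) z = cinner x z - cinner y (z::'a::complex_hilbert_space)"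
  using cinner_add_left[of x "- y" z] by (simp add: cinner_minus_left)

lemma cinner_zero_right [simp]: "cinner x 0 = (0::complex)"
  using cinner_diff_right[of x x x] by simp

lemma cinner_self_eq_0: "cinner x x = 0 \<longleftrightarrow> x = (0::'a::complex_hilbert_space)"
  by (simp add: cinner_self)

lemma scaleC_zero_right [simp]: "c *\<^sub>C (0::'a::complex_hilbert_space) = 0"
  using scaleC_add_right[of c "0::'a" 0] by simp

lemma scaleC_zero_left [simp]: "0 *\<^sub>C (x::'a::complex_hilbert_space) = 0"
  using scaleC_of_real[of 0 x] by simp

lemma scaleC_one [simp]: "1 *\<^sub>C (x::'a::complex_hilbert_space) = x"
  using scaleC_of_real[of 1 x] by simp

lemma scaleC_minus_right: "c *\<^sub>C (- x) = - (c *\<^sub>C (x::'a::complex_hilbert_space))"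
  by (metis scaleC_minus_one scaleC_scaleC mult.commute)

lemma scaleC_minus_left: "(- c) *\<^sub>C x = - (c *\<^sub>C (x::'a::complex_hilbert_space))"
  by (metis mult_minus1 scaleC_minus_one scaleC_scaleC)

lemma scaleC_diff_right: "c *\<^sub>C (x - y) = c *\<^sub>C x - c *\<^sub>C (y::'a::complex_hilbert_space)"
  using scaleC_add_right[of c x "- y"] by (simp add: scaleC_minus_right)

lemma cmod_of_real_square: "z * cnj z = (complex_of_real (cmod z))\<^sup>2"
  by (metis complex_norm_square of_real_power)

lemma norm_scaleC: "norm (c *\<^sub>C x) = cmod c * norm (x::'a::complex_hilbert_space)"
proof -
  have "complex_of_real ((norm (c *\<^sub>C x))\<^sup>2) = cnj c * (c * cinner x x)"
    unfolding cinner_self[symmetric] by (simp add: cinner_scaleC_left cinner_scaleC_right)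
  also have "\<dots> = complex_of_real ((cmod c * norm x)\<^sup>2)"
    unfolding of_real_mult of_real_power power_mult_distrib
    by (simp add: cinner_self cmod_of_real_square[symmetric] mult_ac)
  finally have "(norm (c *\<^sub>C x))\<^sup>2 = (cmod c * norm x)\<^sup>2"
    using of_real_eq_iff by blast
  then show ?thesis
    by (simp add: power2_eq_iff_nonneg)
qed

lemma bounded_bilinear_scaleC:
  "bounded_bilinear (\<lambda>c (x::'a::complex_hilbert_space). c *\<^sub>C x)"
proof
  show "\<exists>K. \<forall>a b. norm (a *\<^sub>C (b::'a)) \<le> norm a * norm b * K"
    by (rule exI[of _ 1]) (simp add: norm_scaleC)
  show "(r *\<^sub>R a) *\<^sub>C b = r *\<^sub>R (a *\<^sub>C b)" for r a and b :: 'a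
    by (simp add: scaleC_of_real[symmetric] scaleC_scaleC scaleR_conv_of_real)
  show "a *\<^sub>C (r *\<^sub>R b) = r *\<^sub>R (a *\<^sub>C b)" for r a and b :: 'a
    by (simp add: scaleC_of_real[symmetric] scaleC_scaleC mult_ac)
qed (simp_all add: scaleC_add_left scaleC_add_right)

lemmas tendsto_scaleC = bounded_bilinear.tendsto[OF bounded_bilinear_scaleC]

lemma clinearD:
  assumes "clinear T"
  shows clinear_add: "T (x + y) = T x + T y" and clinear_scaleC: "T (c *\<^sub>C x) = c *\<^sub>C T x"
    and clinear_zero: "T 0 = 0" and clinear_minus: "T (- x) = - T x"
    and clinear_diff: "T (x - y) = T x - T y"
proof -
  show *: "T (x + y) = T x + T y" "T (c *\<^sub>C x) = c *\<^sub>C T x" for x y c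
    using assms by (auto simp: clinear_def)
  show "T 0 = 0" using *(2)[of 0 0] by simp
  show m: "T (- x) = - T x" for x using *(2)[of "-1" x] by (simp add: scaleC_minus_one)
  show "T (x - y) = T x - T y" using *(1)[of x "- y"] m by simp
qed

lemma bounded_clinear_bound:
  assumes "bounded_clinear T"
  obtains C where "C > 0" "\<And>x. norm (T x) \<le> C * norm x"
proof -
  obtain C where C: "\<And>x. norm (T x) \<le> C * norm x"
    using assms by (auto simp: bounded_clinear_def)
  show ?thesis
  proof
    show "\<bar>C\<bar> + 1 > 0" by simp
    show "norm (T x) \<le> (\<bar>C\<bar> + 1) * norm x" for x
      using C[of x] by (rule order_trans) (auto intro!: mult_right_mono)
  qed
qed

lemma bounded_clinear_imp_bounded_linear:
  assumes "bounded_clinear T" shows "bounded_linear T"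
proof -
  have l: "clinear T" using assms by (simp add: bounded_clinear_def)
  obtain C where C: "\<And>x. norm (T x) \<le> C * norm x"
    using assms by (auto simp: bounded_clinear_def)
  show ?thesis
  proof
    show "T (x + y) = T x + T y" for x y by (rule clinear_add[OF l])
    show "T (r *\<^sub>R x) = r *\<^sub>R T x" for r x
      using clinear_scaleC[OF l, of "of_real r" x] by (simp add: scaleC_of_real)
    show "\<exists>K. \<forall>x. norm (T x) \<le> norm x * K" by (rule exI[of _ C]) (simp add: C mult.commute)
  qed
qed

subsection \<open>Positive operators\<close>

text \<open>The conditions of \<open>is_operator_abs\<close> that do not mention the square, so that
  two candidates for a root can be compared.\<close>

definition positive_op :: "('a::complex_hilbert_space \<Rightarrow> 'a) \<Rightarrow> bool" where
  "positive_op T \<longleftrightarrow> bounded_clinear T \<and> (\<forall>x. cinner x (T x) \<in> \<real> \<and> 0 \<le> Re (cinner x (T x)))"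

lemma positive_op_clinear: "positive_op T \<Longrightarrow> clinear T"
  by (simp add: positive_op_def bounded_clinear_def)

text \<open>Polarisation: a form that is real on the diagonal is Hermitian, since its values at
  \<open>x + y\<close> and \<open>x + \<i> *\<^sub>C y\<close> give the imaginary and the real part
  of the claim.\<close>

lemma positive_op_symmetric:
  assumes "positive_op T"
  shows "cinner x (T y) = cinner (T x) y"
proof -
  have l: "clinear T" using assms by (rule positive_op_clinear)
  have im: "Im (cinner z (T z)) = 0" for z
    using assms by (auto simp: positive_op_def complex_is_Real_iff)
  have "Im (cinner x (T y)) + Im (cinner y (T x)) = 0"
    using im[of "x + y"] im[of x] im[of y]
    by (simp add: clinearD[OF l] cinner_add_left cinner_add_right)
  moreover have "Re (cinner x (T y)) - Re (cinner y (T x)) = 0"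
    using im[of "x + \<i> *\<^sub>C y"] im[of x] im[of y]
    by (simp add: clinearD[OF l] cinner_add_left cinner_add_right cinner_scaleC_left cinner_scaleC_right)
  ultimately have "cinner x (T y) = cnj (cinner y (T x))"
    by (simp add: complex_eq_iff)
  then show ?thesis by (metis cinner_commute)
qed

text \<open>The quadratic form at \<open>x + c *\<^sub>C y\<close> is a nonnegative quadratic
  polynomial in a real parameter. As the form of \<open>T\<close> may be degenerate, a vanishing
  leading coefficient is treated apart.\<close>

lemma positive_op_Cauchy_Schwarz:
  assumes "positive_op T"
  shows "(cmod (cinner x (T y)))\<^sup>2 \<le> Re (cinner x (T x)) * Re (cinner y (T y))"
proof -
  have l: "clinear T" using assms by (rule positive_op_clinear)
  define a b h where "a = Re (cinner x (T x))" and "b = Re (cinner y (T y))" and "h = cinner x (T y)"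
  have pos: "cinner z (T z) = of_real (Re (cinner z (T z)))" "0 \<le> Re (cinner z (T z))" for z
    using assms by (auto simp: positive_op_def complex_is_Real_iff complex_eq_iff)
  have yx: "cinner y (T x) = cnj h"
    unfolding h_def using positive_op_symmetric[OF assms] cinner_commute by metis
  have quad: "0 \<le> a + 2 * r * (cmod h)\<^sup>2 + r\<^sup>2 * (cmod h)\<^sup>2 * b" for r
  proof -
    \<comment> \<open>The factor \<open>cnj h\<close> cancels the phase of \<open>h\<close>, so that
      only a real parameter remains.\<close>
    define c where "c = of_real r * cnj h"
    have "cinner (x + c *\<^sub>C y) (T (x + c *\<^sub>C y)) =
        of_real a + c * h + cnj c * cnj h + cnj c * c * of_real b"
      using pos(1)[of x] pos(1)[of y] yx
      by (simp add: clinearD[OF l] cinner_add_left cinner_add_right cinner_scaleC_left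
          cinner_scaleC_right a_def b_def h_def algebra_simps)
    also have "\<dots> = of_real (a + 2 * r * (cmod h)\<^sup>2 + r\<^sup>2 * (cmod h)\<^sup>2 * b)"
    proof -
      have "c * h + cnj c * cnj h + cnj c * c * of_real b
          = 2 * of_real r * (h * cnj h) + (of_real r)\<^sup>2 * (h * cnj h) * of_real b"
        unfolding c_def by (simp add: algebra_simps power2_eq_square)
      then show ?thesis unfolding cmod_of_real_square by (simp add: algebra_simps)
    qed
    finally show ?thesis using pos(2)[of "x + c *\<^sub>C y"] by (metis Re_complex_of_real)
  qed
  show ?thesis
  proof (cases "b = 0")
    case True
    have "cmod h = 0"
    proof (rule ccontr)
      assume "cmod h \<noteq> 0"
      then have p: "(cmod h)\<^sup>2 > 0" by simp
      \<comment> \<open>For \<open>b = 0\<close> the polynomial is affine in \<open>r\<close>; this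
        \<open>r\<close> would give it the value -1.\<close>
      have "0 \<le> a + 2 * (-(a + 1) / (2 * (cmod h)\<^sup>2)) * (cmod h)\<^sup>2" using quad[of "-(a + 1) / (2 * (cmod h)\<^sup>2)"] True by simp
      also have "\<dots> = -1" using p by (simp add: field_simps)
      finally show False by simp
    qed
    then show ?thesis using pos(2)[of x] pos(2)[of y] by (simp add: h_def)
  next
    case False
    then have "b > 0" using pos(2)[of y] by (simp add: b_def)
    \<comment> \<open>The minimiser of the polynomial.\<close>
    have "0 \<le> a + 2 * (-1 / b) * (cmod h)\<^sup>2 + (-1 / b)\<^sup>2 * (cmod h)\<^sup>2 * b" by (rule quad)
    also have "\<dots> = a - (cmod h)\<^sup>2 / b" using \<open>b > 0\<close> by (simp add: field_simps power2_eq_square)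
    finally show ?thesis using \<open>b > 0\<close> by (simp add: field_simps a_def b_def h_def)
  qed
qed

lemma positive_op_id: "positive_op (\<lambda>x::'a::complex_hilbert_space. x)"
  unfolding positive_op_def bounded_clinear_def clinear_def
  by (auto simp: cinner_self intro: exI[of _ 1])

lemma cinner_Cauchy_Schwarz: "cmod (cinner x y) \<le> norm x * norm (y::'a::complex_hilbert_space)"
proof -
  have "(cmod (cinner x y))\<^sup>2 \<le> (norm x * norm y)\<^sup>2"
    using positive_op_Cauchy_Schwarz[OF positive_op_id, of x y] by (simp add: cinner_self power_mult_distrib)
  then show ?thesis by (rule power2_le_imp_le) simp
qed

lemma bounded_bilinear_cinner: "bounded_bilinear (cinner :: 'a::complex_hilbert_space \<Rightarrow> 'a \<Rightarrow> complex)"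
proof
  show "\<exists>K. \<forall>a b. norm (cinner a (b::'a)) \<le> norm a * norm b * K"
    by (rule exI[of _ 1]) (simp add: cinner_Cauchy_Schwarz)
  show "cinner (r *\<^sub>R a) b = r *\<^sub>R cinner a b" for r and a b :: 'a
    by (simp add: scaleC_of_real[symmetric] cinner_scaleC_left scaleR_conv_of_real)
  show "cinner a (r *\<^sub>R b) = r *\<^sub>R cinner a b" for r and a b :: 'a
    by (simp add: scaleC_of_real[symmetric] cinner_scaleC_right scaleR_conv_of_real)
qed (simp_all add: cinner_add_left cinner_add_right)

lemmas continuous_on_cinner = bounded_bilinear.continuous_on[OF bounded_bilinear_cinner]

lemma norm_diff_square:
  "(norm (x - y))\<^sup>2 = (norm x)\<^sup>2 + (norm y)\<^sup>2 - 2 * Re (cinner x (y::'a::complex_hilbert_space))"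
proof -
  have "complex_of_real ((norm (x - y))\<^sup>2)
      = of_real ((norm x)\<^sup>2) + of_real ((norm y)\<^sup>2) - (cinner x y + cnj (cinner x y))"
    unfolding cinner_self[symmetric] cinner_diff_left cinner_diff_right
    by (subst (4) cinner_commute) simp
  from this[THEN arg_cong[of _ _ Re]] show ?thesis by simp
qed



section \<open>Powers of 1 - T for a positive contraction T\<close>

context
  fixes T :: "'a::complex_hilbert_space \<Rightarrow> 'a"
  assumes T: "positive_op T" and contraction: "\<And>x. norm (T x) \<le> norm x"
begin

text \<open>The operator inequality T^2 \<le> T for 0 \<le> T \<le> 1: Cauchy-Schwarz for the form
  of \<open>T\<close>, applied to \<open>T x\<close> and \<open>x\<close>, leaves a common factor
  \<open>(norm (T x))\<^sup>2\<close>.\<close>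

lemma positive_contraction_norm_le: "(norm (T x))\<^sup>2 \<le> Re (cinner x (T x))"
proof -
  have "(cmod (cinner (T x) (T x)))\<^sup>2 \<le> Re (cinner (T x) (T (T x))) * Re (cinner x (T x))"
    by (rule positive_op_Cauchy_Schwarz[OF T])
  also have "\<dots> \<le> (norm (T x))\<^sup>2 * Re (cinner x (T x))"
  proof (rule mult_right_mono)
    have "Re (cinner (T x) (T (T x))) \<le> norm (T x) * norm (T (T x))"
      using complex_Re_le_cmod cinner_Cauchy_Schwarz order_trans by blast
    also have "\<dots> \<le> norm (T x) * norm (T x)" by (intro mult_left_mono contraction) simp
    finally show "Re (cinner (T x) (T (T x))) \<le> (norm (T x))\<^sup>2" by (simp add: power2_eq_square)
    show "0 \<le> Re (cinner x (T x))" using T by (simp add: positive_op_def)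
  qed
  finally have "(norm (T x))\<^sup>2 * (norm (T x))\<^sup>2 \<le> (norm (T x))\<^sup>2 * Re (cinner x (T x))"
    by (simp add: cinner_self power2_eq_square norm_mult)
  then show ?thesis
  proof (cases "T x = 0")
    case False
    then show ?thesis
      by (intro mult_left_le_imp_le[OF \<open>(norm (T x))\<^sup>2 * (norm (T x))\<^sup>2 \<le> _\<close>]) simp
  qed (use T in \<open>auto simp: positive_op_def\<close>)
qed

abbreviation (input) pow1mT :: "nat \<Rightarrow> 'a \<Rightarrow> 'a" where
  "pow1mT n \<equiv> (\<lambda>x. x - T x) ^^ n"

lemma pow1mT_symmetric: "cinner (pow1mT n x) y = cinner x (pow1mT n y)"
proof (induction n arbitrary: y)
  case (Suc n)
  have "cinner (pow1mT (Suc n) x) y = cinner (pow1mT n x) (y - T y)"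
    by (simp add: cinner_diff_left cinner_diff_right positive_op_symmetric[OF T])
  also have "\<dots> = cinner x (pow1mT (Suc n) y)"
    unfolding Suc using funpow_swap1[of "\<lambda>x. x - T x" n y] by simp
  finally show ?case .
qed simp

text \<open>In the expanded square of y - T y the cross term is at most -2 |T y|^2 by T^2 \<le> T;
  it outweighs the term |T y|^2 and leaves as much again.\<close>

lemma pow1mT_norm_decrease:
  "(norm (pow1mT (Suc n) x))\<^sup>2 + (norm (T (pow1mT n x)))\<^sup>2 \<le> (norm (pow1mT n x))\<^sup>2"
  using norm_diff_square[of "pow1mT n x" "T (pow1mT n x)"]
    positive_contraction_norm_le[of "pow1mT n x"] by simp

lemma pow1mT_norm_le: "norm (pow1mT n x) \<le> norm x"
proof (induction n)
  case (Suc n)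
  have "(norm (pow1mT (Suc n) x))\<^sup>2 \<le> (norm (pow1mT n x))\<^sup>2"
    using pow1mT_norm_decrease[of n x] by (smt (verit) zero_le_power2)
  then show ?case using Suc power2_le_imp_le[OF _ norm_ge_zero] order_trans by blast
qed simp

lemma convergent_pow1mT_norm: "convergent (\<lambda>n. (norm (pow1mT n x))\<^sup>2)"
proof (rule Bseq_monoseq_convergent)
  show "Bseq (\<lambda>n. (norm (pow1mT n x))\<^sup>2)"
    by (rule BseqI'[of _ "(norm x)\<^sup>2"]) (simp add: power_mono pow1mT_norm_le)
  have "(norm (pow1mT (Suc n) x))\<^sup>2 \<le> (norm (pow1mT n x))\<^sup>2" for n
    using pow1mT_norm_decrease[of n x] by (smt (verit) zero_le_power2)
  then show "monoseq (\<lambda>n. (norm (pow1mT n x))\<^sup>2)" by (intro decseq_imp_monoseq decseq_SucI)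
qed

text \<open>The squared norms of (1 - T)^n x decrease to a limit, so their consecutive differences
  tend to 0, and these dominate the squared norms in question.\<close>

lemma T_pow1mT_tendsto_0: "(\<lambda>n. T (pow1mT n x)) \<longlonglongrightarrow> 0"
proof -
  obtain l where l: "(\<lambda>n. (norm (pow1mT n x))\<^sup>2) \<longlonglongrightarrow> l"
    using convergent_pow1mT_norm by (auto simp: convergent_def)
  have "(\<lambda>n. (norm (pow1mT n x))\<^sup>2 - (norm (pow1mT (Suc n) x))\<^sup>2) \<longlonglongrightarrow> l - l"
    by (intro tendsto_diff l LIMSEQ_Suc[OF l])
  then have lim: "(\<lambda>n. (norm (pow1mT n x))\<^sup>2 - (norm (pow1mT (Suc n) x))\<^sup>2) \<longlonglongrightarrow> 0" by simp
  have le: "(norm (T (pow1mT n x)))\<^sup>2 \<le> (norm (pow1mT n x))\<^sup>2 - (norm (pow1mT (Suc n) x))\<^sup>2" for n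
    using pow1mT_norm_decrease[of n x] by linarith
  have "(\<lambda>n. (norm (T (pow1mT n x)))\<^sup>2) \<longlonglongrightarrow> 0"
    by (rule tendsto_sandwich[OF _ _ tendsto_const lim]) (intro always_eventually allI le zero_le_power2)+
  then have "(\<lambda>n. sqrt ((norm (T (pow1mT n x)))\<^sup>2)) \<longlonglongrightarrow> sqrt 0"
    by (rule tendsto_real_sqrt)
  then show ?thesis by (simp add: tendsto_norm_zero_iff)
qed

text \<open>Since \<open>(x\<^sub>2\<^sub>m, x\<^sub>2\<^sub>n) = \<parallel>x\<^sub>m\<^sub>+\<^sub>n\<parallel>\<^sup>2\<close> for \<open>x\<^sub>n = (1 - T)\<^sup>n x\<close>, the sequence \<open>x\<^sub>2\<^sub>n\<close> is Cauchy.\<close>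

lemma pow1mT_tendsto_0:
  assumes inj: "\<And>x. T x = 0 \<Longrightarrow> x = 0"
  shows "(\<lambda>n. pow1mT (2 * n) x) \<longlonglongrightarrow> 0"
proof -
  obtain l where l: "(\<lambda>n. (norm (pow1mT n x))\<^sup>2) \<longlonglongrightarrow> l"
    using convergent_pow1mT_norm by (auto simp: convergent_def)
  have inner: "cinner (pow1mT (2 * m) x) (pow1mT (2 * n) x) = of_real ((norm (pow1mT (m + n) x))\<^sup>2)"
    if "m \<le> n" for m n
  proof -
    define k where "k = n - m"
    have n: "2 * n = m + n + k" "m + n = k + 2 * m" "2 * n = k + (m + n)" using that by (auto simp: k_def)
    have "cinner (pow1mT (2 * m) x) (pow1mT (2 * n) x) = cinner (pow1mT (2 * m) x) (pow1mT k (pow1mT (m + n) x))"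
      unfolding n(3) by (simp only: funpow_add comp_apply)
    also have "\<dots> = cinner (pow1mT k (pow1mT (2 * m) x)) (pow1mT (m + n) x)"
      by (simp add: pow1mT_symmetric)
    also have "pow1mT k (pow1mT (2 * m) x) = pow1mT (m + n) x"
      unfolding n(2) by (simp only: funpow_add comp_apply)
    finally show ?thesis by (simp add: cinner_self)
  qed
  have "Cauchy (\<lambda>n. pow1mT (2 * n) x)"
  proof (rule metric_CauchyI)
    fix e :: real assume e: "e > 0"
    then have "e\<^sup>2 / 4 > 0" by simp
    from LIMSEQ_D[OF l this] obtain N where N: "\<And>n. n \<ge> N \<Longrightarrow> \<bar>(norm (pow1mT n x))\<^sup>2 - l\<bar> < e\<^sup>2 / 4"
      by auto
    have *: "dist (pow1mT (2 * m) x) (pow1mT (2 * n) x) < e" if "N \<le> m" "m \<le> n" for m n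
    proof -
      have "(norm (pow1mT (2 * m) x - pow1mT (2 * n) x))\<^sup>2 =
          (norm (pow1mT (2 * m) x))\<^sup>2 + (norm (pow1mT (2 * n) x))\<^sup>2 - 2 * (norm (pow1mT (m + n) x))\<^sup>2"
        using norm_diff_square[of "pow1mT (2 * m) x" "pow1mT (2 * n) x"] inner[OF that(2)] by simp
      also have "\<dots> < e\<^sup>2"
        using N[of "2 * m", unfolded abs_less_iff] N[of "2 * n", unfolded abs_less_iff]
          N[of "m + n", unfolded abs_less_iff] that by simp
      finally show ?thesis using e power2_less_imp_less[of _ e] by (simp add: dist_norm)
    qed
    show "\<exists>M. \<forall>m\<ge>M. \<forall>n\<ge>M. dist (pow1mT (2 * m) x) (pow1mT (2 * n) x) < e"
      using * by (metis dist_commute nle_le)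
  qed
  then obtain y where y: "(\<lambda>n. pow1mT (2 * n) x) \<longlonglongrightarrow> y"
    using Cauchy_convergent convergent_def by blast
  have "bounded_linear T" using T bounded_clinear_imp_bounded_linear by (auto simp: positive_op_def)
  then have "(\<lambda>n. T (pow1mT (2 * n) x)) \<longlonglongrightarrow> T y" using y by (rule bounded_linear.tendsto)
  moreover have "(\<lambda>n. T (pow1mT (2 * n) x)) \<longlonglongrightarrow> 0"
    using LIMSEQ_subseq_LIMSEQ[OF T_pow1mT_tendsto_0[of x], of "\<lambda>n. 2 * n"]
    by (simp add: strict_mono_def comp_def)
  ultimately have "T y = 0" by (rule LIMSEQ_unique)
  from inj[OF this] show ?thesis using y by blast
qed

lemma diff_pow1mT_in_range: "x - pow1mT n x \<in> range T"
proof (induction n)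
  case 0
  have "clinear T" using T by (rule positive_op_clinear)
  then have "T 0 = 0" by (rule clinear_zero)
  then show ?case by (metis funpow_0 diff_self rangeI)
next
  case (Suc n)
  have l: "clinear T" using T by (rule positive_op_clinear)
  from Suc obtain u where "x - pow1mT n x = T u" by blast
  then have "x - pow1mT (Suc n) x = T (u + pow1mT n x)" by (simp add: clinear_add[OF l])
  then show ?case by blast
qed

end



lemma positive_op_rescale:
  assumes "positive_op T"
  obtains s :: real where "s > 0" "positive_op (\<lambda>x. s *\<^sub>R T x)" "\<And>x. norm (s *\<^sub>R T x) \<le> norm x"
proof -
  obtain C where C: "C > 0" "\<And>x. norm (T x) \<le> C * norm x"
    using assms by (auto simp: positive_op_def intro: bounded_clinear_bound)
  have l: "clinear T" using assms by (rule positive_op_clinear)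
  have nb: "norm ((1 / C) *\<^sub>R T x) \<le> norm x" for x using C(2)[of x] C(1) by (simp add: field_simps)
  show ?thesis
  proof
    show "1 / C > 0" using C by simp
    have "clinear (\<lambda>x. (1 / C) *\<^sub>R T x)"
      unfolding scaleC_of_real[symmetric] clinear_def
      by (simp add: clinear_add[OF l] clinear_scaleC[OF l] scaleC_add_right scaleC_scaleC mult_ac)
    moreover have "cinner x ((1 / C) *\<^sub>R T x) = of_real (1 / C) * cinner x (T x)" for x
      by (simp add: scaleC_of_real[symmetric] cinner_scaleC_right)
    ultimately show "positive_op (\<lambda>x. (1 / C) *\<^sub>R T x)"
      using assms C(1) unfolding positive_op_def bounded_clinear_def
      by (intro conjI allI exI[of _ 1]) (use nb in \<open>auto simp: complex_is_Real_iff\<close>)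
    show "norm ((1 / C) *\<^sub>R T x) \<le> norm x" for x by (rule nb)
  qed
qed

text \<open>The approximants are x - (1 - s T)^(2n) x. They lie in the range because 1 - (1 - s T)^n
  is divisible by \<open>T\<close>; no orthogonal complement is formed.\<close>

lemma positive_injective_dense_range:
  assumes "positive_op T" and inj: "\<And>x. T x = 0 \<Longrightarrow> x = 0"
  shows "closure (range T) = UNIV"
proof -
  obtain s :: real where s: "s > 0" "positive_op (\<lambda>x. s *\<^sub>R T x)" "\<And>x. norm (s *\<^sub>R T x) \<le> norm x"
    using positive_op_rescale[OF assms(1)] by metis
  have l: "clinear T" using assms(1) by (rule positive_op_clinear)
  have "x \<in> closure (range T)" for x
  proof -
    have "(\<lambda>n. x - ((\<lambda>x. x - s *\<^sub>R T x) ^^ (2 * n)) x) \<longlonglongrightarrow> x - 0"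
      by (intro tendsto_diff tendsto_const pow1mT_tendsto_0[OF s(2,3)]) (use inj s(1) in auto)
    moreover have "range (\<lambda>x. s *\<^sub>R T x) \<subseteq> range T"
      by (auto simp: scaleC_of_real[symmetric] clinear_scaleC[OF l, symmetric])
    then have "x - ((\<lambda>x. x - s *\<^sub>R T x) ^^ (2 * n)) x \<in> range T" for n
      using diff_pow1mT_in_range[OF s(2,3), of x "2 * n"] by blast
    ultimately show ?thesis unfolding closure_sequential by fastforce
  qed
  then show ?thesis by blast
qed

text \<open>For \<open>A, B \<ge> 0\<close> with \<open>A\<^sup>2 = B\<^sup>2\<close> the operator \<open>D = A - B\<close> satisfies \<open>A D = - D B\<close>. Hence
  \<open>(1 + s A)\<^sup>n D = D (1 - s B)\<^sup>n\<close>, where the left-hand side is bounded below by \<open>D\<close>.\<close>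

lemma positive_sqrt_unique:
  assumes A: "positive_op A" and B: "positive_op B"
    and square: "\<And>x. A (A x) = B (B x)" and inj: "\<And>x. B x = 0 \<Longrightarrow> x = 0"
  shows "A x = B x"
proof -
  define D where "D = (\<lambda>x. A x - B x)"
  have lA: "clinear A" and lB: "clinear B" using A B by (simp_all add: positive_op_clinear)
  obtain s :: real where s: "s > 0" "positive_op (\<lambda>x. s *\<^sub>R B x)" "\<And>x. norm (s *\<^sub>R B x) \<le> norm x"
    using positive_op_rescale[OF B] by metis
  have bD: "bounded_linear D" unfolding D_def
    using A B unfolding positive_op_def
    by (intro bounded_linear_sub bounded_clinear_imp_bounded_linear) simp_all
  have AD: "D y + s *\<^sub>R A (D y) = D (y - s *\<^sub>R B y)" for y
  proof -
    have "A (D y) = - D (B y)" by (simp add: D_def clinear_diff[OF lA] clinear_diff[OF lB] square)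
    then show ?thesis
      by (simp add: linear_diff[OF bounded_linear.linear[OF bD]] linear_scale[OF bounded_linear.linear[OF bD]])
  qed
  have lower: "norm y \<le> norm (y + s *\<^sub>R A y)" for y
  proof (rule power2_le_imp_le)
    have "(norm (y - (- s) *\<^sub>R A y))\<^sup>2 = (norm y)\<^sup>2 + (norm (s *\<^sub>R A y))\<^sup>2 + 2 * s * Re (cinner y (A y))"
      unfolding norm_diff_square
      by (simp add: scaleC_of_real[symmetric] cinner_scaleC_right del: of_real_minus) (simp add: scaleC_of_real cinner_minus_right scaleC_minus_left cinner_scaleC_right)
    then show "(norm y)\<^sup>2 \<le> (norm (y + s *\<^sub>R A y))\<^sup>2" using A s(1) by (simp add: positive_op_def)
  qed simp
  have bound: "norm (D y) \<le> norm (D (((\<lambda>x. x - s *\<^sub>R B x) ^^ n) y))" for n y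
  proof (induction n)
    case (Suc n)
    show ?case using Suc lower[of "D (((\<lambda>x. x - s *\<^sub>R B x) ^^ n) y)"] by (simp add: AD)
  qed simp
  have "(\<lambda>n. norm (D (((\<lambda>x. x - s *\<^sub>R B x) ^^ (2 * n)) x))) \<longlonglongrightarrow> norm (D 0)"
    by (intro tendsto_norm bounded_linear.tendsto[OF bD] pow1mT_tendsto_0[OF s(2,3)])
       (use inj s(1) in auto)
  then have "norm (D x) \<le> norm (D 0)"
    by (rule LIMSEQ_le_const) (use bound in blast)
  also have "D 0 = 0" using bD by (simp add: bounded_linear.linear linear_0)
  finally show ?thesis by (simp add: D_def)
qed

lemma eq_on_dense:
  fixes f g :: "'a::topological_space \<Rightarrow> 'b::t2_space"
  assumes "closure S = UNIV" "continuous_on UNIV f" "continuous_on UNIV g" "\<And>x. x \<in> S \<Longrightarrow> f x = g x"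
  shows "f x = g x"
proof -
  have "closed {x. f x = g x}" using assms(2,3) by (rule closed_Collect_eq)
  then have "closure S \<subseteq> {x. f x = g x}" using assms(4) by (intro closure_minimal) auto
  then show ?thesis using assms(1) by auto
qed

text \<open>The sign \<open>V\<close> is isometric with \<open>S V = \<bar>S\<bar>\<close>, so \<open>V S\<close> is a positive square root of \<open>S\<^sup>2\<close>,
  whence \<open>V S = \<bar>S\<bar> = S V\<close>.\<close>

lemma operator_abs_sign:
  assumes sym: "\<And>x y. cinner x (S y) = cinner (S x) y" and inj: "\<And>x. S x = 0 \<Longrightarrow> x = 0"
    and abs: "is_operator_abs S T" and sign: "is_operator_sign S V"
  shows "T (V x) = S x"
proof -
  obtain T' where T': "is_operator_abs S T'" "\<And>x. V (T' x) = S x"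
    and bV: "bounded_clinear V" using sign by (auto simp: is_operator_sign_def)
  have pos: "positive_op T" "positive_op T'" and sq: "\<And>x. T (T x) = S (S x)" "\<And>x. T' (T' x) = S (S x)"
    using abs T'(1) by (auto simp: is_operator_abs_def positive_op_def)
  have lT: "clinear T" using pos(1) by (rule positive_op_clinear)
  have bT: "bounded_clinear T" using pos(1) by (simp add: positive_op_def)
  have S0: "S 0 = 0"
    using sym[of "S 0" 0] by (metis cinner_self_eq_0 cinner_zero_right)
  have injT: "x = 0" if "T x = 0" for x
  proof -
    have "S (S x) = 0" using sq(1)[of x] that clinear_zero[OF lT] by simp
    then show ?thesis using inj by blast
  qed
  \<comment> \<open>\<open>is_operator_sign\<close> brings its own absolute value \<open>T'\<close>;
    uniqueness of the positive root identifies it with the given one.\<close>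
  have "T' = T" using positive_sqrt_unique[OF pos(2,1)] sq injT by (metis ext)
  with T'(2) have VT: "V (T x) = S x" for x by simp
  have lV: "clinear V" using bV by (simp add: bounded_clinear_def)
  have S_eq: "S = (\<lambda>x. V (T x))" by (simp add: VT)
  have lS: "clinear S" unfolding S_eq clinear_def
    by (simp add: clinear_add[OF lV] clinear_add[OF lT] clinear_scaleC[OF lV] clinear_scaleC[OF lT])
  note blin = bounded_clinear_imp_bounded_linear[OF bV] bounded_clinear_imp_bounded_linear[OF bT]
  have blS: "bounded_linear S" unfolding S_eq using blin by (rule bounded_linear_compose)
  note cont = blin[THEN linear_continuous_on] blS[THEN linear_continuous_on]
  have dT: "closure (range T) = UNIV" using pos(1) injT by (rule positive_injective_dense_range)
  have SV: "S (V x) = T x" for x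
  proof (rule eq_on_dense[OF dT, where f = "\<lambda>x. S (V x)" and g = T and x = x])
    show "continuous_on UNIV (\<lambda>x. S (V x))"
      by (rule linear_continuous_on[OF bounded_linear_compose[OF blS blin(1)]])
    show "continuous_on UNIV T" by (rule cont)
    show "S (V y) = T y" if "y \<in> range T" for y using that VT sq(1) by auto
  qed
  \<comment> \<open>On the range of \<open>T\<close> this reads (S x, S y) = (T x, T y), by symmetry
    and equal squares; density extends it one variable at a time.\<close>
  have isom: "cinner (V x) (V y) = cinner x y" for x y
  proof -
    have 1: "cinner (V (T x)) (V (T y)) = cinner (T x) (T y)" for x y
      unfolding VT using sym positive_op_symmetric[OF pos(1)] sq(1) by metis
    have 2: "cinner (V x) (V (T y)) = cinner x (T y)" for x y
      by (rule eq_on_dense[OF dT, where f = "\<lambda>x. cinner (V x) (V (T y))" and g = "\<lambda>x. cinner x (T y)"])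
         (auto intro!: continuous_on_cinner cont continuous_on_id continuous_on_const 1)
    show ?thesis
      by (rule eq_on_dense[OF dT, where f = "\<lambda>y. cinner (V x) (V y)" and g = "\<lambda>y. cinner x y"])
         (auto intro!: continuous_on_cinner cont continuous_on_id continuous_on_const 2)
  qed
  have dV: "closure (range V) = UNIV"
  proof -
    have "range T \<subseteq> closure (range V)"
    proof -
      have "range S \<subseteq> range V" using VT by (metis image_subsetI rangeI)
      have "T y \<in> closure (range V)" for y
      proof -
        have "S (V y) \<in> range V" using \<open>range S \<subseteq> range V\<close> by blast
        then show ?thesis using SV closure_subset by fastforce
      qed
      then show ?thesis by blast
    qed
    then have "closure (range T) \<subseteq> closure (range V)" by (rule closure_minimal) simp
    then show ?thesis using dT by auto
  qed
  have posVS: "positive_op (\<lambda>x. V (S x))"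
  proof -
    have "bounded_clinear (\<lambda>x. V (S x))"
    proof -
      obtain K where "\<And>x. norm (V (S x)) \<le> norm x * K"
        using bounded_linear.bounded[OF bounded_linear_compose[OF blin(1) blS]] by auto
      then show ?thesis unfolding bounded_clinear_def clinear_def
        by (auto simp: clinear_add[OF lV] clinear_add[OF lS] clinear_scaleC[OF lV]
            clinear_scaleC[OF lS] mult.commute intro!: exI[of _ K])
    qed
    moreover have "cinner x (V (S x)) \<in> \<real> \<and> 0 \<le> Re (cinner x (V (S x)))" for x
    proof -
      let ?P = "{x. cinner x (V (S x)) \<in> \<real>} \<inter> {x. 0 \<le> Re (cinner x (V (S x)))}"
      have c: "continuous_on UNIV (\<lambda>x. cinner x (V (S x)))"
        by (intro continuous_on_cinner continuous_on_id
            linear_continuous_on[OF bounded_linear_compose[OF blin(1) blS]])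
      have "closed ?P"
        unfolding complex_is_Real_iff mem_Collect_eq
        by (intro closed_Int closed_Collect_eq closed_Collect_le continuous_intros c)
      \<comment> \<open>By isometry, (V x, V S V x) = (x, S V x) = (x, T x).\<close>
      moreover have "range V \<subseteq> ?P"
        using pos(1) by (auto simp: SV isom positive_op_def)
      ultimately have "closure (range V) \<subseteq> ?P" by (rule closure_minimal[rotated])
      then show ?thesis using dV by auto
    qed
    ultimately show ?thesis by (simp add: positive_op_def)
  qed
  have "V (S x) = T x" for x
    using positive_sqrt_unique[OF posVS pos(1)] SV VT sq(1) injT by metis
  then have "V (T (V x)) = V (S x)" using VT SV by metis
  moreover have "u = 0" if "V u = 0" for u using isom[of u u] that by (simp add: cinner_self)
  ultimately show ?thesis
    using clinear_diff[OF lV, of "T (V x)" "S x"] by (metis eq_iff_diff_eq_0)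
qed

section \<open>Schwartz functions of several vectors\<close>

lemma has_vector_derivative_quotient:
  "(f has_vector_derivative D) (at x) \<longleftrightarrow> ((\<lambda>h. (1 / h) *\<^sub>R (f (x + h) - f x)) \<longlongrightarrow> D) (at 0)"
proof -
  have "(f has_vector_derivative D) (at x) \<longleftrightarrow>
      ((\<lambda>h. norm (f (x + h) - f x - h *\<^sub>R D) / norm h) \<longlongrightarrow> 0) (at 0)"
    by (simp add: has_vector_derivative_def has_derivative_at bounded_linear_scaleR_left)
  also have "\<dots> \<longleftrightarrow> ((\<lambda>h. norm ((1 / h) *\<^sub>R (f (x + h) - f x) - D)) \<longlongrightarrow> 0) (at 0)"
  proof (rule tendsto_cong)
    show "\<forall>\<^sub>F h in at 0. norm (f (x + h) - f x - h *\<^sub>R D) / norm h = norm ((1 / h) *\<^sub>R (f (x + h) - f x) - D)"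
    proof (rule eventually_at_filter[THEN iffD2], rule always_eventually, intro allI impI)
      fix h :: real assume "h \<noteq> 0"
      then have "(1 / h) *\<^sub>R (f (x + h) - f x) - D = (1 / h) *\<^sub>R (f (x + h) - f x - h *\<^sub>R D)"
        by (simp add: scaleR_diff_right)
      then show "norm (f (x + h) - f x - h *\<^sub>R D) / norm h = norm ((1 / h) *\<^sub>R (f (x + h) - f x) - D)"
        by (simp add: divide_inverse mult.commute)
    qed
  qed
  also have "\<dots> \<longleftrightarrow> ((\<lambda>h. (1 / h) *\<^sub>R (f (x + h) - f x)) \<longlongrightarrow> D) (at 0)"
    by (simp add: tendsto_norm_zero_iff LIM_zero_iff)
  finally show ?thesis .
qed

lemma vector_derivative_mean_bound:
  fixes f :: "real \<Rightarrow> 'a::real_normed_vector"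
  assumes "convex S" "\<And>s. s \<in> S \<Longrightarrow> (f has_vector_derivative f' s) (at s)"
    and "\<And>s. s \<in> S \<Longrightarrow> norm (f' s) \<le> B" "x \<in> S" "y \<in> S"
  shows "norm (f x - f y) \<le> B * \<bar>x - y\<bar>"
proof -
  have "norm (f x - f y) \<le> B * norm (x - y)"
  proof (rule differentiable_bound[OF assms(1)])
    show "(f has_derivative (\<lambda>h. h *\<^sub>R f' s)) (at s within S)" if "s \<in> S" for s
      using assms(2)[OF that] by (auto simp: has_vector_derivative_def intro: has_derivative_at_withinI)
    show "onorm (\<lambda>h. h *\<^sub>R f' s) \<le> B" if "s \<in> S" for s
      using assms(3)[OF that] by (subst onorm_scaleR_left) (auto intro: bounded_linear_ident simp: onorm_id)
  qed fact+
  then show ?thesis by simp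
qed

text \<open>Dominated convergence for the difference quotients along an arbitrary null sequence: the
  mean value bound dominates them by \<open>w\<close>. Measurability of the derivative is inherited
  from the quotients.\<close>

lemma has_vector_derivative_integral:
  fixes F :: "real \<Rightarrow> 'b \<Rightarrow> complex"
  assumes int: "\<And>s. integrable M (F s)"
    and deriv: "\<And>s t. ((\<lambda>s. F s t) has_vector_derivative F' s t) (at s)"
    and bound: "\<And>s t. norm (F' s t) \<le> w t" and w: "integrable M w"
  shows "((\<lambda>s. LINT t|M. F s t) has_vector_derivative (LINT t|M. F' s\<^sub>0 t)) (at s\<^sub>0)"
  unfolding has_vector_derivative_quotient tendsto_at_iff_sequentially comp_def
proof (intro allI impI)
  fix X :: "nat \<Rightarrow> real" assume X: "\<forall>i. X i \<in> UNIV - {0}" "X \<longlonglongrightarrow> 0"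
  define Q where "Q = (\<lambda>i t. (1 / X i) *\<^sub>R (F (s\<^sub>0 + X i) t - F s\<^sub>0 t))"
  have Q_int: "integrable M (Q i)" for i
    unfolding Q_def by (intro integrable_scaleR_right impI Bochner_Integration.integrable_diff int)
  have Q_lim: "(\<lambda>i. Q i t) \<longlonglongrightarrow> F' s\<^sub>0 t" for t
    using deriv[of t s\<^sub>0] X unfolding has_vector_derivative_quotient tendsto_at_iff_sequentially comp_def Q_def
    by blast
  have "(\<lambda>i. LINT t|M. Q i t) \<longlonglongrightarrow> (LINT t|M. F' s\<^sub>0 t)"
  proof (rule integral_dominated_convergence[OF _ _ w])
    show "F' s\<^sub>0 \<in> borel_measurable M"
      by (rule borel_measurable_LIMSEQ_metric[OF borel_measurable_integrable[OF Q_int] Q_lim])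
    show "Q i \<in> borel_measurable M" for i by (rule borel_measurable_integrable[OF Q_int])
    show "AE t in M. (\<lambda>i. Q i t) \<longlonglongrightarrow> F' s\<^sub>0 t" using Q_lim by simp
    have "norm (Q i t) \<le> w t" for i t
    proof -
      have "norm (F (s\<^sub>0 + X i) t - F s\<^sub>0 t) \<le> w t * \<bar>s\<^sub>0 + X i - s\<^sub>0\<bar>"
        by (rule vector_derivative_mean_bound[OF convex_UNIV deriv bound]) auto
      then have "norm (F (s\<^sub>0 + X i) t - F s\<^sub>0 t) / \<bar>X i\<bar> \<le> w t"
        using X(1) by (simp add: divide_le_eq)
      then show ?thesis unfolding Q_def norm_scaleR by simp
    qed
    then show "AE t in M. norm (Q i t) \<le> w t" for i by simp
  qed
  moreover have "(LINT t|M. Q i t) = (1 / X i) *\<^sub>R ((LINT t|M. F (s\<^sub>0 + X i) t) - (LINT t|M. F s\<^sub>0 t))" for i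
    unfolding Q_def by (simp add: int)
  ultimately show "(\<lambda>i. (1 / X i) *\<^sub>R ((LINT t|M. F (s\<^sub>0 + X i) t) - (LINT t|M. F s\<^sub>0 t)))
      \<longlonglongrightarrow> (LINT t|M. F' s\<^sub>0 t)" by simp
qed

section \<open>Norms and partial derivatives of functions of lists\<close>

lemma sum_list_squares_nonneg [simp]: "0 \<le> (\<Sum>x\<leftarrow>xs. (norm x)\<^sup>2)"
  by (induction xs) auto

lemma list_norm_nonneg [simp]: "0 \<le> list_norm xs"
  by (simp add: list_norm_def)

lemma list_norm_append: "(list_norm (xs @ ys))\<^sup>2 = (list_norm xs)\<^sup>2 + (list_norm ys)\<^sup>2"
  by (simp add: list_norm_def)

lemma norm_nth_le_list_norm: "i < length xs \<Longrightarrow> norm (xs ! i) \<le> list_norm xs"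
proof -
  assume i: "i < length xs"
  have "(norm (xs ! i))\<^sup>2 \<le> (\<Sum>x\<leftarrow>xs. (norm x)\<^sup>2)"
    by (rule member_le_sum_list) (use i in auto)
  then show ?thesis by (simp add: list_norm_def real_le_rsqrt)
qed

lemma list_norm_map_le:
  assumes "\<And>x. norm (f x) \<le> C * norm (g x)" "0 \<le> C"
  shows "list_norm (map f xs) \<le> C * list_norm (map g xs)"
proof -
  have "(\<Sum>x\<leftarrow>xs. (norm (f x))\<^sup>2) \<le> (\<Sum>x\<leftarrow>xs. C\<^sup>2 * (norm (g x))\<^sup>2)"
    using assms power_mono[of "norm (f _)" "C * norm (g _)" 2]
    by (intro sum_list_mono) (auto simp: power_mult_distrib)
  then have "(\<Sum>x\<leftarrow>xs. (norm (f x))\<^sup>2) \<le> C\<^sup>2 * (\<Sum>x\<leftarrow>xs. (norm (g x))\<^sup>2)"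
    by (simp add: sum_list_const_mult)
  then have "sqrt (\<Sum>x\<leftarrow>xs. (norm (f x))\<^sup>2) \<le> sqrt (C\<^sup>2 * (\<Sum>x\<leftarrow>xs. (norm (g x))\<^sup>2))" by simp
  then show ?thesis using assms(2) by (simp add: list_norm_def real_sqrt_mult comp_def)
qed

declare partial.simps [simp del]

text \<open>A relation instead of the total function \<open>partial\<close>, whose value carries no
  information where the derivative does not exist. Lists of other lengths are left out because they
  belong to other components.\<close>

definition has_partial ::
  "nat \<Rightarrow> nat \<Rightarrow> 'v::euclidean_space \<Rightarrow> ('v list \<Rightarrow> complex) \<Rightarrow> ('v list \<Rightarrow> complex) \<Rightarrow> bool" where
  "has_partial n i b f f' \<longleftrightarrow> (\<forall>xs. length xs = n \<longrightarrow>
     ((\<lambda>t. f (xs[i := xs ! i + t *\<^sub>R b])) has_vector_derivative f' xs) (at 0))"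

lemma has_partial_cong:
  assumes "\<And>xs. length xs = n \<Longrightarrow> f xs = g xs" "\<And>xs. length xs = n \<Longrightarrow> f' xs = g' xs"
  shows "has_partial n i b f f' \<longleftrightarrow> has_partial n i b g g'"
  using assms by (simp add: has_partial_def)

lemma partial_eqI: "has_partial n i b f f' \<Longrightarrow> length xs = n \<Longrightarrow> partial (i, b) f xs = f' xs"
  by (simp add: has_partial_def vector_derivative_at partial.simps)

lemma has_partial_add:
  "has_partial n i b f f' \<Longrightarrow> has_partial n i b g g' \<Longrightarrow>
    has_partial n i b (\<lambda>xs. f xs + g xs) (\<lambda>xs. f' xs + g' xs)"
  by (auto simp: has_partial_def intro!: has_vector_derivative_add)

lemma has_partial_cmult:
  "has_partial n i b f f' \<Longrightarrow> has_partial n i b (\<lambda>xs. c * f xs) (\<lambda>xs. c * f' xs)"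
  by (auto simp: has_partial_def intro!: has_vector_derivative_mult_right)

lemma directions_Nil [simp]: "[] \<in> directions n"
  by (simp add: directions_def)

lemma directions_Cons [simp]: "(i, b) # js \<in> directions n \<longleftrightarrow> i < n \<and> b \<in> Basis \<and> js \<in> directions n"
  by (auto simp: directions_def)

lemma directions_append [simp]: "js @ ks \<in> directions n \<longleftrightarrow> js \<in> directions n \<and> ks \<in> directions n"
  by (simp add: directions_def)

lemma partials_Nil [simp]: "partials [] f = f"
  by (simp add: partials_def)

lemma partials_Cons [simp]: "partials (j # js) f = partial j (partials js f)"
  by (simp add: partials_def)

lemma partials_append [simp]: "partials (js @ ks) f = partials js (partials ks f)"
  by (simp add: partials_def)

text \<open>The functions of a family \<open>F \<in> K\<close> are indexed by \<open>w \<in> \<Omega>\<close>; a class of families that is closed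
  under partial derivatives is closed under iterated ones, uniformly in the index.\<close>

lemma partials_in_closed_class:
  assumes closed: "\<And>F i b. F \<in> K \<Longrightarrow> i < n \<Longrightarrow> b \<in> Basis \<Longrightarrow>
      \<exists>F'\<in>K. \<forall>w\<in>\<Omega>. has_partial n i b (F w) (F' w)"
    and "F \<in> K" "js \<in> directions n"
  shows "\<exists>G\<in>K. \<forall>w\<in>\<Omega>. \<forall>xs. length xs = n \<longrightarrow> partials js (F w) xs = G w xs"
  using assms(3)
proof (induction js)
  case Nil then show ?case using assms(2) by auto
next
  case (Cons j js)
  obtain i b where j: "j = (i, b)" by force
  with Cons obtain G where G: "G \<in> K" "\<forall>w\<in>\<Omega>. \<forall>xs. length xs = n \<longrightarrow> partials js (F w) xs = G w xs"
    by auto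
  have "i < n" "b \<in> Basis" using Cons.prems j by auto
  from closed[OF G(1) this] obtain G' where G': "G' \<in> K" "\<forall>w\<in>\<Omega>. has_partial n i b (G w) (G' w)"
    by auto
  have "partials (j # js) (F w) xs = G' w xs" if "w \<in> \<Omega>" "length xs = n" for w xs
  proof -
    have "has_partial n i b (partials js (F w)) (G' w)"
      using G'(2) G(2) that(1) by (subst has_partial_cong[where g = "G w" and g' = "G' w"]) auto
    then show ?thesis unfolding j partials_Cons using that(2) by (rule partial_eqI)
  qed
  with G'(1) show ?case by blast
qed

text \<open>Iterated partial derivatives never have to be computed: on lists of length
  \<open>n\<close> they agree with members of \<open>K\<close>, so continuity and decay are checked
  for the members themselves.\<close>

lemma schwartz_compI:
  assumes closed: "\<And>f i b. f \<in> K \<Longrightarrow> i < n \<Longrightarrow> b \<in> Basis \<Longrightarrow> \<exists>f'\<in>K. has_partial n i b f f'"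
    and cont: "\<And>f. f \<in> K \<Longrightarrow> continuous_on UNIV (\<lambda>x. f (map x [0..<n]))"
    and bound: "\<And>f N. f \<in> K \<Longrightarrow> \<exists>B. \<forall>xs. length xs = n \<longrightarrow> (1 + list_norm xs) ^ N * cmod (f xs) \<le> B"
    and "f \<in> K"
  shows "schwartz_comp n (f :: 'a::euclidean_space list \<Rightarrow> complex)"
proof -
  have ex: "\<exists>g\<in>K. \<forall>xs. length xs = n \<longrightarrow> partials js f xs = g xs" if js: "js \<in> directions n" for js
  proof -
    \<comment> \<open>A single function is a family over the one-element index type.\<close>
    have "\<exists>G\<in>(\<lambda>f (_::unit). f) ` K. \<forall>w\<in>UNIV. \<forall>xs. length xs = n \<longrightarrow> partials js f xs = G w xs"
    proof (rule partials_in_closed_class[OF _ _ js])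
      show "\<exists>F'\<in>(\<lambda>f _. f) ` K. \<forall>w\<in>UNIV. has_partial n i b (F w) (F' w)"
        if "F \<in> (\<lambda>f (_::unit). f) ` K" "i < n" "b \<in> Basis" for F i b
        using that closed[OF _ that(2,3)] by auto
    qed (use \<open>f \<in> K\<close> in auto)
    then show ?thesis by auto
  qed
  show ?thesis unfolding schwartz_comp_def smooth_comp_def
  proof (intro conjI ballI allI impI)
    fix js :: "(nat \<times> 'a) list" assume js: "js \<in> directions n"
    obtain g where g: "g \<in> K" "\<forall>xs. length xs = n \<longrightarrow> partials js f xs = g xs" using ex[OF js] by blast
    show "continuous_on UNIV (\<lambda>x. partials js f (map x [0..<n]))"
      using cont[OF g(1)] g(2) by simp
    show "bdd_above ((\<lambda>xs. (1 + list_norm xs) ^ N * cmod (partials js f xs)) ` {xs. length xs = n})" for N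
      using bound[OF g(1), of N] g(2) by (auto simp: bdd_above_def)
    fix i and b :: 'a and xs :: "'a list"
    assume i: "i < n" "b \<in> Basis" "length xs = n"
    from closed[OF g(1) i(1,2)] obtain g' where "has_partial n i b g g'" by blast
    then show "(\<lambda>t. partials js f (xs[i := xs ! i + t *\<^sub>R b])) differentiable at 0"
      using g(2) i(3) by (auto simp: has_partial_def intro: differentiableI_vector)
  qed
qed

lemma schwartz_has_partial:
  assumes "schwartz_comp n f" "i < n" "b \<in> Basis"
  shows "has_partial n i b f (partial (i, b) f)"
  using assms unfolding schwartz_comp_def smooth_comp_def has_partial_def partial.simps
  by (metis directions_Nil partials_Nil vector_derivative_works)

lemma schwartz_continuous:
  "schwartz_comp n f \<Longrightarrow> continuous_on UNIV (\<lambda>x. f (map x [0..<n]))"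
  unfolding schwartz_comp_def smooth_comp_def by (metis directions_Nil partials_Nil)

lemma schwartz_bound:
  assumes "schwartz_comp n f"
  obtains B where "B > 0" "\<And>xs. length xs = n \<Longrightarrow> (1 + list_norm xs) ^ N * cmod (f xs) \<le> B"
proof -
  have "bdd_above ((\<lambda>xs. (1 + list_norm xs) ^ N * cmod (partials [] f xs)) ` {xs. length xs = n})"
    using assms unfolding schwartz_comp_def by (meson directions_Nil)
  then obtain B where B: "\<And>xs. length xs = n \<Longrightarrow> (1 + list_norm xs) ^ N * cmod (f xs) \<le> B"
    by (auto simp: bdd_above_def)
  show ?thesis by (rule that[of "max 1 B"]) (use B in \<open>auto simp: le_max_iff_disj\<close>)
qed

lemma schwartz_partial:
  assumes "schwartz_comp n f" "i < n" "b \<in> Basis"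
  shows "schwartz_comp n (partial (i, b) f)"
proof -
  have *: "js @ [(i, b)] \<in> directions n" if "js \<in> directions n" for js
    using that assms by simp
  have **: "partials js (partial (i, b) f) = partials (js @ [(i, b)]) f" for js by simp
  show ?thesis
    unfolding schwartz_comp_def smooth_comp_def **
    using assms(1)[unfolded schwartz_comp_def smooth_comp_def, THEN conjunct1, THEN bspec, OF *]
      assms(1)[unfolded schwartz_comp_def smooth_comp_def, THEN conjunct2, THEN bspec, OF *]
    by simp
qed

lemma schwartz_partials:
  "schwartz_comp n f \<Longrightarrow> js \<in> directions n \<Longrightarrow> schwartz_comp n (partials js f)"
  by (induction js) (auto intro: schwartz_partial)

lemma schwartz_zero: "schwartz_comp n (\<lambda>xs. 0)"
  by (rule schwartz_compI[of "{\<lambda>xs. 0}"]) (auto simp: has_partial_def)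

text \<open>A partial derivative of the \<open>n\<close>-th component never reaches lists of other
  lengths, so the functions that agree there with some Schwartz function form a closed
  class.\<close>

lemma schwartz_cong:
  assumes "schwartz_comp n f" "\<And>xs. length xs = n \<Longrightarrow> g xs = f xs"
  shows "schwartz_comp n g"
proof (rule schwartz_compI)
  let ?K = "{g. \<exists>f. schwartz_comp n f \<and> (\<forall>xs. length xs = n \<longrightarrow> g xs = f xs)}"
  show "g \<in> ?K" using assms by blast
  show "\<exists>f'\<in>?K. has_partial n i b g f'" if "g \<in> ?K" "i < n" "b \<in> Basis" for g i b
  proof -
    from that(1) obtain f where f: "schwartz_comp n f" "\<forall>xs. length xs = n \<longrightarrow> g xs = f xs" by blast
    have "has_partial n i b g (partial (i, b) f)"
      using schwartz_has_partial[OF f(1) that(2,3)] f(2)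
      by (subst has_partial_cong[where g = f and g' = "partial (i, b) f"]) auto
    then show ?thesis using schwartz_partial[OF f(1) that(2,3)] by blast
  qed
  show "continuous_on UNIV (\<lambda>x. g (map x [0..<n]))" if "g \<in> ?K" for g
    using that schwartz_continuous by fastforce
  show "\<exists>B. \<forall>xs. length xs = n \<longrightarrow> (1 + list_norm xs) ^ N * cmod (g xs) \<le> B" if "g \<in> ?K" for g N
  proof -
    from that obtain f where f: "schwartz_comp n f" "\<forall>xs. length xs = n \<longrightarrow> g xs = f xs" by blast
    obtain B where "\<And>xs. length xs = n \<Longrightarrow> (1 + list_norm xs) ^ N * cmod (f xs) \<le> B"
      using schwartz_bound[OF f(1)] by metis
    then show ?thesis using f(2) by auto
  qed
qed

lemma schwartz_add:
  assumes "schwartz_comp n f" "schwartz_comp n g"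
  shows "schwartz_comp n (\<lambda>xs. f xs + g xs)"
proof (rule schwartz_compI)
  let ?K = "{\<lambda>xs. f xs + g xs | f g. schwartz_comp n f \<and> schwartz_comp n g}"
  show "(\<lambda>xs. f xs + g xs) \<in> ?K" using assms by blast
  show "\<exists>f'\<in>?K. has_partial n i b h f'" if h: "h \<in> ?K" "i < n" "b \<in> Basis" for h i b
  proof -
    from h(1) obtain f g where fg: "h = (\<lambda>xs. f xs + g xs)" "schwartz_comp n f" "schwartz_comp n g" by blast
    have "has_partial n i b h (\<lambda>xs. partial (i, b) f xs + partial (i, b) g xs)"
      unfolding fg(1) by (intro has_partial_add schwartz_has_partial fg h)
    moreover have "(\<lambda>xs. partial (i, b) f xs + partial (i, b) g xs) \<in> ?K"
      using schwartz_partial fg(2,3) h(2,3) by blast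
    ultimately show ?thesis by blast
  qed
  show "continuous_on UNIV (\<lambda>x. h (map x [0..<n]))" if "h \<in> ?K" for h
    using that by (auto intro!: continuous_on_add continuous_on_mult_left dest!: schwartz_continuous)
  show "\<exists>B. \<forall>xs. length xs = n \<longrightarrow> (1 + list_norm xs) ^ N * cmod (h xs) \<le> B" if h: "h \<in> ?K" for h N
  proof -
    from h obtain f g where fg: "h = (\<lambda>xs. f xs + g xs)" "schwartz_comp n f" "schwartz_comp n g" by blast
    obtain A where A: "\<And>xs. length xs = n \<Longrightarrow> (1 + list_norm xs) ^ N * cmod (f xs) \<le> A"
      using schwartz_bound[OF fg(2)] by metis
    obtain B where B: "\<And>xs. length xs = n \<Longrightarrow> (1 + list_norm xs) ^ N * cmod (g xs) \<le> B"
      using schwartz_bound[OF fg(3)] by metis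
    have "(1 + list_norm xs) ^ N * cmod (h xs) \<le> A + B" if "length xs = n" for xs
    proof -
      have "(1 + list_norm xs) ^ N * cmod (h xs) \<le> (1 + list_norm xs) ^ N * (cmod (f xs) + cmod (g xs))"
        unfolding fg(1) by (intro mult_left_mono norm_triangle_ineq) simp
      then show ?thesis using A[OF that] B[OF that] by (simp add: algebra_simps)
    qed
    then show ?thesis by blast
  qed
qed

lemma schwartz_cmult:
  assumes "schwartz_comp n f"
  shows "schwartz_comp n (\<lambda>xs. c * f xs)"
proof (rule schwartz_compI)
  let ?K = "{\<lambda>xs. c * f xs | f. schwartz_comp n f}"
  show "(\<lambda>xs. c * f xs) \<in> ?K" using assms by blast
  show "\<exists>f'\<in>?K. has_partial n i b h f'" if h: "h \<in> ?K" "i < n" "b \<in> Basis" for h i b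
  proof -
    from h(1) obtain f where f: "h = (\<lambda>xs. c * f xs)" "schwartz_comp n f" by blast
    have "has_partial n i b h (\<lambda>xs. c * partial (i, b) f xs)"
      unfolding f(1) by (intro has_partial_cmult schwartz_has_partial f h)
    then show ?thesis using schwartz_partial[OF f(2) h(2,3)] by blast
  qed
  show "continuous_on UNIV (\<lambda>x. h (map x [0..<n]))" if "h \<in> ?K" for h
    using that by (auto intro!: continuous_on_add continuous_on_mult_left dest!: schwartz_continuous)
  show "\<exists>B. \<forall>xs. length xs = n \<longrightarrow> (1 + list_norm xs) ^ N * cmod (h xs) \<le> B" if h: "h \<in> ?K" for h N
  proof -
    from h obtain f where f: "h = (\<lambda>xs. c * f xs)" "schwartz_comp n f" by blast
    obtain A where A: "\<And>xs. length xs = n \<Longrightarrow> (1 + list_norm xs) ^ N * cmod (f xs) \<le> A"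
      using schwartz_bound[OF f(2)] by metis
    have "(1 + list_norm xs) ^ N * cmod (h xs) \<le> cmod c * A" if "length xs = n" for xs
      using mult_left_mono[OF A[OF that], of "cmod c"] by (simp add: f(1) norm_mult mult_ac)
    then show ?thesis by blast
  qed
qed

lemma schwartz_sum:
  "(\<And>i. i \<in> I \<Longrightarrow> schwartz_comp n (f i)) \<Longrightarrow> schwartz_comp n (\<lambda>xs. \<Sum>i\<in>I. f i xs)"
  by (induction I rule: infinite_finite_induct) (auto intro: schwartz_zero schwartz_add)

lemma partials_linear:
  assumes "schwartz_comp n f" "schwartz_comp n g" "js \<in> directions n" "length xs = n"
  shows "partials js (\<lambda>xs. f xs + c * g xs) xs = partials js f xs + c * partials js g xs"
  using assms(3,4)
proof (induction js arbitrary: xs)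
  case (Cons j js)
  obtain i b where j: "j = (i, b)" by force
  have *: "has_partial n i b (\<lambda>xs. partials js f xs + c * partials js g xs)
      (\<lambda>xs. partials (j # js) f xs + c * partials (j # js) g xs)"
    unfolding j partials_Cons using Cons.prems j assms(1,2)
    by (intro has_partial_add has_partial_cmult schwartz_has_partial schwartz_partials) auto
  have "has_partial n i b (partials js (\<lambda>xs. f xs + c * g xs))
      (\<lambda>xs. partials (j # js) f xs + c * partials (j # js) g xs)"
    by (subst has_partial_cong[OF _ refl]) (use Cons * j in auto)
  from partial_eqI[OF this Cons.prems(2)] show ?case by (simp add: j)
qed simp

subsection \<open>The chain rule\<close>

lemma continuous_on_coordinates:
  "(\<And>k. continuous_on S (\<lambda>x. f x k)) \<Longrightarrow> continuous_on S (f :: _ \<Rightarrow> nat \<Rightarrow> 'v::euclidean_space)"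
  by (rule continuous_on_coordinatewise_then_product)

text \<open>Induction on the set of moving coordinates. One coordinate \<open>p\<close> is split off
  and made an independent variable \<open>r\<close>: the derivative in \<open>t\<close> is the
  induction hypothesis, the one in \<open>r\<close> is the given partial derivative, and continuity
  of the latter makes the function of two variables differentiable.\<close>

lemma chain_rule_coordinates:
  fixes \<phi> :: "(nat \<Rightarrow> 'v::euclidean_space) \<Rightarrow> complex"
  assumes "finite S"
    and "\<And>i b x. (i, b) \<in> S \<Longrightarrow> ((\<lambda>s. \<phi> (x(i := x i + s *\<^sub>R b))) has_vector_derivative d\<phi> (i, b) x) (at 0)"
    and "\<And>p. p \<in> S \<Longrightarrow> continuous_on UNIV (d\<phi> p)"
    and "\<And>p t. p \<in> S \<Longrightarrow> (u p has_real_derivative u' p t) (at t)"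
  shows "((\<lambda>t. \<phi> (\<lambda>k. \<zeta> k + (\<Sum>p\<in>S. if fst p = k then u p t *\<^sub>R snd p else 0))) has_vector_derivative
    (\<Sum>p\<in>S. u' p t\<^sub>0 *\<^sub>R d\<phi> p (\<lambda>k. \<zeta> k + (\<Sum>p\<in>S. if fst p = k then u p t\<^sub>0 *\<^sub>R snd p else 0)))) (at t\<^sub>0)"
  using assms
proof (induction S arbitrary: \<zeta> rule: finite_induct)
  case (insert p S)
  obtain i b where p: "p = (i, b)" by force
  define pt where "pt = (\<lambda>t r k. \<zeta> k + (if i = k then r *\<^sub>R b else 0)
      + (\<Sum>p\<in>S. if fst p = k then u p t *\<^sub>R snd p else 0))"
  define H where "H = (\<lambda>t r. \<phi> (pt t r))"
  define D where "D = (\<Sum>q\<in>S. u' q t\<^sub>0 *\<^sub>R d\<phi> q (pt t\<^sub>0 (u p t\<^sub>0)))"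
  have IH: "((\<lambda>t. H t r) has_vector_derivative (\<Sum>q\<in>S. u' q t\<^sub>0 *\<^sub>R d\<phi> q (pt t\<^sub>0 r))) (at t\<^sub>0)" for r
    using insert.IH[OF insert.prems, of "\<lambda>k. \<zeta> k + (if i = k then r *\<^sub>R b else 0)"]
    unfolding H_def pt_def by simp
  have cont_u: "continuous_on UNIV (u q)" if "q \<in> S" for q
    using insert.prems(3)[of q] that
    by (meson insertI2 DERIV_isCont continuous_at_imp_continuous_on)
  have cont_pt: "continuous_on UNIV (\<lambda>z. pt (fst z) (snd z))"
  proof (rule continuous_on_coordinates)
    fix k
    have "continuous_on UNIV (\<lambda>z::real \<times> real. if fst q = k then u q (fst z) *\<^sub>R snd q else 0)" if "q \<in> S" for q
      using continuous_on_compose2[OF cont_u[OF that] continuous_on_fst[OF continuous_on_id, of UNIV]]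
      by (cases "fst q = k") (auto intro!: continuous_intros)
    then show "continuous_on UNIV (\<lambda>z. pt (fst z) (snd z) k)"
      unfolding pt_def by (cases "i = k") (auto intro!: continuous_intros)
  qed
  have fy: "((\<lambda>r. H t r) has_derivative blinfun_apply (blinfun_scaleR_left (d\<phi> p (pt t r)))) (at r within UNIV)" for t r
  proof -
    have "((\<lambda>s. \<phi> ((pt t r)(i := pt t r i + s *\<^sub>R b))) has_vector_derivative d\<phi> (i, b) (pt t r)) (at 0)"
      by (rule insert.prems(1)) (simp add: p)
    moreover have "(pt t r)(i := pt t r i + s *\<^sub>R b) = pt t (r + s)" for s
      by (auto simp: pt_def scaleR_add_left)
    ultimately have "((\<lambda>s. H t (r + s)) has_vector_derivative d\<phi> p (pt t r)) (at 0)"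
      by (simp add: H_def p)
    then have "((\<lambda>s. H t s) has_vector_derivative d\<phi> p (pt t r)) (at r)"
      unfolding has_vector_derivative_quotient by simp
    then show ?thesis by (simp add: has_vector_derivative_def)
  qed
  have "((\<lambda>(t, r). H t r) has_derivative
      (\<lambda>(tx, ty). tx *\<^sub>R D + blinfun_apply (blinfun_scaleR_left (d\<phi> p (pt t\<^sub>0 (u p t\<^sub>0)))) ty))
      (at (t\<^sub>0, u p t\<^sub>0) within UNIV \<times> UNIV)"
  proof (rule has_derivative_partialsI[OF _ fy])
    show "((\<lambda>t. H t (u p t\<^sub>0)) has_derivative (\<lambda>tx. tx *\<^sub>R D)) (at t\<^sub>0 within UNIV)"
      using IH[of "u p t\<^sub>0"] by (simp add: has_vector_derivative_def D_def)
    have "continuous_on UNIV (\<lambda>z. d\<phi> p (pt (fst z) (snd z)))"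
      by (rule continuous_on_compose2[OF insert.prems(2) cont_pt]) auto
    then have "continuous_on UNIV (\<lambda>z. blinfun_scaleR_left (d\<phi> p (pt (fst z) (snd z))))"
      by (rule bounded_linear.continuous_on[OF bounded_linear_blinfun_scaleR_left])
    then show "continuous (at (t\<^sub>0, u p t\<^sub>0) within UNIV \<times> UNIV)
        (\<lambda>(x, y). blinfun_scaleR_left (d\<phi> p (pt x y)))"
      by (simp add: continuous_on_eq_continuous_at case_prod_unfold)
  qed auto
  \<comment> \<open>The split-off variable is tied back to the curve.\<close>
  moreover have "((\<lambda>t. (t, u p t)) has_derivative (\<lambda>h. (h, h * u' p t\<^sub>0))) (at t\<^sub>0)"
    using insert.prems(3)[of p t\<^sub>0]
    by (auto intro!: derivative_eq_intros simp: has_field_derivative_def mult.commute)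
  ultimately have "((\<lambda>(t, r). H t r) \<circ> (\<lambda>t. (t, u p t)) has_derivative
      (\<lambda>(tx, ty). tx *\<^sub>R D + blinfun_apply (blinfun_scaleR_left (d\<phi> p (pt t\<^sub>0 (u p t\<^sub>0)))) ty) \<circ> (\<lambda>h. (h, h * u' p t\<^sub>0))) (at t\<^sub>0)"
    by (intro diff_chain_at) (auto simp: has_derivative_at_withinI)
  then have "((\<lambda>t. H t (u p t)) has_vector_derivative (u' p t\<^sub>0 *\<^sub>R d\<phi> p (pt t\<^sub>0 (u p t\<^sub>0)) + D)) (at t\<^sub>0)"
    by (simp add: has_vector_derivative_def comp_def scaleR_add_right add.commute)
  moreover have "pt t (u p t) = (\<lambda>k. \<zeta> k + (\<Sum>p\<in>insert p S. if fst p = k then u p t *\<^sub>R snd p else 0))" for t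
    using insert.hyps by (auto simp: pt_def p add.assoc)
  ultimately show ?case
    using insert.hyps by (simp add: H_def D_def)
qed simp

lemma map_update_nth:
  "i < n \<Longrightarrow> map (x(i := v)) [0..<n] = (map x [0..<n])[i := v]"
  by (intro nth_equalityI) (auto simp: nth_list_update)

text \<open>All coordinates of all arguments move, over the base point 0. Lists are read as
  functions on the naturals, where a single coordinate can be updated and continuity is that of the
  product.\<close>

lemma schwartz_chain_rule:
  fixes \<gamma> :: "real \<Rightarrow> nat \<Rightarrow> 'v::euclidean_space"
  assumes f: "schwartz_comp n f"
    and \<gamma>: "\<And>k t. k < n \<Longrightarrow> ((\<lambda>t. \<gamma> t k) has_vector_derivative \<gamma>' t k) (at t)"
  shows "((\<lambda>t. f (map (\<gamma> t) [0..<n])) has_vector_derivative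
    (\<Sum>i<n. \<Sum>b\<in>Basis. (\<gamma>' t i \<bullet> b) *\<^sub>R partial (i, b) f (map (\<gamma> t) [0..<n]))) (at t)"
proof -
  define S where "S = {..<n} \<times> (Basis :: 'v set)"
  have pt: "map (\<lambda>k. 0 + (\<Sum>p\<in>S. if fst p = k then (\<gamma> t (fst p) \<bullet> snd p) *\<^sub>R snd p else 0)) [0..<n] = map (\<gamma> t) [0..<n]" for t
  proof (intro nth_equalityI, simp_all)
    fix k assume "k < n"
    have "(\<Sum>p\<in>S. if fst p = k then (\<gamma> t (fst p) \<bullet> snd p) *\<^sub>R snd p else 0)
        = (\<Sum>i<n. \<Sum>b\<in>Basis. if i = k then (\<gamma> t i \<bullet> b) *\<^sub>R b else 0)"
      unfolding S_def by (subst sum.cartesian_product) (simp add: case_prod_unfold)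
    also have "\<dots> = (\<Sum>i<n. if i = k then \<gamma> t i else 0)"
      by (intro sum.cong refl) (simp add: euclidean_representation)
    also have "\<dots> = \<gamma> t k" using \<open>k < n\<close> by simp
    finally show "(\<Sum>p\<in>S. if fst p = k then (\<gamma> t (fst p) \<bullet> snd p) *\<^sub>R snd p else 0) = \<gamma> t k" .
  qed
  have "((\<lambda>t. (\<lambda>x. f (map x [0..<n])) (\<lambda>k. 0 + (\<Sum>p\<in>S. if fst p = k then (\<gamma> t (fst p) \<bullet> snd p) *\<^sub>R snd p else 0)))
    has_vector_derivative (\<Sum>p\<in>S. (\<gamma>' t (fst p) \<bullet> snd p) *\<^sub>R
      (\<lambda>x. partial p f (map x [0..<n])) (\<lambda>k. 0 + (\<Sum>p\<in>S. if fst p = k then (\<gamma> t (fst p) \<bullet> snd p) *\<^sub>R snd p else 0)))) (at t)"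
  proof (rule chain_rule_coordinates)
    show "finite S" by (simp add: S_def)
    show "((\<lambda>s. f (map (x(i := x i + s *\<^sub>R b)) [0..<n])) has_vector_derivative partial (i, b) f (map x [0..<n])) (at 0)"
      if "(i, b) \<in> S" for i b x
    proof -
      have "i < n" "b \<in> Basis" using that by (auto simp: S_def)
      with schwartz_has_partial[OF f this, unfolded has_partial_def, rule_format, of "map x [0..<n]"]
      show ?thesis by (simp add: map_update_nth)
    qed
    show "continuous_on UNIV (\<lambda>x. partial p f (map x [0..<n]))" if "p \<in> S" for p
      using that by (cases p) (auto simp: S_def intro!: schwartz_continuous schwartz_partial[OF f] simp del: partial.simps)
    show "((\<lambda>t. \<gamma> t (fst p) \<bullet> snd p) has_real_derivative \<gamma>' t (fst p) \<bullet> snd p) (at t)" if "p \<in> S" for p t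
      using bounded_linear.has_vector_derivative[OF bounded_linear_inner_left \<gamma>, of "fst p" "snd p" t] that
      by (auto simp: S_def has_real_derivative_iff_has_vector_derivative)
  qed
  then show ?thesis
    unfolding pt by (simp add: S_def sum.cartesian_product case_prod_unfold)
qed

section \<open>Smearing over a one-parameter group of linear maps\<close>

text \<open>Models the matrix entries of L(t) and their products. The growth bound enters the
  estimates of smeared functions; the bound on \<open>m t - m 0\<close>, of first order in
  \<open>t\<close>, gives the rate at which smearing approaches the identity.\<close>

definition moderate :: "(real \<Rightarrow> real) \<Rightarrow> bool" where
  "moderate m \<longleftrightarrow> continuous_on UNIV m \<and> (\<exists>C. \<exists>K::nat. \<forall>t::real.
     \<bar>m t\<bar> \<le> C * exp (K * \<bar>t\<bar>) \<and> \<bar>m t - m 0\<bar> \<le> C * \<bar>t\<bar> * exp (K * \<bar>t\<bar>))"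

text \<open>All exponential moments are required because each partial derivative of a smeared
  function multiplies the weight by further entries of L(t), which grow exponentially.\<close>

definition weight :: "real measure \<Rightarrow> (real \<Rightarrow> complex) \<Rightarrow> bool" where
  "weight M G \<longleftrightarrow> sets M = sets borel \<and> G \<in> borel_measurable borel \<and>
     (\<forall>K::nat. integrable M (\<lambda>t. cmod (G t) * exp (K * \<bar>t\<bar>)))"

lemma moderate_one: "moderate (\<lambda>t. 1)"
  unfolding moderate_def by (auto intro!: exI[of _ "1::real"] exI[of _ "0::nat"])

lemma moderateE:
  assumes "moderate m"
  obtains C and K :: nat where "C \<ge> 0" "\<And>t::real. \<bar>m t\<bar> \<le> C * exp (K * \<bar>t\<bar>)"
    "\<And>t::real. \<bar>m t - m 0\<bar> \<le> C * \<bar>t\<bar> * exp (K * \<bar>t\<bar>)"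
proof -
  obtain C and K :: nat where C: "\<And>t::real. \<bar>m t\<bar> \<le> C * exp (K * \<bar>t\<bar>)"
    "\<And>t::real. \<bar>m t - m 0\<bar> \<le> C * \<bar>t\<bar> * exp (K * \<bar>t\<bar>)"
    using assms by (auto simp: moderate_def)
  have "C \<ge> 0" using C(1)[of 0] by simp
  then show ?thesis using C by (rule that)
qed

lemma moderate_mult:
  assumes "moderate m" "moderate m'"
  shows "moderate (\<lambda>t. m t * m' t)"
proof -
  obtain C and K :: nat where C: "C \<ge> 0" "\<And>t::real. \<bar>m t\<bar> \<le> C * exp (K * \<bar>t\<bar>)"
    "\<And>t::real. \<bar>m t - m 0\<bar> \<le> C * \<bar>t\<bar> * exp (K * \<bar>t\<bar>)" using assms(1) by (rule moderateE) blast
  obtain C' and K' :: nat where C': "C' \<ge> 0" "\<And>t::real. \<bar>m' t\<bar> \<le> C' * exp (K' * \<bar>t\<bar>)"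
    "\<And>t::real. \<bar>m' t - m' 0\<bar> \<le> C' * \<bar>t\<bar> * exp (K' * \<bar>t\<bar>)" using assms(2) by (rule moderateE) blast
  show ?thesis unfolding moderate_def
  proof (intro conjI exI[of _ "2 * C * C'"] exI[of _ "K + K'"] allI)
    show "continuous_on UNIV (\<lambda>t. m t * m' t)"
      using assms by (auto simp: moderate_def intro: continuous_intros)
    fix t :: real
    have e: "exp (real (K + K') * \<bar>t\<bar>) = exp (K * \<bar>t\<bar>) * exp (K' * \<bar>t\<bar>)"
      by (simp add: exp_add[symmetric] algebra_simps)
    have "\<bar>m t * m' t\<bar> \<le> (C * exp (K * \<bar>t\<bar>)) * (C' * exp (K' * \<bar>t\<bar>))"
      unfolding abs_mult using C C' by (intro mult_mono) auto
    also have "\<dots> \<le> 2 * C * C' * exp (real (K + K') * \<bar>t\<bar>)" unfolding e using C(1) C'(1) by (simp add: mult_ac)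
    finally show "\<bar>m t * m' t\<bar> \<le> 2 * C * C' * exp (real (K + K') * \<bar>t\<bar>)" .
    have m0: "\<bar>m 0\<bar> \<le> C * exp (K * \<bar>t\<bar>)"
    proof -
      have "\<bar>m 0\<bar> \<le> C * 1" using C(2)[of 0] by simp
      also have "\<dots> \<le> C * exp (K * \<bar>t\<bar>)" using C(1) by (intro mult_left_mono) auto
      finally show ?thesis .
    qed
    have "\<bar>m t * m' t - m 0 * m' 0\<bar> = \<bar>(m t - m 0) * m' t + m 0 * (m' t - m' 0)\<bar>"
      by (simp add: algebra_simps)
    also have "\<dots> \<le> \<bar>m t - m 0\<bar> * \<bar>m' t\<bar> + \<bar>m 0\<bar> * \<bar>m' t - m' 0\<bar>"
      by (metis abs_mult abs_triangle_ineq)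
    also have "\<dots> \<le> (C * \<bar>t\<bar> * exp (K * \<bar>t\<bar>)) * (C' * exp (K' * \<bar>t\<bar>))
        + (C * exp (K * \<bar>t\<bar>)) * (C' * \<bar>t\<bar> * exp (K' * \<bar>t\<bar>))"
      using C C' m0 by (intro add_mono mult_mono) auto
    also have "\<dots> = 2 * C * C' * \<bar>t\<bar> * exp (real (K + K') * \<bar>t\<bar>)" unfolding e by (simp add: algebra_simps)
    finally show "\<bar>m t * m' t - m 0 * m' 0\<bar> \<le> 2 * C * C' * \<bar>t\<bar> * exp (real (K + K') * \<bar>t\<bar>)" .
  qed
qed

lemma exp_abs_mono: "(K::nat) \<le> K' \<Longrightarrow> exp (K * \<bar>t\<bar>) \<le> exp (K' * \<bar>t::real\<bar>)"
  unfolding exp_le_cancel_iff by (rule mult_right_mono) simp_all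

lemma weight_measurable:
  assumes "weight M G" shows "sets M = sets borel" "G \<in> borel_measurable M"
proof -
  show s: "sets M = sets borel" using assms by (simp add: weight_def)
  show "G \<in> borel_measurable M"
    unfolding measurable_cong_sets[OF s refl] using assms by (simp add: weight_def)
qed

lemma continuous_measurable:
  "sets M = sets borel \<Longrightarrow> continuous_on UNIV f \<Longrightarrow> f \<in> borel_measurable M"
  by (subst measurable_cong_sets[OF _ refl], assumption) (rule borel_measurable_continuous_onI)

lemma weight_integrable_bound:
  assumes G: "weight M G" and f: "f \<in> borel_measurable M"
    and bound: "\<And>t. cmod (f t) \<le> cmod (G t) * (C * exp (K * \<bar>t\<bar>))"
  shows "integrable M f" "(LINT t|M. cmod (f t)) \<le> C * (LINT t|M. cmod (G t) * exp (real K * \<bar>t\<bar>))"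
proof -
  have int: "integrable M (\<lambda>t. C * (cmod (G t) * exp (real K * \<bar>t\<bar>)))"
    using G by (auto simp: weight_def)
  show f_int: "integrable M f"
    by (rule Bochner_Integration.integrable_bound[OF int f])
       (intro AE_I2, rule order_trans[OF bound], simp add: mult_ac order_trans[OF _ abs_ge_self])
  have "(LINT t|M. cmod (f t)) \<le> (LINT t|M. C * (cmod (G t) * exp (real K * \<bar>t\<bar>)))"
    by (rule integral_mono[OF integrable_norm[OF f_int] int]) (use bound in \<open>simp add: mult_ac\<close>)
  then show "(LINT t|M. cmod (f t)) \<le> C * (LINT t|M. cmod (G t) * exp (real K * \<bar>t\<bar>))" by simp
qed

lemma weight_mult:
  assumes G: "weight M G" and m: "moderate m"
  shows "weight M (\<lambda>t. G t * of_real (m t))"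
proof -
  obtain C and K :: nat where C: "C \<ge> 0" "\<And>t::real. \<bar>m t\<bar> \<le> C * exp (K * \<bar>t\<bar>)" using m by (rule moderateE) blast
  have cm: "continuous_on UNIV m" using m by (simp add: moderate_def)
  have meas: "(\<lambda>t. G t * of_real (m t)) \<in> borel_measurable borel"
    using G by (intro borel_measurable_times borel_measurable_continuous_onI[OF continuous_on_of_real[OF cm]])
               (simp add: weight_def)
  have "integrable M (\<lambda>t. cmod (G t * of_real (m t)) * exp (K' * \<bar>t\<bar>))" for K' :: nat
  proof -
    have "integrable M (\<lambda>t. G t * of_real (m t) * of_real (exp (K' * \<bar>t\<bar>)))"
    proof (rule weight_integrable_bound[OF G])
      have "(\<lambda>t::real. G t * of_real (m t) * of_real (exp (K' * \<bar>t\<bar>))) \<in> borel_measurable borel"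
        by (rule borel_measurable_times[OF meas borel_measurable_continuous_onI]) (intro continuous_intros)
      then show "(\<lambda>t. G t * of_real (m t) * of_real (exp (K' * \<bar>t\<bar>))) \<in> borel_measurable M"
        by (subst measurable_cong_sets[OF weight_measurable(1)[OF G] refl])
      fix t :: real
      have "\<bar>m t\<bar> * exp (K' * \<bar>t\<bar>) \<le> C * exp (K * \<bar>t\<bar>) * exp (K' * \<bar>t\<bar>)"
        by (intro mult_right_mono C) simp
      also have "\<dots> = C * exp (real (K + K') * \<bar>t\<bar>)" by (simp add: exp_add algebra_simps)
      finally show "cmod (G t * of_real (m t) * of_real (exp (K' * \<bar>t\<bar>))) \<le> cmod (G t) * (C * exp (real (K + K') * \<bar>t\<bar>))"
        by (simp add: norm_mult mult.assoc mult_left_mono)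
    qed
    from integrable_norm[OF this] show ?thesis by (simp add: norm_mult)
  qed
  then show ?thesis using meas G by (simp add: weight_def)
qed

lemma weight_moment_mono:
  assumes "weight M G" "(K::nat) \<le> K'"
  shows "(LINT t|M. cmod (G t) * exp (real K * \<bar>t\<bar>)) \<le> (LINT t|M. cmod (G t) * exp (real K' * \<bar>t\<bar>))"
proof (rule integral_mono)
  have "integrable M (\<lambda>t. cmod (G t) * exp (real K * \<bar>t\<bar>))" for K
    using assms(1) unfolding weight_def by blast
  then show "integrable M (\<lambda>t. cmod (G t) * exp (real K * \<bar>t\<bar>))"
    "integrable M (\<lambda>t. cmod (G t) * exp (real K' * \<bar>t\<bar>))" by blast+
  show "cmod (G t) * exp (real K * \<bar>t\<bar>) \<le> cmod (G t) * exp (real K' * \<bar>t\<bar>)" for t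
    by (rule mult_left_mono[OF exp_abs_mono[OF assms(2)] norm_ge_zero])
qed

lemma weight_integrable_abs:
  assumes "weight M G"
  shows "integrable M (\<lambda>t. cmod (G t) * (\<bar>t\<bar> * exp (real K * \<bar>t\<bar>)))"
proof -
  have "integrable M (\<lambda>t. G t * of_real (\<bar>t\<bar> * exp (real K * \<bar>t\<bar>)))"
  proof (rule weight_integrable_bound[OF assms])
    have "(\<lambda>t. of_real (\<bar>t\<bar> * exp (real K * \<bar>t\<bar>)) :: complex) \<in> borel_measurable M"
      using weight_measurable[OF assms] by (intro continuous_measurable continuous_intros)
    then show "(\<lambda>t. G t * of_real (\<bar>t\<bar> * exp (real K * \<bar>t\<bar>))) \<in> borel_measurable M"
      using weight_measurable[OF assms] by (intro borel_measurable_times)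
    fix t :: real
    \<comment> \<open>The factor |t| is paid for by raising the exponent by one.\<close>
    have "\<bar>t\<bar> * exp (real K * \<bar>t\<bar>) \<le> exp \<bar>t\<bar> * exp (real K * \<bar>t\<bar>)"
      using exp_ge_add_one_self[of "\<bar>t\<bar>"] by (intro mult_right_mono) (linarith, simp)
    also have "\<dots> = 1 * exp (real (K + 1) * \<bar>t\<bar>)" by (simp add: exp_add[symmetric] algebra_simps)
    finally show "cmod (G t * of_real (\<bar>t\<bar> * exp (real K * \<bar>t\<bar>))) \<le> cmod (G t) * (1 * exp (real (K + 1) * \<bar>t\<bar>))"
      unfolding norm_mult norm_of_real by (intro mult_left_mono) (auto simp: abs_mult)
  qed
  moreover have "cmod (G t * of_real (\<bar>t\<bar> * exp (real K * \<bar>t\<bar>))) = cmod (G t) * (\<bar>t\<bar> * exp (real K * \<bar>t\<bar>))" for t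
    unfolding norm_mult norm_of_real by simp
  ultimately show ?thesis using integrable_norm by fastforce
qed

text \<open>The Dirac measure at \<open>t\<close>, realised on the Borel sets as the image of
  counting measure on one point, so that integration against it is a sum with one term.\<close>

definition point_mass :: "real \<Rightarrow> real measure" where
  "point_mass t = distr (count_space {0::nat}) borel (\<lambda>_. t)"

lemma integral_point_mass:
  "f \<in> borel_measurable borel \<Longrightarrow> (LINT s|point_mass t. f s) = (f t :: 'b::{banach, second_countable_topology})"
proof -
  assume f: "f \<in> borel_measurable borel"
  have c: "(\<lambda>_. t) \<in> count_space {0::nat} \<rightarrow>\<^sub>M borel" by (rule measurable_const) simp
  show ?thesis
    unfolding point_mass_def integral_distr[OF c f]
    by (subst lebesgue_integral_count_space_finite) simp_all
qed

lemma weight_point_mass: "weight (point_mass t) (\<lambda>_. 1)"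
proof -
  have "integrable (count_space {0::nat}) (\<lambda>_. cmod 1 * exp (real K * \<bar>t\<bar>))" for K
    by (rule integrable_count_space) simp
  then show ?thesis
    unfolding weight_def point_mass_def
  proof (intro conjI allI)
    fix K :: nat
    have c: "(\<lambda>_. t) \<in> count_space {0::nat} \<rightarrow>\<^sub>M borel" by (rule measurable_const) simp
    have "(\<lambda>t::real. 1 * exp (real K * \<bar>t\<bar>)) \<in> borel_measurable borel"
      by (intro borel_measurable_continuous_onI continuous_intros)
    then show "integrable (distr (count_space {0::nat}) borel (\<lambda>_. t)) (\<lambda>t. cmod (1::complex) * exp (real K * \<bar>t\<bar>))"
      unfolding norm_one by (rule integrable_distr_eq[OF c, THEN iffD2]) (rule integrable_count_space, simp)
  qed simp_all
qed

text \<open>The properties of the boosts that enter the analysis. \<open>X\<close> is the generator,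
  and one constant \<open>\<kappa>\<close> serves both bounds. The growth bound at -t is a lower
  bound at \<open>t\<close>, which carries decay over to the orbits.\<close>

locale linear_group =
  fixes L :: "real \<Rightarrow> 'v::euclidean_space \<Rightarrow> 'v" and X :: "'v \<Rightarrow> 'v" and \<kappa> :: real
  assumes L_linear: "\<And>t. linear (L t)"
    and L_deriv: "\<And>t x. ((\<lambda>t. L t x) has_vector_derivative X (L t x)) (at t)"
    and L_bound: "\<And>t x. norm (L t x) \<le> \<kappa> * exp \<bar>t\<bar> * norm x"
    and X_bound: "\<And>x. norm (X x) \<le> \<kappa> * norm x"
    and L_zero: "\<And>x. L 0 x = x"
    and L_add: "\<And>s t x. L (s + t) x = L s (L t x)"
    and kappa: "1 \<le> \<kappa>"
begin

lemma L_lower_bound: "norm x \<le> \<kappa> * exp \<bar>t\<bar> * norm (L t x)"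
  using L_bound[of "-t" "L t x"] L_add[of "-t" t x] by (simp add: L_zero)

lemma L_continuous: "continuous_on S (\<lambda>t. L t x)"
  using L_deriv by (meson continuous_at_imp_continuous_on has_vector_derivative_continuous)

lemma L_continuous_vector: "continuous_on S (L t)"
  using L_linear by (rule linear_continuous_on[OF linear_conv_bounded_linear[THEN iffD1]])

lemma L_at_0: "map (L 0) xs = xs"
  by (simp add: L_zero map_idI)

text \<open>Decay of a function at the point \<open>map (L t) xs\<close> is thereby worth decay in
  \<open>xs\<close> itself, at the price exp (N |t|).\<close>

lemma list_norm_L_bound: "(1 + list_norm xs) ^ N \<le> \<kappa> ^ N * exp (N * \<bar>t\<bar>) * (1 + list_norm (map (L t) xs)) ^ N"
proof -
  have k1: "1 \<le> \<kappa> * exp \<bar>t\<bar>"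
    using mult_mono[of 1 \<kappa> 1 "exp \<bar>t\<bar>"] kappa by auto
  have "list_norm (map (\<lambda>x. x) xs) \<le> \<kappa> * exp \<bar>t\<bar> * list_norm (map (L t) xs)"
    by (rule list_norm_map_le) (use L_lower_bound k1 in auto)
  then have "1 + list_norm xs \<le> \<kappa> * exp \<bar>t\<bar> * (1 + list_norm (map (L t) xs))"
    using k1 by (simp add: algebra_simps)
  then have "(1 + list_norm xs) ^ N \<le> (\<kappa> * exp \<bar>t\<bar> * (1 + list_norm (map (L t) xs))) ^ N"
    by (rule power_mono) (simp add: add_nonneg_nonneg)
  then show ?thesis by (simp add: power_mult_distrib exp_of_nat_mult)
qed

lemma moderate_coefficient:
  assumes "b \<in> Basis" "c \<in> Basis" shows "moderate (\<lambda>t. L t b \<bullet> c)"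
  unfolding moderate_def
\<comment> \<open>In the mean value estimate one \<open>\<kappa>\<close> bounds \<open>X\<close> and
  the other bounds \<open>L s b\<close>; the growth bound is relaxed to the same constant.\<close>
proof (intro conjI exI[of _ "\<kappa> * \<kappa>"] exI[of _ "1::nat"] allI)
  have nb: "norm b = 1" "norm c = 1" using assms by auto
  show "continuous_on UNIV (\<lambda>t. L t b \<bullet> c)" by (intro continuous_intros L_continuous)
  fix t :: real
  have "\<bar>L t b \<bullet> c\<bar> \<le> norm (L t b)" using Cauchy_Schwarz_ineq2[of "L t b" c] nb by simp
  also have "\<dots> \<le> \<kappa> * exp \<bar>t\<bar>" using L_bound[of t b] nb by simp
  also have "\<dots> \<le> \<kappa> * \<kappa> * exp \<bar>t\<bar>"
    using mult_right_mono[of \<kappa> "\<kappa> * \<kappa>" "exp \<bar>t\<bar>"] kappa by (auto simp: mult_le_cancel_left)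
  finally show "\<bar>L t b \<bullet> c\<bar> \<le> \<kappa> * \<kappa> * exp (real 1 * \<bar>t\<bar>)" by simp
  have "norm (L t b - L 0 b) \<le> (\<kappa> * \<kappa> * exp \<bar>t\<bar>) * \<bar>t - 0\<bar>"
  proof (rule vector_derivative_mean_bound[where S = "{-\<bar>t\<bar>..\<bar>t\<bar>}"])
    fix s assume s: "s \<in> {-\<bar>t\<bar>..\<bar>t\<bar>}"
    show "((\<lambda>t. L t b) has_vector_derivative X (L s b)) (at s)" by (rule L_deriv)
    have "norm (X (L s b)) \<le> \<kappa> * (\<kappa> * exp \<bar>s\<bar> * norm b)"
      using X_bound[of "L s b"] L_bound[of s b] kappa mult_left_mono[of _ _ \<kappa>] by (smt (verit))
    also have "\<dots> \<le> \<kappa> * \<kappa> * exp \<bar>t\<bar>"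
      using s kappa nb by auto
    finally show "norm (X (L s b)) \<le> \<kappa> * \<kappa> * exp \<bar>t\<bar>" .
  qed auto
  then have "norm (L t b - b) \<le> \<kappa> * \<kappa> * \<bar>t\<bar> * exp \<bar>t\<bar>" by (simp add: L_zero mult_ac)
  then show "\<bar>L t b \<bullet> c - L 0 b \<bullet> c\<bar> \<le> \<kappa> * \<kappa> * \<bar>t\<bar> * exp (real 1 * \<bar>t\<bar>)"
    using Cauchy_Schwarz_ineq2[of "L t b - b" c] nb by (simp add: L_zero inner_diff_left)
qed

text \<open>A point mass at \<open>t\<close> gives the action \<open>f \<circ> L(t)\<close>, Lebesgue measure the regularisation of \<open>f\<close> along
  the orbits; treating both at once avoids proving twice that Schwartz functions are preserved.\<close>

definition smear :: "real measure \<Rightarrow> (real \<Rightarrow> complex) \<Rightarrow> ('v list \<Rightarrow> complex) \<Rightarrow> 'v list \<Rightarrow> complex" where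
  "smear M G f xs = (LINT t|M. G t * f (map (L t) xs))"

lemma map_L_coordinates: "length xs = n \<Longrightarrow> map (L t) xs = map (\<lambda>k. L t (xs ! k)) [0..<n]"
  by (auto intro: nth_equalityI)

lemma schwartz_orbit_continuous:
  assumes "schwartz_comp n f" "length xs = n"
  shows "continuous_on UNIV (\<lambda>t. f (map (L t) xs))"
  unfolding map_L_coordinates[OF assms(2)]
  by (rule continuous_on_compose2[OF schwartz_continuous[OF assms(1)]])
     (intro continuous_on_coordinates L_continuous, simp)

lemma schwartz_uniform_bound:
  assumes "schwartz_comp n f" obtains B where "B > 0" "\<And>xs. length xs = n \<Longrightarrow> cmod (f xs) \<le> B"
  using schwartz_bound[OF assms, of 0] unfolding power_0 mult_1 by blast

lemma smear_measurable:
  assumes "weight M G" "schwartz_comp n f" "length xs = n"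
  shows "(\<lambda>t. G t * f (map (L t) xs)) \<in> borel_measurable M"
  by (intro borel_measurable_times weight_measurable(2)[OF assms(1)]
      continuous_measurable[OF weight_measurable(1)[OF assms(1)]] schwartz_orbit_continuous[OF assms(2,3)])

lemma smear_integrable:
  assumes "weight M G" "schwartz_comp n f" "length xs = n"
  shows "integrable M (\<lambda>t. G t * f (map (L t) xs))"
proof -
  obtain B where B: "B > 0" "\<And>xs. length xs = n \<Longrightarrow> cmod (f xs) \<le> B"
    using schwartz_uniform_bound[OF assms(2)] by blast
  have "cmod (G t * f (map (L t) xs)) \<le> cmod (G t) * (B * exp (real 0 * \<bar>t\<bar>))" for t
    using B(2)[of "map (L t) xs"] assms(3) by (simp add: norm_mult mult_left_mono)
  then show ?thesis
    by (rule weight_integrable_bound[OF assms(1) smear_measurable[OF assms]])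
qed

lemma smear_point_mass:
  assumes "schwartz_comp n f" "length xs = n"
  shows "smear (point_mass t) (\<lambda>_. 1) f xs = f (map (L t) xs)"
  unfolding smear_def using borel_measurable_continuous_onI[OF schwartz_orbit_continuous[OF assms]]
  by (subst integral_point_mass) auto

text \<open>Differentiation under the integral. Moving the \<open>i\<close>-th argument by
  \<open>b\<close> moves its image by \<open>L t b\<close>, whose coordinates are moderate; they
  join the weight, and the derivative is a sum of smeared Schwartz functions.\<close>

lemma smear_partial:
  assumes G: "weight M G" and f: "schwartz_comp n f" and i: "i < n" "b \<in> Basis"
  shows "has_partial n i b (smear M G f)
    (\<lambda>xs. \<Sum>c\<in>Basis. smear M (\<lambda>t. G t * of_real (L t b \<bullet> c)) (partial (i, c) f) xs)"
  unfolding has_partial_def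
proof (intro allI impI)
  fix xs :: "'v list" assume xs: "length xs = n"
  define ys where "ys = (\<lambda>s. xs[i := xs ! i + s *\<^sub>R b])"
  define F where "F = (\<lambda>s t. G t * f (map (L t) (ys s)))"
  define F' where "F' = (\<lambda>s t. G t * (\<Sum>c\<in>Basis. (L t b \<bullet> c) *\<^sub>R partial (i, c) f (map (L t) (ys s))))"
  have len: "length (ys s) = n" for s by (simp add: ys_def xs)
  have "\<forall>c\<in>Basis. \<exists>B. \<forall>xs. length xs = n \<longrightarrow> cmod (partial (i, c) f xs) \<le> B"
    using schwartz_uniform_bound[OF schwartz_partial[OF f i(1)]] by metis
  from bchoice[OF this] obtain B
    where B: "\<And>c xs. c \<in> Basis \<Longrightarrow> length xs = n \<Longrightarrow> cmod (partial (i, c) f xs) \<le> B c" by blast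
  have B0: "0 \<le> B c" if "c \<in> Basis" for c by (rule order_trans[OF norm_ge_zero B[OF that length_replicate]])
  \<comment> \<open>Suprema of the partial derivatives times the constant in the growth bound of
    \<open>L t b\<close>; the factor exp |t| is left to the weight.\<close>
  define C where "C = (\<Sum>c\<in>Basis. \<kappa> * B c)"
  have "((\<lambda>s. LINT t|M. F s t) has_vector_derivative (LINT t|M. F' 0 t)) (at 0)"
  proof (rule has_vector_derivative_integral)
    show "integrable M (F s)" for s unfolding F_def by (rule smear_integrable[OF G f len])
    have "integrable M (\<lambda>t. cmod (G t) * exp (real 1 * \<bar>t\<bar>))"
      using G unfolding weight_def by blast
    then show "integrable M (\<lambda>t. C * (cmod (G t) * exp (real 1 * \<bar>t\<bar>)))"
      by (simp only: integrable_mult_right)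
    fix s t
    have "((\<lambda>s. f (map (\<lambda>k. L t (ys s ! k)) [0..<n])) has_vector_derivative
        (\<Sum>j<n. \<Sum>c\<in>Basis. ((if j = i then L t b else 0) \<bullet> c) *\<^sub>R partial (j, c) f (map (\<lambda>k. L t (ys s ! k)) [0..<n]))) (at s)"
    proof (rule schwartz_chain_rule[OF f])
      fix k s assume k: "k < n"
      show "((\<lambda>s. L t (ys s ! k)) has_vector_derivative (if k = i then L t b else 0)) (at s)"
      proof (cases "k = i")
        case True
        have "L t (ys s ! k) = L t (xs ! i) + s *\<^sub>R L t b" for s
          using k xs by (simp add: ys_def True linear_add[OF L_linear] linear_scale[OF L_linear])
        then show ?thesis using True by (auto intro!: derivative_eq_intros)
      next
        case False
        then show ?thesis by (simp add: ys_def)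
      qed
    qed
    moreover have "(\<Sum>j<n. \<Sum>c\<in>Basis. ((if j = i then L t b else 0) \<bullet> c) *\<^sub>R partial (j, c) f (map (L t) (ys s)))
        = (\<Sum>j<n. if j = i then \<Sum>c\<in>Basis. (L t b \<bullet> c) *\<^sub>R partial (i, c) f (map (L t) (ys s)) else 0)"
      by (intro sum.cong) auto
    ultimately have "((\<lambda>s. f (map (L t) (ys s))) has_vector_derivative
        (\<Sum>c\<in>Basis. (L t b \<bullet> c) *\<^sub>R partial (i, c) f (map (L t) (ys s)))) (at s)"
      using i(1) by (simp add: map_L_coordinates[OF len])
    then show "((\<lambda>s. F s t) has_vector_derivative F' s t) (at s)"
      unfolding F_def F'_def by (rule has_vector_derivative_mult_right)
    have "cmod (\<Sum>c\<in>Basis. (L t b \<bullet> c) *\<^sub>R partial (i, c) f (map (L t) (ys s))) \<le> (\<Sum>c\<in>Basis. (\<kappa> * exp \<bar>t\<bar>) * B c)"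
    proof (rule sum_norm_le)
      fix c :: 'v assume c: "c \<in> Basis"
      have "\<bar>L t b \<bullet> c\<bar> \<le> norm (L t b)" using Cauchy_Schwarz_ineq2[of "L t b" c] c by simp
      also have "\<dots> \<le> \<kappa> * exp \<bar>t\<bar>" using L_bound[of t b] i by simp
      finally show "cmod ((L t b \<bullet> c) *\<^sub>R partial (i, c) f (map (L t) (ys s))) \<le> (\<kappa> * exp \<bar>t\<bar>) * B c"
        using B[OF c, of "map (L t) (ys s)"] len kappa by (simp add: mult_mono)
    qed
    also have "\<dots> = C * exp (real 1 * \<bar>t\<bar>)" by (simp add: C_def sum_distrib_left sum_distrib_right mult_ac)
    finally have "cmod (F' s t) \<le> cmod (G t) * (C * exp (real 1 * \<bar>t\<bar>))"
      unfolding F'_def norm_mult by (rule mult_left_mono) simp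
    then show "cmod (F' s t) \<le> C * (cmod (G t) * exp (real 1 * \<bar>t\<bar>))" by (simp add: mult_ac)
  qed
  moreover have "(LINT t|M. F' 0 t) = (\<Sum>c\<in>Basis. smear M (\<lambda>t. G t * of_real (L t b \<bullet> c)) (partial (i, c) f) xs)"
  proof -
    have y0: "ys 0 = xs" by (simp add: ys_def)
    have "F' 0 = (\<lambda>t. \<Sum>c\<in>Basis. G t * of_real (L t b \<bullet> c) * partial (i, c) f (map (L t) xs))"
      by (simp add: F'_def y0 sum_distrib_left scaleR_conv_of_real mult_ac)
    then show ?thesis unfolding smear_def
      using smear_integrable[OF weight_mult[OF G moderate_coefficient[OF i(2)]] schwartz_partial[OF f i(1)] xs]
      by simp
  qed
  ultimately show "((\<lambda>s. smear M G f (xs[i := xs ! i + s *\<^sub>R b])) has_vector_derivative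
      (\<Sum>c\<in>Basis. smear M (\<lambda>t. G t * of_real (L t b \<bullet> c)) (partial (i, c) f) xs)) (at 0)"
    by (simp add: smear_def F_def ys_def)
qed

text \<open>The iterated partial derivatives of a smeared function stay in a class that does not depend
  on the measure and the weight: these only enter through smearing.\<close>

inductive smear_class :: "nat \<Rightarrow> (real measure \<times> (real \<Rightarrow> complex) \<Rightarrow> 'v list \<Rightarrow> complex) \<Rightarrow> bool" for n where
  base: "moderate m \<Longrightarrow> schwartz_comp n h \<Longrightarrow> smear_class n (\<lambda>w. smear (fst w) (\<lambda>t. snd w t * of_real (m t)) h)"
| zero: "smear_class n (\<lambda>w xs. 0)"
| add: "smear_class n F \<Longrightarrow> smear_class n F' \<Longrightarrow> smear_class n (\<lambda>w xs. F w xs + F' w xs)"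

lemma smear_class_sum:
  "(\<And>c. c \<in> I \<Longrightarrow> smear_class n (F c)) \<Longrightarrow> smear_class n (\<lambda>w xs. \<Sum>c\<in>I. F c w xs)"
  by (induction I rule: infinite_finite_induct) (auto intro: smear_class.intros)

lemma smear_class_partial:
  assumes "smear_class n F" "i < n" "b \<in> Basis"
  shows "\<exists>F'. smear_class n F' \<and> (\<forall>w\<in>{(M, G). weight M G}. has_partial n i b (F w) (F' w))"
  using assms(1)
proof induction
  case (base m h)
  let ?F = "\<lambda>w xs. \<Sum>c\<in>Basis. smear (fst w) (\<lambda>t. snd w t * of_real (m t * (L t b \<bullet> c))) (partial (i, c) h) xs"
  have "smear_class n ?F"
    by (intro smear_class_sum smear_class.base moderate_mult moderate_coefficient schwartz_partial base assms(2,3))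
  moreover have "has_partial n i b (smear M (\<lambda>t. G t * of_real (m t)) h) (?F (M, G))" if "weight M G" for M G
    using smear_partial[OF weight_mult[OF that base(1)] base(2) assms(2,3)] by (simp add: mult.assoc)
  ultimately show ?case by auto
next
  case zero
  then show ?case by (intro exI[of _ "\<lambda>w xs. 0"]) (auto simp: has_partial_def intro: smear_class.zero)
next
  case (add F F')
  then obtain D D' where "smear_class n D" "\<forall>w\<in>{(M, G). weight M G}. has_partial n i b (F w) (D w)"
     "smear_class n D'" "\<forall>w\<in>{(M, G). weight M G}. has_partial n i b (F' w) (D' w)" by blast
  then show ?case
    by (intro exI[of _ "\<lambda>w xs. D w xs + D' w xs"]) (auto intro: smear_class.add has_partial_add)
qed

text \<open>The gain from the class: \<open>C\<close> and \<open>K\<close> depend on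
  \<open>F\<close> and \<open>N\<close> alone and hold for every measure, weight and point at
  once.\<close>

lemma smear_class_bound:
  assumes "smear_class n F"
  shows "\<exists>C K. C \<ge> 0 \<and> (\<forall>M G xs. weight M G \<longrightarrow> length xs = n \<longrightarrow>
    (1 + list_norm xs) ^ N * cmod (F (M, G) xs) \<le> C * (LINT t|M. cmod (G t) * exp (real K * \<bar>t\<bar>)))"
  using assms
proof induction
  case (base m h)
  obtain C and K :: nat where C: "C \<ge> 0" "\<And>t::real. \<bar>m t\<bar> \<le> C * exp (K * \<bar>t\<bar>)"
    using base(1) by (rule moderateE) blast
  obtain B where B: "B > 0" "\<And>xs. length xs = n \<Longrightarrow> (1 + list_norm xs) ^ N * cmod (h xs) \<le> B"
    using schwartz_bound[OF base(2)] by metis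
  define C' where "C' = C * (\<kappa> ^ N * B)"
  show ?case
  proof (intro exI[of _ C'] exI[of _ "K + N"] conjI allI impI)
    show "C' \<ge> 0" using C B(1) kappa by (simp add: C'_def)
    fix M G and xs :: "'v list" assume G: "weight M G" and xs: "length xs = n"
    note Gm = weight_mult[OF G base(1)]
    let ?f = "\<lambda>t. G t * of_real (m t) * h (map (L t) xs)"
    have bd: "cmod (of_real ((1 + list_norm xs) ^ N) * ?f t) \<le> cmod (G t) * (C' * exp (real (K + N) * \<bar>t\<bar>))" for t
    proof -
      have "(1 + list_norm xs) ^ N * cmod (h (map (L t) xs))
          \<le> \<kappa> ^ N * exp (N * \<bar>t\<bar>) * (1 + list_norm (map (L t) xs)) ^ N * cmod (h (map (L t) xs))"
        by (intro mult_right_mono list_norm_L_bound) simp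
      also have "\<dots> \<le> \<kappa> ^ N * exp (N * \<bar>t\<bar>) * B"
        using B(2)[of "map (L t) xs"] xs kappa by (simp add: mult.assoc mult_left_mono)
      finally have 1: "(1 + list_norm xs) ^ N * cmod (h (map (L t) xs)) \<le> \<kappa> ^ N * B * exp (N * \<bar>t\<bar>)"
        by (simp add: mult_ac)
      have "\<bar>m t\<bar> * ((1 + list_norm xs) ^ N * cmod (h (map (L t) xs))) \<le> (C * exp (K * \<bar>t\<bar>)) * (\<kappa> ^ N * B * exp (N * \<bar>t\<bar>))"
        by (intro mult_mono C 1) (use C in auto)
      also have "\<dots> = C' * exp (real (K + N) * \<bar>t\<bar>)" by (simp add: C'_def algebra_simps exp_add)
      finally have "cmod (G t) * (\<bar>m t\<bar> * ((1 + list_norm xs) ^ N * cmod (h (map (L t) xs)))) \<le> cmod (G t) * (C' * exp (real (K + N) * \<bar>t\<bar>))"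
        by (rule mult_left_mono) simp
      moreover have "cmod (of_real ((1 + list_norm xs) ^ N) :: complex) = (1 + list_norm xs) ^ N"
        unfolding norm_of_real by simp
      ultimately show ?thesis unfolding norm_mult by (simp only: norm_of_real mult_ac)
    qed
    have "(1 + list_norm xs) ^ N * cmod (smear M (\<lambda>t. G t * of_real (m t)) h xs)
        = cmod (LINT t|M. of_real ((1 + list_norm xs) ^ N) * ?f t)"
      unfolding smear_def by (simp add: norm_mult del: of_real_power of_real_add)
    also have "\<dots> \<le> (LINT t|M. cmod (of_real ((1 + list_norm xs) ^ N) * ?f t))"
      by (rule integral_norm_bound)
    also have "\<dots> \<le> C' * (LINT t|M. cmod (G t) * exp (real (K + N) * \<bar>t\<bar>))"
      using weight_integrable_bound(2)[OF G _ bd] smear_measurable[OF Gm base(2) xs] by simp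
    finally show "(1 + list_norm xs) ^ N * cmod (smear (fst (M, G)) (\<lambda>t. snd (M, G) t * of_real (m t)) h xs)
        \<le> C' * (LINT t|M. cmod (G t) * exp (real (K + N) * \<bar>t\<bar>))" by simp
  qed
next
  case zero
  then show ?case by (intro exI[of _ 0]) auto
next
  case (add F F')
  from add.IH(1) obtain C K where 1: "C \<ge> 0" "\<forall>M G xs. weight M G \<longrightarrow> length xs = n \<longrightarrow>
    (1 + list_norm xs) ^ N * cmod (F (M, G) xs) \<le> C * (LINT t|M. cmod (G t) * exp (real K * \<bar>t\<bar>))" by blast
  from add.IH(2) obtain C' K' where 2: "C' \<ge> 0" "\<forall>M G xs. weight M G \<longrightarrow> length xs = n \<longrightarrow>
    (1 + list_norm xs) ^ N * cmod (F' (M, G) xs) \<le> C' * (LINT t|M. cmod (G t) * exp (real K' * \<bar>t\<bar>))" by blast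
  note C = 1 2
  show ?case
  proof (intro exI[of _ "C + C'"] exI[of _ "max K K'"] conjI allI impI)
    fix M G and xs :: "'v list" assume G: "weight M G" and xs: "length xs = n"
    have "(1 + list_norm xs) ^ N * cmod (F (M, G) xs + F' (M, G) xs)
        \<le> (1 + list_norm xs) ^ N * (cmod (F (M, G) xs) + cmod (F' (M, G) xs))"
      by (intro mult_left_mono norm_triangle_ineq) simp
    also have "\<dots> \<le> C * (LINT t|M. cmod (G t) * exp (real K * \<bar>t\<bar>)) + C' * (LINT t|M. cmod (G t) * exp (real K' * \<bar>t\<bar>))"
      using C G xs by (simp add: distrib_left add_mono)
    also have "\<dots> \<le> C * (LINT t|M. cmod (G t) * exp (real (max K K') * \<bar>t\<bar>)) + C' * (LINT t|M. cmod (G t) * exp (real (max K K') * \<bar>t\<bar>))"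
      by (intro add_mono mult_left_mono weight_moment_mono[OF G] C) auto
    finally show "(1 + list_norm xs) ^ N * cmod (F (M, G) xs + F' (M, G) xs) \<le> (C + C') * (LINT t|M. cmod (G t) * exp (real (max K K') * \<bar>t\<bar>))"
      by (simp add: distrib_right)
  qed (use C in auto)
qed

lemma smear_class_continuous:
  assumes "smear_class n F" "weight M G"
  shows "continuous_on UNIV (\<lambda>x. F (M, G) (map x [0..<n]))"
  using assms(1)
proof induction
  case (base m h)
  note Gm = weight_mult[OF assms(2) base(1)]
  obtain B where B: "B > 0" "\<And>xs. length xs = n \<Longrightarrow> cmod (h xs) \<le> B"
    using schwartz_uniform_bound[OF base(2)] by blast
  have "(\<lambda>i. smear M (\<lambda>t. G t * of_real (m t)) h (map (x i) [0..<n])) \<longlonglongrightarrow> smear M (\<lambda>t. G t * of_real (m t)) h (map a [0..<n])"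
    if x: "x \<longlonglongrightarrow> a" for x a
    unfolding smear_def
  proof (rule integral_dominated_convergence)
    show "(\<lambda>t. G t * of_real (m t) * h (map (L t) (map a [0..<n]))) \<in> borel_measurable M"
      "(\<lambda>t. G t * of_real (m t) * h (map (L t) (map (x i) [0..<n]))) \<in> borel_measurable M" for i
      by (rule smear_measurable[OF Gm base(2)]; simp)+
    have "integrable M (\<lambda>t. cmod (G t * of_real (m t)) * exp (real 0 * \<bar>t\<bar>))"
      using Gm unfolding weight_def by blast
    then have "integrable M (\<lambda>t. cmod (G t * of_real (m t)))"
      by (simp only: of_nat_0 mult_zero_left exp_zero mult_1_right)
    then show "integrable M (\<lambda>t. cmod (G t * of_real (m t)) * B)" by (rule integrable_mult_left)
    have "(\<lambda>i. h (map (\<lambda>k. L t (x i k)) [0..<n])) \<longlonglongrightarrow> h (map (\<lambda>k. L t (a k)) [0..<n])" for t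
    proof -
      have "continuous_on UNIV (\<lambda>y. h (map (\<lambda>k. L t (y k)) [0..<n]))"
      proof (rule continuous_on_compose2[OF schwartz_continuous[OF base(2)]])
        have *: "continuous_on UNIV (\<lambda>y. L t (y k))" for k :: nat
          by (rule continuous_on_compose2[OF L_continuous_vector[of UNIV]])
             (rule continuous_on_product_then_coordinatewise[OF continuous_on_id], simp)
        show "continuous_on UNIV (\<lambda>y (k::nat). L t (y k))" by (rule continuous_on_coordinates) (rule *)
      qed simp
      then show ?thesis using x unfolding continuous_on_sequentially comp_def by blast
    qed
    then show "AE t in M. (\<lambda>i. G t * of_real (m t) * h (map (L t) (map (x i) [0..<n]))) \<longlonglongrightarrow> G t * of_real (m t) * h (map (L t) (map a [0..<n]))"
      by (intro AE_I2 tendsto_mult_left) (simp only: map_map comp_def)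
    show "AE t in M. norm (G t * of_real (m t) * h (map (L t) (map (x i) [0..<n]))) \<le> cmod (G t * of_real (m t)) * B" for i
      by (intro AE_I2, subst norm_mult, rule mult_left_mono, rule B(2)) simp_all
  qed
  then show ?case unfolding continuous_on_sequentially comp_def by simp
qed (auto intro: continuous_on_add continuous_on_const)

lemma smear_in_class: "schwartz_comp n f \<Longrightarrow> smear_class n (\<lambda>w. smear (fst w) (snd w) f)"
  using smear_class.base[OF moderate_one] by simp

lemma smear_class_schwartz:
  assumes "smear_class n F" "weight M G" shows "schwartz_comp n (F (M, G))"
proof (rule schwartz_compI)
  let ?K = "(\<lambda>F. F (M, G)) ` {F. smear_class n F}"
  show "F (M, G) \<in> ?K" using assms by blast
  show "\<exists>f'\<in>?K. has_partial n i b f f'" if "f \<in> ?K" "i < n" "b \<in> Basis" for f i b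
  proof -
    from that(1) obtain F where F: "smear_class n F" "f = F (M, G)" by blast
    from smear_class_partial[OF this(1) that(2,3)] assms(2)
    obtain F' where "smear_class n F'" "has_partial n i b f (F' (M, G))" unfolding F(2) by blast
    then show ?thesis by blast
  qed
  show "continuous_on UNIV (\<lambda>x. f (map x [0..<n]))" if "f \<in> ?K" for f
    using that smear_class_continuous assms(2) by blast
  show "\<exists>B. \<forall>xs. length xs = n \<longrightarrow> (1 + list_norm xs) ^ N * cmod (f xs) \<le> B" if "f \<in> ?K" for f N
  proof -
    from that obtain F where F: "smear_class n F" "f = F (M, G)" by blast
    from smear_class_bound[OF F(1), of N] assms(2) show ?thesis unfolding F(2) by blast
  qed
qed

lemma smear_schwartz: "schwartz_comp n f \<Longrightarrow> weight M G \<Longrightarrow> schwartz_comp n (smear M G f)"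
  using smear_class_schwartz[OF smear_in_class, of n f M G] by simp

text \<open>One member \<open>F\<close> represents the derivative for all measures and weights
  together, so that smearing with Lebesgue measure can be compared with a point mass.\<close>

lemma smear_partials:
  assumes "schwartz_comp n f" "js \<in> directions n"
  obtains F where "smear_class n F"
    "\<And>M G xs. weight M G \<Longrightarrow> length xs = n \<Longrightarrow> partials js (smear M G f) xs = F (M, G) xs"
proof -
  have "\<exists>F\<in>{F. smear_class n F}. \<forall>w\<in>{(M, G). weight M G}. \<forall>xs. length xs = n \<longrightarrow>
      partials js (smear (fst w) (snd w) f) xs = F w xs"
    by (rule partials_in_closed_class[OF _ _ assms(2)])
       (use smear_class_partial smear_in_class[OF assms(1)] in auto)
  then show ?thesis using that by auto
qed

lemma smear_borchers:
  assumes "f \<in> borchers" "weight M G" shows "smear M G f \<in> borchers"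
proof -
  obtain N where "\<forall>xs. N < length xs \<longrightarrow> f xs = 0" using assms(1) by (auto simp: borchers_def)
  then have "\<forall>xs. N < length xs \<longrightarrow> smear M G f xs = 0" by (simp add: smear_def)
  then show ?thesis using assms smear_schwartz by (auto simp: borchers_def)
qed

end

section \<open>Schwartz norms\<close>

lemma finite_directions: "finite {js \<in> directions n. length js \<le> N}"
proof -
  have "{js \<in> directions n. length js \<le> N}
      = {js. set js \<subseteq> {..<n} \<times> (Basis :: 'a::euclidean_space set) \<and> length js \<le> N}"
    by (auto simp: directions_def lists_eq_set)
  then show ?thesis by (simp add: finite_lists_length_le)
qed

lemma schwartz_norm_le:
  fixes f :: "'a::euclidean_space list \<Rightarrow> complex"
  assumes "\<And>js xs. js \<in> directions n \<Longrightarrow> length js \<le> N \<Longrightarrow> length xs = n \<Longrightarrow>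
    (1 + list_norm xs) ^ N * cmod (partials js f xs) \<le> B"
  shows "schwartz_norm n N f \<le> B"
  unfolding schwartz_norm_def
proof (rule cSUP_least)
  have "([], replicate n 0) \<in> {js :: (nat \<times> 'a) list. js \<in> directions n \<and> length js \<le> N} \<times> {xs :: 'a list. length xs = n}"
    by simp
  then show "{js :: (nat \<times> 'a) list. js \<in> directions n \<and> length js \<le> N} \<times> {xs :: 'a list. length xs = n} \<noteq> {}"
    by (metis empty_iff)
  fix z assume "z \<in> {js :: (nat \<times> 'a) list. js \<in> directions n \<and> length js \<le> N} \<times> {xs :: 'a list. length xs = n}"
  then show "(case z of (js, xs) \<Rightarrow> (1 + list_norm xs) ^ N * cmod (partials js f xs)) \<le> B"
    using assms by (cases z) (simp only: mem_Times_iff mem_Collect_eq fst_conv snd_conv prod.case)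
qed

text \<open>Only finitely many derivatives enter, each bounded with the given polynomial weight;
  hence the set is bounded above and \<open>SUP\<close> is an actual upper bound.\<close>

lemma schwartz_norm_upper:
  assumes f: "schwartz_comp n f" and js: "js \<in> directions n" "length js \<le> N" "length xs = n"
  shows "(1 + list_norm xs) ^ N * cmod (partials js f xs) \<le> schwartz_norm n N f"
proof -
  let ?h = "\<lambda>(js, xs). (1 + list_norm xs) ^ N * cmod (partials js f xs)"
  let ?D = "{js \<in> directions n. length js \<le> N}"
  have eq: "?h ` (?D \<times> {xs. length xs = n})
     = (\<Union>js\<in>?D. (\<lambda>xs. (1 + list_norm xs) ^ N * cmod (partials js f xs)) ` {xs. length xs = n})"
    by auto
  have "bdd_above (?h ` (?D \<times> {xs. length xs = n}))"
    unfolding eq using f by (subst bdd_above_UN[OF finite_directions]) (simp add: schwartz_comp_def)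
  then have "?h (js, xs) \<le> (SUP z\<in>?D \<times> {xs. length xs = n}. ?h z)"
    by (rule cSUP_upper[rotated]) (use js in simp)
  then show ?thesis by (simp add: schwartz_norm_def)
qed

lemma schwartz_norm_nonneg:
  assumes "schwartz_comp n (f :: 'a::euclidean_space list \<Rightarrow> complex)" shows "0 \<le> schwartz_norm n N f"
proof -
  have "0 \<le> (1 + list_norm (replicate n (0::'a))) ^ N * cmod (partials [] f (replicate n (0::'a)))" by simp
  also have "\<dots> \<le> schwartz_norm n N f" by (rule schwartz_norm_upper[OF assms]) simp_all
  finally show ?thesis .
qed

lemma schwartz_norm_mono:
  assumes f: "schwartz_comp n (f :: 'a::euclidean_space list \<Rightarrow> complex)" and "N \<le> N'" shows "schwartz_norm n N f \<le> schwartz_norm n N' f"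
proof (rule schwartz_norm_le)
  fix js :: "(nat \<times> 'a) list" and xs :: "'a list"
  assume js: "js \<in> directions n" "length js \<le> N" "length xs = n"
  have "(1 + list_norm xs) ^ N * cmod (partials js f xs) \<le> (1 + list_norm xs) ^ N' * cmod (partials js f xs)"
    using assms(2) by (intro mult_right_mono power_increasing) simp_all
  also have "\<dots> \<le> schwartz_norm n N' f" by (rule schwartz_norm_upper[OF f]) (use js assms(2) in simp_all)
  finally show "(1 + list_norm xs) ^ N * cmod (partials js f xs) \<le> schwartz_norm n N' f" .
qed

lemma partials_cong:
  assumes "\<And>xs. length xs = n \<Longrightarrow> f xs = g xs" "js \<in> directions n" "length xs = n"
  shows "partials js f xs = partials js g xs"
  using assms(2,3)
proof (induction js arbitrary: xs)
  case Nil then show ?case using assms(1) by simp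
next
  case (Cons j js)
  obtain i b where j: "j = (i, b)" by force
  have "(\<lambda>t. partials js f (xs[i := xs ! i + t *\<^sub>R b])) = (\<lambda>t. partials js g (xs[i := xs ! i + t *\<^sub>R b]))"
    using Cons j by simp
  then show ?case by (simp add: j partial.simps)
qed

lemma schwartz_norm_cong:
  assumes "\<And>xs :: 'a::euclidean_space list. length xs = n \<Longrightarrow> f xs = g xs"
  shows "schwartz_norm n N f = schwartz_norm n N g"
  unfolding schwartz_norm_def
proof (rule SUP_cong[OF refl], clarify)
  fix js :: "(nat \<times> 'a) list" and xs :: "'a list"
  assume "js \<in> directions (length xs)" "length js \<le> N" "n = length xs"
  then have "partials js f xs = partials js g xs" by (intro partials_cong[OF assms]) auto
  then show "(1 + list_norm xs) ^ N * cmod (partials js f xs) = (1 + list_norm xs) ^ N * cmod (partials js g xs)"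
    by (simp only:)
qed

section \<open>Uniform Schwartz norm estimates for smeared functions\<close>

context linear_group
begin

lemma orbit_decay:
  assumes "schwartz_comp n f"
  obtains C where "C \<ge> 0"
    "\<And>t xs. length xs = n \<Longrightarrow> (1 + list_norm xs) ^ N * cmod (f (map (L t) xs)) \<le> C * exp (real N * \<bar>t\<bar>)"
proof -
  obtain B where B: "B > 0" "\<And>xs. length xs = n \<Longrightarrow> (1 + list_norm xs) ^ N * cmod (f xs) \<le> B"
    using schwartz_bound[OF assms] by blast
  show ?thesis
  proof (rule that[of "\<kappa> ^ N * B"])
    show "\<kappa> ^ N * B \<ge> 0" using B(1) kappa by simp
    fix t and xs :: "'v list" assume xs: "length xs = n"
    have "(1 + list_norm xs) ^ N * cmod (f (map (L t) xs))
        \<le> \<kappa> ^ N * exp (real N * \<bar>t\<bar>) * (1 + list_norm (map (L t) xs)) ^ N * cmod (f (map (L t) xs))"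
      by (rule mult_right_mono[OF list_norm_L_bound norm_ge_zero])
    also have "\<dots> = (\<kappa> ^ N * exp (real N * \<bar>t\<bar>)) * ((1 + list_norm (map (L t) xs)) ^ N * cmod (f (map (L t) xs)))"
      by (simp only: mult.assoc)
    also have "\<dots> \<le> (\<kappa> ^ N * exp (real N * \<bar>t\<bar>)) * B"
      by (rule mult_left_mono[OF B(2)]) (use xs kappa in simp_all)
    finally show "(1 + list_norm xs) ^ N * cmod (f (map (L t) xs)) \<le> \<kappa> ^ N * B * exp (real N * \<bar>t\<bar>)"
      by (simp only: mult_ac)
  qed
qed

text \<open>Mean value estimate along the orbit, whose velocity is \<open>X\<close>. As
  \<open>X\<close> grows linearly, one extra power of decay of the partial derivatives is spent on
  it, hence the exponent \<open>Suc N\<close> in the proof.\<close>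

lemma flow_difference:
  assumes f: "schwartz_comp n f"
  obtains C where "C \<ge> 0" "\<And>t xs. length xs = n \<Longrightarrow>
    (1 + list_norm xs) ^ N * cmod (f (map (L t) xs) - f xs) \<le> C * (\<bar>t\<bar> * exp (real N * \<bar>t\<bar>))"
proof -
  have "\<exists>B. \<forall>i<n. \<forall>b\<in>Basis. B (i, b) \<ge> 0 \<and> (\<forall>xs. length xs = n \<longrightarrow>
      (1 + list_norm xs) ^ Suc N * cmod (partial (i, b) f xs) \<le> B (i, b))"
  proof -
    have "\<forall>p\<in>{..<n} \<times> Basis. \<exists>B. B \<ge> 0 \<and> (\<forall>xs. length xs = n \<longrightarrow>
      (1 + list_norm xs) ^ Suc N * cmod (partial p f xs) \<le> B)"
    proof
      fix p :: "nat \<times> 'v" assume p: "p \<in> {..<n} \<times> Basis"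
      then have "schwartz_comp n (partial p f)" by (cases p) (auto intro: schwartz_partial[OF f])
      from schwartz_bound[OF this, of "Suc N"] obtain b where b: "b > 0"
        "\<And>xs. length xs = n \<Longrightarrow> (1 + list_norm xs) ^ Suc N * cmod (partial p f xs) \<le> b" by blast
      show "\<exists>B. B \<ge> 0 \<and> (\<forall>xs. length xs = n \<longrightarrow>
          (1 + list_norm xs) ^ Suc N * cmod (partial p f xs) \<le> B)"
        by (intro exI[of _ b] conjI allI impI b(2) less_imp_le[OF b(1)])
    qed
    from bchoice[OF this] show ?thesis by auto
  qed
  then obtain B where B0: "\<And>i b. i < n \<Longrightarrow> b \<in> Basis \<Longrightarrow> B (i, b) \<ge> 0"
    and B: "\<And>i b xs. i < n \<Longrightarrow> b \<in> Basis \<Longrightarrow> length xs = n \<Longrightarrow>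
      (1 + list_norm xs) ^ Suc N * cmod (partial (i, b) f xs) \<le> B (i, b)" by blast
  define S where "S = (\<Sum>i<n. \<Sum>b\<in>Basis. B (i, b))"
  have S0: "S \<ge> 0" unfolding S_def by (intro sum_nonneg B0) auto
  show ?thesis
  \<comment> \<open>\<open>\<kappa> ^ N\<close> converts the polynomial weight at the orbit point
    back to the one at \<open>xs\<close>; the single \<open>\<kappa>\<close> bounds
    \<open>X\<close>.\<close>
  proof (rule that[of "\<kappa> ^ N * \<kappa> * S"])
    show "\<kappa> ^ N * \<kappa> * S \<ge> 0" using S0 kappa by simp
    fix t and xs :: "'v list" assume xs: "length xs = n"
    define D where "D = (\<lambda>s. \<Sum>i<n. \<Sum>b\<in>Basis. (X (L s (xs ! i)) \<bullet> b) *\<^sub>R partial (i, b) f (map (L s) xs))"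
    have pos: "(1 + list_norm xs) ^ N > 0" by (rule zero_less_power) (simp add: add_pos_nonneg)
    have "norm (f (map (L t) xs) - f (map (L 0) xs))
        \<le> (\<kappa> ^ N * \<kappa> * S * exp (real N * \<bar>t\<bar>) / (1 + list_norm xs) ^ N) * \<bar>t - 0\<bar>"
    proof (rule vector_derivative_mean_bound[where S = "{-\<bar>t\<bar>..\<bar>t\<bar>}"])
      fix s assume s: "s \<in> {-\<bar>t\<bar>..\<bar>t\<bar>}"
      show "((\<lambda>s. f (map (L s) xs)) has_vector_derivative D s) (at s)"
        unfolding D_def map_L_coordinates[OF xs]
        by (rule schwartz_chain_rule[OF f]) (rule L_deriv)
      let ?ys = "map (L s) xs"
      have summand: "(1 + list_norm ?ys) ^ N * cmod ((X (L s (xs ! i)) \<bullet> b) *\<^sub>R partial (i, b) f ?ys) \<le> \<kappa> * B (i, b)"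
        if ib: "i < n" "b \<in> Basis" for i b
      proof -
        have "\<bar>X (L s (xs ! i)) \<bullet> b\<bar> \<le> norm (X (L s (xs ! i)))"
          using Cauchy_Schwarz_ineq2[of "X (L s (xs ! i))" b] ib by simp
        also have "\<dots> \<le> \<kappa> * norm (?ys ! i)" using X_bound[of "L s (xs ! i)"] ib xs by simp
        also have "\<dots> \<le> \<kappa> * (1 + list_norm ?ys)"
          using norm_nth_le_list_norm[of i ?ys] ib xs kappa by (intro mult_left_mono) simp_all
        finally have 1: "\<bar>X (L s (xs ! i)) \<bullet> b\<bar> \<le> \<kappa> * (1 + list_norm ?ys)" .
        have "(1 + list_norm ?ys) ^ N * cmod ((X (L s (xs ! i)) \<bullet> b) *\<^sub>R partial (i, b) f ?ys)
            = \<bar>X (L s (xs ! i)) \<bullet> b\<bar> * ((1 + list_norm ?ys) ^ N * cmod (partial (i, b) f ?ys))"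
          by (simp only: norm_scaleR mult_ac)
        also have "\<dots> \<le> \<kappa> * (1 + list_norm ?ys) * ((1 + list_norm ?ys) ^ N * cmod (partial (i, b) f ?ys))"
          by (rule mult_right_mono[OF 1]) simp
        also have "\<dots> = \<kappa> * ((1 + list_norm ?ys) ^ Suc N * cmod (partial (i, b) f ?ys))"
          by (simp only: power_Suc mult_ac)
        also have "\<dots> \<le> \<kappa> * B (i, b)"
          by (rule mult_left_mono[OF B[OF ib]]) (use xs kappa in simp_all)
        finally show ?thesis .
      qed
      have "(1 + list_norm ?ys) ^ N * norm (D s) \<le> (1 + list_norm ?ys) ^ N *
          (\<Sum>i<n. \<Sum>b\<in>Basis. cmod ((X (L s (xs ! i)) \<bullet> b) *\<^sub>R partial (i, b) f ?ys))"
        unfolding D_def by (rule mult_left_mono) (intro order_trans[OF norm_sum] sum_mono norm_sum, simp)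
      also have "\<dots> \<le> (\<Sum>i<n. \<Sum>b\<in>Basis. \<kappa> * B (i, b))"
        unfolding sum_distrib_left by (intro sum_mono summand) simp_all
      also have "\<dots> = \<kappa> * S" by (simp only: S_def sum_distrib_left)
      finally have 2: "(1 + list_norm ?ys) ^ N * norm (D s) \<le> \<kappa> * S" .
      have "(1 + list_norm xs) ^ N * norm (D s)
          \<le> \<kappa> ^ N * exp (real N * \<bar>s\<bar>) * (1 + list_norm ?ys) ^ N * norm (D s)"
        by (rule mult_right_mono[OF list_norm_L_bound norm_ge_zero])
      also have "\<dots> = \<kappa> ^ N * exp (real N * \<bar>s\<bar>) * ((1 + list_norm ?ys) ^ N * norm (D s))"
        by (simp only: mult.assoc)
      also have "\<dots> \<le> \<kappa> ^ N * exp (real N * \<bar>s\<bar>) * (\<kappa> * S)"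
        by (rule mult_left_mono[OF 2]) (use kappa in simp)
      also have "\<dots> \<le> \<kappa> ^ N * exp (real N * \<bar>t\<bar>) * (\<kappa> * S)"
      proof -
        have "\<bar>s\<bar> \<le> \<bar>t\<bar>" using s by auto
        then have "exp (real N * \<bar>s\<bar>) \<le> exp (real N * \<bar>t\<bar>)"
          unfolding exp_le_cancel_iff by (rule mult_left_mono) simp
        then show ?thesis
          by (intro mult_right_mono mult_left_mono) (use S0 kappa in simp_all)
      qed
      finally have 3: "(1 + list_norm xs) ^ N * norm (D s) \<le> \<kappa> ^ N * \<kappa> * S * exp (real N * \<bar>t\<bar>)"
        by (simp only: mult_ac)
      show "norm (D s) \<le> \<kappa> ^ N * \<kappa> * S * exp (real N * \<bar>t\<bar>) / (1 + list_norm xs) ^ N"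
        unfolding pos_le_divide_eq[OF pos] using 3 by (simp only: mult.commute)
    qed auto
    then have "cmod (f (map (L t) xs) - f xs) \<le> (\<kappa> ^ N * \<kappa> * S * exp (real N * \<bar>t\<bar>) * \<bar>t\<bar>) / (1 + list_norm xs) ^ N"
      by (simp only: L_at_0 diff_zero times_divide_eq_left)
    then show "(1 + list_norm xs) ^ N * cmod (f (map (L t) xs) - f xs) \<le> \<kappa> ^ N * \<kappa> * S * (\<bar>t\<bar> * exp (real N * \<bar>t\<bar>))"
      unfolding pos_le_divide_eq[OF pos] by (simp only: mult_ac)
  qed
qed

lemma weight_abs_moment_mono:
  assumes "weight M G" "(K::nat) \<le> K'"
  shows "(LINT t|M. cmod (G t) * (\<bar>t\<bar> * exp (real K * \<bar>t\<bar>))) \<le> (LINT t|M. cmod (G t) * (\<bar>t\<bar> * exp (real K' * \<bar>t\<bar>)))"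
proof (rule integral_mono[OF weight_integrable_abs[OF assms(1)] weight_integrable_abs[OF assms(1)]])
  show "cmod (G t) * (\<bar>t\<bar> * exp (real K * \<bar>t\<bar>)) \<le> cmod (G t) * (\<bar>t\<bar> * exp (real K' * \<bar>t\<bar>))" for t
    by (rule mult_left_mono[OF mult_left_mono[OF exp_abs_mono[OF assms(2)] abs_ge_zero] norm_ge_zero])
qed

text \<open>The point mass at 0 stands for the unsmeared function, seen through the same
  \<open>F\<close>. Since \<open>G\<close> has integral 1, both terms go under one integral, in
  which the factor of \<open>G\<close> vanishes to first order at t = 0.\<close>

lemma smear_class_difference:
  assumes "smear_class n F"
  shows "\<exists>C K. C \<ge> 0 \<and> (\<forall>M G xs. weight M G \<longrightarrow> (LINT t|M. G t) = 1 \<longrightarrow> length xs = n \<longrightarrow>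
    (1 + list_norm xs) ^ N * cmod (F (M, G) xs - F (point_mass 0, \<lambda>_. 1) xs)
      \<le> C * (LINT t|M. cmod (G t) * (\<bar>t\<bar> * exp (real K * \<bar>t\<bar>))))"
  using assms
proof induction
  case (base m h)
  obtain C and K :: nat where C: "C \<ge> 0" "\<And>t::real. \<bar>m t\<bar> \<le> C * exp (K * \<bar>t\<bar>)"
    "\<And>t::real. \<bar>m t - m 0\<bar> \<le> C * \<bar>t\<bar> * exp (K * \<bar>t\<bar>)"
    using base(1) by (rule moderateE) blast
  obtain A where A: "A \<ge> 0" "\<And>t xs. length xs = n \<Longrightarrow>
      (1 + list_norm xs) ^ N * cmod (h (map (L t) xs)) \<le> A * exp (real N * \<bar>t\<bar>)"
    using orbit_decay[OF base(2)] by blast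
  obtain B where B: "B \<ge> 0" "\<And>t xs. length xs = n \<Longrightarrow>
      (1 + list_norm xs) ^ N * cmod (h (map (L t) xs) - h xs) \<le> B * (\<bar>t\<bar> * exp (real N * \<bar>t\<bar>))"
    using flow_difference[OF base(2)] by blast
  define C' where "C' = C * (A + B)"
  have C': "C' \<ge> 0" using C A B by (simp add: C'_def)
  have "(1 + list_norm xs) ^ N * cmod (smear M (\<lambda>t. G t * of_real (m t)) h xs - smear (point_mass 0) (\<lambda>t. 1 * of_real (m t)) h xs)
      \<le> C' * (LINT t|M. cmod (G t) * (\<bar>t\<bar> * exp (real (K + N) * \<bar>t\<bar>)))"
    if G: "weight M G" and one: "(LINT t|M. G t) = 1" and xs: "length xs = n" for M G xs
  proof -
    note Gm = weight_mult[OF G base(1)]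
    let ?r = "complex_of_real ((1 + list_norm xs) ^ N)"
    let ?d = "\<lambda>t. of_real (m t) * h (map (L t) xs) - of_real (m 0) * h xs"
    have cm: "continuous_on UNIV m" using base(1) by (simp add: moderate_def)
    have pm: "smear (point_mass 0) (\<lambda>t. 1 * of_real (m t)) h xs = of_real (m 0) * h xs"
    proof -
      have "(\<lambda>t. 1 * of_real (m t) * h (map (L t) xs)) \<in> borel_measurable borel"
        by (intro borel_measurable_continuous_onI continuous_on_mult continuous_on_of_real cm
            continuous_on_const schwartz_orbit_continuous[OF base(2) xs])
      then have "smear (point_mass 0) (\<lambda>t. 1 * of_real (m t)) h xs = 1 * of_real (m 0) * h (map (L 0) xs)"
        unfolding smear_def by (rule integral_point_mass)
      then show ?thesis by (simp only: L_at_0 mult_1)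
    qed
    have intG: "integrable M G"
    proof (rule weight_integrable_bound(1)[OF G weight_measurable(2)[OF G]])
      show "cmod (G t) \<le> cmod (G t) * (1 * exp (real 0 * \<bar>t\<bar>))" for t by simp
    qed
    have int1: "integrable M (\<lambda>t. G t * of_real (m t) * h (map (L t) xs))"
      by (rule smear_integrable[OF Gm base(2) xs])
    have int2: "integrable M (\<lambda>t. G t * (of_real (m 0) * h xs))" using intG by (rule integrable_mult_left)
    have "smear M (\<lambda>t. G t * of_real (m t)) h xs - of_real (m 0) * h xs
        = (LINT t|M. G t * of_real (m t) * h (map (L t) xs)) - (LINT t|M. G t * (of_real (m 0) * h xs))"
      by (simp add: smear_def one)
    also have "\<dots> = (LINT t|M. G t * of_real (m t) * h (map (L t) xs) - G t * (of_real (m 0) * h xs))"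
      by (rule Bochner_Integration.integral_diff[OF int1 int2, symmetric])
    also have "\<dots> = (LINT t|M. G t * ?d t)" by (simp only: right_diff_distrib mult.assoc)
    finally have diff: "smear M (\<lambda>t. G t * of_real (m t)) h xs - of_real (m 0) * h xs = (LINT t|M. G t * ?d t)" .
    have intd: "integrable M (\<lambda>t. G t * ?d t)"
      using Bochner_Integration.integrable_diff[OF int1 int2] by (simp only: right_diff_distrib mult.assoc)
    have bd: "(1 + list_norm xs) ^ N * cmod (?d t) \<le> C' * (\<bar>t\<bar> * exp (real (K + N) * \<bar>t\<bar>))" for t
    proof -
      have m0: "\<bar>m 0\<bar> \<le> C * exp (real K * \<bar>t\<bar>)"
      proof -
        have "\<bar>m 0\<bar> \<le> C * 1" using C(2)[of 0] by simp
        also have "\<dots> \<le> C * exp (real K * \<bar>t\<bar>)" by (rule mult_left_mono) (use C(1) in simp_all)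
        finally show ?thesis .
      qed
      have e: "exp (real (K + N) * \<bar>t\<bar>) = exp (real K * \<bar>t\<bar>) * exp (real N * \<bar>t\<bar>)"
        by (simp add: exp_add[symmetric] algebra_simps)
      \<comment> \<open>The change of the coefficient is separated from the change of the function,
        to use \<open>moderate\<close> for one and \<open>flow_difference\<close> for the
        other.\<close>
      have "?d t = of_real (m t - m 0) * h (map (L t) xs) + of_real (m 0) * (h (map (L t) xs) - h xs)"
        by (simp add: algebra_simps)
      then have "cmod (?d t) \<le> \<bar>m t - m 0\<bar> * cmod (h (map (L t) xs)) + \<bar>m 0\<bar> * cmod (h (map (L t) xs) - h xs)"
        using norm_triangle_ineq[of "of_real (m t - m 0) * h (map (L t) xs)" "of_real (m 0) * (h (map (L t) xs) - h xs)"]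
        by (simp only: norm_mult norm_of_real)
      then have "(1 + list_norm xs) ^ N * cmod (?d t) \<le> (1 + list_norm xs) ^ N *
          (\<bar>m t - m 0\<bar> * cmod (h (map (L t) xs)) + \<bar>m 0\<bar> * cmod (h (map (L t) xs) - h xs))"
        by (rule mult_left_mono) simp
      also have "\<dots> = \<bar>m t - m 0\<bar> * ((1 + list_norm xs) ^ N * cmod (h (map (L t) xs)))
          + \<bar>m 0\<bar> * ((1 + list_norm xs) ^ N * cmod (h (map (L t) xs) - h xs))"
        by (simp only: distrib_left mult_ac)
      also have "\<dots> \<le> (C * \<bar>t\<bar> * exp (K * \<bar>t\<bar>)) * (A * exp (real N * \<bar>t\<bar>))
          + (C * exp (real K * \<bar>t\<bar>)) * (B * (\<bar>t\<bar> * exp (real N * \<bar>t\<bar>)))"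
        by (intro add_mono mult_mono C A B xs m0) (use C(1) in simp_all)
      also have "\<dots> = C' * (\<bar>t\<bar> * exp (real (K + N) * \<bar>t\<bar>))"
        unfolding C'_def e by (simp only: distrib_left distrib_right mult_ac)
      finally show ?thesis .
    qed
    have "(1 + list_norm xs) ^ N * cmod (LINT t|M. G t * ?d t)
        \<le> (1 + list_norm xs) ^ N * (LINT t|M. cmod (G t * ?d t))"
      by (rule mult_left_mono[OF integral_norm_bound]) simp
    also have "\<dots> = (LINT t|M. (1 + list_norm xs) ^ N * cmod (G t * ?d t))" by simp
    also have "\<dots> \<le> (LINT t|M. C' * (cmod (G t) * (\<bar>t\<bar> * exp (real (K + N) * \<bar>t\<bar>))))"
    proof (rule integral_mono)
      show "integrable M (\<lambda>t. (1 + list_norm xs) ^ N * cmod (G t * ?d t))"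
        by (rule integrable_mult_right) (rule integrable_norm[OF intd])
      show "integrable M (\<lambda>t. C' * (cmod (G t) * (\<bar>t\<bar> * exp (real (K + N) * \<bar>t\<bar>))))"
        by (rule integrable_mult_right) (rule weight_integrable_abs[OF G])
      fix t :: real
      have "(1 + list_norm xs) ^ N * cmod (G t * ?d t) = cmod (G t) * ((1 + list_norm xs) ^ N * cmod (?d t))"
        by (simp only: norm_mult mult_ac)
      also have "\<dots> \<le> cmod (G t) * (C' * (\<bar>t\<bar> * exp (real (K + N) * \<bar>t\<bar>)))"
        by (rule mult_left_mono[OF bd norm_ge_zero])
      finally show "(1 + list_norm xs) ^ N * cmod (G t * ?d t) \<le> C' * (cmod (G t) * (\<bar>t\<bar> * exp (real (K + N) * \<bar>t\<bar>)))"
        by (simp only: mult_ac)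
    qed
    also have "\<dots> = C' * (LINT t|M. cmod (G t) * (\<bar>t\<bar> * exp (real (K + N) * \<bar>t\<bar>)))" by simp
    finally show ?thesis unfolding pm diff .
  qed
  then show ?case using C' by (intro exI[of _ C'] exI[of _ "K + N"]) (simp only: fst_conv snd_conv, blast)
next
  case zero
  show ?case
    by (intro exI[of _ "0::real"] exI[of _ "0::nat"])
       (simp only: diff_self norm_zero mult_zero_left mult_zero_right order_refl simp_thms)
next
  case (add F F')
  from add.IH(1) obtain C K where 1: "C \<ge> 0" "\<forall>M G xs. weight M G \<longrightarrow> (LINT t|M. G t) = 1 \<longrightarrow> length xs = n \<longrightarrow>
    (1 + list_norm xs) ^ N * cmod (F (M, G) xs - F (point_mass 0, \<lambda>_. 1) xs) \<le> C * (LINT t|M. cmod (G t) * (\<bar>t\<bar> * exp (real K * \<bar>t\<bar>)))" by blast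
  from add.IH(2) obtain C' K' where 2: "C' \<ge> 0" "\<forall>M G xs. weight M G \<longrightarrow> (LINT t|M. G t) = 1 \<longrightarrow> length xs = n \<longrightarrow>
    (1 + list_norm xs) ^ N * cmod (F' (M, G) xs - F' (point_mass 0, \<lambda>_. 1) xs) \<le> C' * (LINT t|M. cmod (G t) * (\<bar>t\<bar> * exp (real K' * \<bar>t\<bar>)))" by blast
  show ?case
  proof (intro exI[of _ "C + C'"] exI[of _ "max K K'"] conjI allI impI)
    fix M G and xs :: "'v list" assume G: "weight M G" and one: "(LINT t|M. G t) = 1" and xs: "length xs = n"
    let ?a = "F (M, G) xs - F (point_mass 0, \<lambda>_. 1) xs" and ?b = "F' (M, G) xs - F' (point_mass 0, \<lambda>_. 1) xs"
    let ?I = "\<lambda>K. LINT t|M. cmod (G t) * (\<bar>t\<bar> * exp (real K * \<bar>t\<bar>))"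
    have "(1 + list_norm xs) ^ N * cmod (?a + ?b) \<le> (1 + list_norm xs) ^ N * (cmod ?a + cmod ?b)"
      by (rule mult_left_mono[OF norm_triangle_ineq]) simp
    also have "\<dots> = (1 + list_norm xs) ^ N * cmod ?a + (1 + list_norm xs) ^ N * cmod ?b" by (simp only: distrib_left)
    also have "\<dots> \<le> C * ?I K + C' * ?I K'"
      using 1(2)[rule_format, OF G one xs] 2(2)[rule_format, OF G one xs] by (rule add_mono)
    also have "\<dots> \<le> C * ?I (max K K') + C' * ?I (max K K')"
      by (intro add_mono mult_left_mono weight_abs_moment_mono[OF G] 1(1) 2(1)) simp_all
    finally show "(1 + list_norm xs) ^ N * cmod (F (M, G) xs + F' (M, G) xs -
        (F (point_mass 0, \<lambda>_. 1) xs + F' (point_mass 0, \<lambda>_. 1) xs)) \<le> (C + C') * ?I (max K K')"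
      by (simp only: distrib_right add_diff_add)
  qed (use 1 2 in simp)
qed

lemma smear_schwartz_norm:
  assumes f: "schwartz_comp n f"
  obtains C and K :: nat where "C \<ge> 0"
    "\<And>M G. weight M G \<Longrightarrow> schwartz_norm n N (smear M G f) \<le> C * (LINT t|M. cmod (G t) * exp (real K * \<bar>t\<bar>))"
proof -
  let ?D = "{js :: (nat \<times> 'v) list. js \<in> directions n \<and> length js \<le> N}"
  have "\<forall>js\<in>?D. \<exists>CK. fst CK \<ge> 0 \<and> (\<forall>M G xs. weight M G \<longrightarrow> length xs = n \<longrightarrow>
    (1 + list_norm xs) ^ N * cmod (partials js (smear M G f) xs) \<le> fst CK * (LINT t|M. cmod (G t) * exp (real (snd CK) * \<bar>t\<bar>)))"
  proof
    fix js :: "(nat \<times> 'v) list" assume "js \<in> ?D"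
    then obtain F where F: "smear_class n F"
      "\<And>M G xs. weight M G \<Longrightarrow> length xs = n \<Longrightarrow> partials js (smear M G f) xs = F (M, G) xs"
      using smear_partials[OF f] by blast
    obtain C K where "C \<ge> 0" "\<forall>M G xs. weight M G \<longrightarrow> length xs = n \<longrightarrow>
      (1 + list_norm xs) ^ N * cmod (F (M, G) xs) \<le> C * (LINT t|M. cmod (G t) * exp (real K * \<bar>t\<bar>))"
      using smear_class_bound[OF F(1)] by blast
    then show "\<exists>CK. fst CK \<ge> 0 \<and> (\<forall>M G xs. weight M G \<longrightarrow> length xs = n \<longrightarrow>
      (1 + list_norm xs) ^ N * cmod (partials js (smear M G f) xs) \<le> fst CK * (LINT t|M. cmod (G t) * exp (real (snd CK) * \<bar>t\<bar>)))"
      by (intro exI[of _ "(C, K)"]) (simp add: F(2))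
  qed
  from bchoice[OF this] obtain c where c0: "\<And>js. js \<in> ?D \<Longrightarrow> fst (c js) \<ge> 0"
    and c: "\<And>js M G xs. js \<in> ?D \<Longrightarrow> weight M G \<Longrightarrow> length xs = n \<Longrightarrow>
      (1 + list_norm xs) ^ N * cmod (partials js (smear M G f) xs) \<le> fst (c js) * (LINT t|M. cmod (G t) * exp (real (snd (c js)) * \<bar>t\<bar>))"
    by blast
  show ?thesis
  \<comment> \<open>Sums over the finitely many multi-indices serve as common upper bounds, for the
    constants as well as for the exponents.\<close>
  proof (rule that[of "\<Sum>js\<in>?D. fst (c js)" "\<Sum>js\<in>?D. snd (c js)"])
    show "(\<Sum>js\<in>?D. fst (c js)) \<ge> 0" by (intro sum_nonneg c0)
    fix M G assume G: "weight M G"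
    let ?I = "\<lambda>K. LINT t|M. cmod (G t) * exp (real K * \<bar>t\<bar>)"
    show "schwartz_norm n N (smear M G f) \<le> (\<Sum>js\<in>?D. fst (c js)) * ?I (\<Sum>js\<in>?D. snd (c js))"
    proof (rule schwartz_norm_le)
      fix js :: "(nat \<times> 'v) list" and xs :: "'v list" assume js: "js \<in> directions n" "length js \<le> N" and xs: "length xs = n"
      have D: "js \<in> ?D" using js by simp
      have I0: "?I K \<ge> 0" for K by (rule Bochner_Integration.integral_nonneg) simp
      have "(1 + list_norm xs) ^ N * cmod (partials js (smear M G f) xs) \<le> fst (c js) * ?I (snd (c js))"
        by (rule c[OF D G xs])
      also have "\<dots> \<le> (\<Sum>js\<in>?D. fst (c js)) * ?I (\<Sum>js\<in>?D. snd (c js))"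
        by (intro mult_mono weight_moment_mono[OF G] member_le_sum D c0 finite_directions sum_nonneg I0) auto
      finally show "(1 + list_norm xs) ^ N * cmod (partials js (smear M G f) xs) \<le> (\<Sum>js\<in>?D. fst (c js)) * ?I (\<Sum>js\<in>?D. snd (c js))" .
    qed
  qed
qed

lemma smear_difference_schwartz_norm:
  assumes f: "schwartz_comp n f"
  obtains C and K :: nat where "C \<ge> 0"
    "\<And>M G. weight M G \<Longrightarrow> (LINT t|M. G t) = 1 \<Longrightarrow> schwartz_norm n N (\<lambda>xs. smear M G f xs + (-1) * f xs)
        \<le> C * (LINT t|M. cmod (G t) * (\<bar>t\<bar> * exp (real K * \<bar>t\<bar>)))"
proof -
  let ?D = "{js :: (nat \<times> 'v) list. js \<in> directions n \<and> length js \<le> N}"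
  let ?I = "\<lambda>M G K. LINT t|M. cmod (G t) * (\<bar>t\<bar> * exp (real K * \<bar>t\<bar>))"
  have "\<forall>js\<in>?D. \<exists>CK. fst CK \<ge> 0 \<and> (\<forall>M G xs. weight M G \<longrightarrow> (LINT t|M. G t) = 1 \<longrightarrow> length xs = n \<longrightarrow>
    (1 + list_norm xs) ^ N * cmod (partials js (\<lambda>xs. smear M G f xs + (-1) * f xs) xs) \<le> fst CK * ?I M G (snd CK))"
  proof
    fix js :: "(nat \<times> 'v) list" assume js: "js \<in> ?D"
    then obtain F where F: "smear_class n F"
      "\<And>M G xs. weight M G \<Longrightarrow> length xs = n \<Longrightarrow> partials js (smear M G f) xs = F (M, G) xs"
      using smear_partials[OF f] by blast
    obtain C K where C: "C \<ge> 0" "\<forall>M G xs. weight M G \<longrightarrow> (LINT t|M. G t) = 1 \<longrightarrow> length xs = n \<longrightarrow>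
      (1 + list_norm xs) ^ N * cmod (F (M, G) xs - F (point_mass 0, \<lambda>_. 1) xs) \<le> C * ?I M G K"
      using smear_class_difference[OF F(1)] by blast
    \<comment> \<open>\<open>f\<close> is its own smearing with the point mass at 0, so the same
      \<open>F\<close> yields its derivatives.\<close>
    have pf: "partials js f xs = F (point_mass 0, \<lambda>_. 1) xs" if "length xs = n" for xs
    proof -
      have "partials js f xs = partials js (smear (point_mass 0) (\<lambda>_. 1) f) xs"
        by (rule partials_cong) (use smear_point_mass[OF f, of _ 0] that js in \<open>simp_all add: L_at_0\<close>)
      then show ?thesis using F(2)[OF weight_point_mass that] by simp
    qed
    have "partials js (\<lambda>xs. smear M G f xs + (-1) * f xs) xs = F (M, G) xs - F (point_mass 0, \<lambda>_. 1) xs"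
      if "weight M G" "length xs = n" for M G xs
      using partials_linear[OF smear_schwartz[OF f that(1)] f, of js xs "-1"] js that F(2)[OF that] pf by simp
    then show "\<exists>CK. fst CK \<ge> 0 \<and> (\<forall>M G xs. weight M G \<longrightarrow> (LINT t|M. G t) = 1 \<longrightarrow> length xs = n \<longrightarrow>
      (1 + list_norm xs) ^ N * cmod (partials js (\<lambda>xs. smear M G f xs + (-1) * f xs) xs) \<le> fst CK * ?I M G (snd CK))"
      using C by (intro exI[of _ "(C, K)"]) simp
  qed
  from bchoice[OF this] obtain c where c0: "\<And>js. js \<in> ?D \<Longrightarrow> fst (c js) \<ge> 0"
    and c: "\<And>js M G xs. js \<in> ?D \<Longrightarrow> weight M G \<Longrightarrow> (LINT t|M. G t) = 1 \<Longrightarrow> length xs = n \<Longrightarrow>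
      (1 + list_norm xs) ^ N * cmod (partials js (\<lambda>xs. smear M G f xs + (-1) * f xs) xs) \<le> fst (c js) * ?I M G (snd (c js))"
    by blast
  show ?thesis
  proof (rule that[of "\<Sum>js\<in>?D. fst (c js)" "\<Sum>js\<in>?D. snd (c js)"])
    show "(\<Sum>js\<in>?D. fst (c js)) \<ge> 0" by (intro sum_nonneg c0)
    fix M G assume G: "weight M G" and one: "(LINT t|M. G t) = 1"
    show "schwartz_norm n N (\<lambda>xs. smear M G f xs + (-1) * f xs) \<le> (\<Sum>js\<in>?D. fst (c js)) * ?I M G (\<Sum>js\<in>?D. snd (c js))"
    proof (rule schwartz_norm_le)
      fix js :: "(nat \<times> 'v) list" and xs :: "'v list" assume js: "js \<in> directions n" "length js \<le> N" and xs: "length xs = n"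
      have D: "js \<in> ?D" using js by simp
      have I0: "?I M G K \<ge> 0" for K by (rule Bochner_Integration.integral_nonneg) simp
      have "(1 + list_norm xs) ^ N * cmod (partials js (\<lambda>xs. smear M G f xs + (-1) * f xs) xs) \<le> fst (c js) * ?I M G (snd (c js))"
        by (rule c[OF D G one xs])
      also have "\<dots> \<le> (\<Sum>js\<in>?D. fst (c js)) * ?I M G (\<Sum>js\<in>?D. snd (c js))"
        by (intro mult_mono weight_abs_moment_mono[OF G] member_le_sum D c0 finite_directions sum_nonneg I0) auto
      finally show "(1 + list_norm xs) ^ N * cmod (partials js (\<lambda>xs. smear M G f xs + (-1) * f xs) xs)
        \<le> (\<Sum>js\<in>?D. fst (c js)) * ?I M G (\<Sum>js\<in>?D. snd (c js))" .
    qed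
  qed
qed

end

subsection \<open>Continuous seminorms on the Borchers algebra\<close>

lemma borchers_add: "f \<in> borchers \<Longrightarrow> g \<in> borchers \<Longrightarrow> (\<lambda>xs. f xs + g xs) \<in> borchers"
proof -
  assume f: "f \<in> borchers" and g: "g \<in> borchers"
  obtain N where N: "\<And>xs. N < length xs \<Longrightarrow> f xs = 0" using f by (auto simp: borchers_def)
  obtain N' where N': "\<And>xs. N' < length xs \<Longrightarrow> g xs = 0" using g by (auto simp: borchers_def)
  have "\<forall>xs. max N N' < length xs \<longrightarrow> f xs + g xs = 0" using N N' by simp
  moreover have "schwartz_comp n (\<lambda>xs. f xs + g xs)" for n
    using f g by (intro schwartz_add) (simp_all add: borchers_def)
  ultimately show ?thesis unfolding borchers_def by blast
qed

lemma borchers_cmult: "f \<in> borchers \<Longrightarrow> (\<lambda>xs. c * f xs) \<in> borchers"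
proof -
  assume f: "f \<in> borchers"
  then obtain N where "\<forall>xs. N < length xs \<longrightarrow> f xs = 0" by (auto simp: borchers_def)
  then have "\<forall>xs. N < length xs \<longrightarrow> c * f xs = 0" by simp
  moreover have "schwartz_comp n (\<lambda>xs. c * f xs)" for n
    using f by (intro schwartz_cmult) (simp add: borchers_def)
  ultimately show ?thesis unfolding borchers_def by blast
qed

lemma borchers_zero: "(\<lambda>xs. 0) \<in> borchers"
  unfolding borchers_def by (simp add: schwartz_zero)

lemma borchers_sum: "(\<And>i. i \<in> I \<Longrightarrow> f i \<in> borchers) \<Longrightarrow> (\<lambda>xs. \<Sum>i\<in>I. f i xs) \<in> borchers"
  by (induction I rule: infinite_finite_induct) (auto intro: borchers_zero borchers_add)

lemma borchersD: "f \<in> borchers \<Longrightarrow> schwartz_comp n f"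
  by (simp add: borchers_def)

lemma component_in_comp: "f \<in> borchers \<Longrightarrow> component n f \<in> borchers_comp n"
proof -
  assume f: "f \<in> borchers"
  have "schwartz_comp k (component n f)" for k
  proof (cases "k = n")
    case True then show ?thesis by (intro schwartz_cong[OF borchersD[OF f]]) (simp add: component_def)
  next
    case False then show ?thesis by (intro schwartz_cong[OF schwartz_zero]) (simp add: component_def)
  qed
  then show ?thesis by (auto simp: borchers_comp_def borchers_def component_def)
qed

lemma component_schwartz_norm: "schwartz_norm n N (component n f) = schwartz_norm n N f"
  by (rule schwartz_norm_cong) (simp add: component_def)

lemma sum_components:
  assumes "\<And>xs. N < length xs \<Longrightarrow> f xs = 0"
  shows "f = (\<lambda>xs. \<Sum>n\<le>N. component n f xs)"
proof
  fix xs show "f xs = (\<Sum>n\<le>N. component n f xs)"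
    using assms[of xs] by (cases "length xs \<le> N") (auto simp: component_def)
qed

lemma hilbert_seminorm_scale:
  assumes "hilbert_seminorm p" "f \<in> borchers" shows "p (\<lambda>xs. c * f xs) = cmod c * p f"
proof -
  obtain B where B: "\<forall>f\<in>borchers. borchers_linear (B f)" "\<forall>f\<in>borchers. borchers_linear (\<lambda>g. cnj (B g f))"
    "\<forall>f\<in>borchers. B f f \<in> \<real> \<and> 0 \<le> Re (B f f) \<and> p f = sqrt (Re (B f f))"
    using assms(1) unfolding hilbert_seminorm_def by blast
  have cf: "(\<lambda>xs. c * f xs) \<in> borchers" using assms(2) by (rule borchers_cmult)
  have "B (\<lambda>xs. c * f xs) (\<lambda>xs. c * f xs) = c * B (\<lambda>xs. c * f xs) f"
    using B(1) cf assms(2) unfolding borchers_linear_def by blast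
  also have "cnj (B (\<lambda>xs. c * f xs) f) = c * cnj (B f f)"
    using B(2) assms(2) unfolding borchers_linear_def by blast
  then have "B (\<lambda>xs. c * f xs) f = cnj c * B f f" by (metis complex_cnj_cnj complex_cnj_mult)
  finally have "B (\<lambda>xs. c * f xs) (\<lambda>xs. c * f xs) = (c * cnj c) * B f f" by (simp only: mult.assoc)
  then have "Re (B (\<lambda>xs. c * f xs) (\<lambda>xs. c * f xs)) = (cmod c)\<^sup>2 * Re (B f f)"
    unfolding complex_norm_square[symmetric] by simp
  then show ?thesis using B(3) cf assms(2) by (simp add: real_sqrt_mult)
qed

lemma hilbert_seminorm_nonneg: "hilbert_seminorm p \<Longrightarrow> f \<in> borchers \<Longrightarrow> 0 \<le> p f"
  unfolding hilbert_seminorm_def by auto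

text \<open>Continuity makes the set where \<open>p\<close> is below 1 a neighbourhood of 0, so it
  contains a ball of finitely many defining seminorms. On one component these are below a Schwartz
  norm, and homogeneity turns the inclusion of balls into an inequality.\<close>

lemma sobolev_dominated_on_comp:
  fixes p :: "('v::euclidean_space list \<Rightarrow> complex) \<Rightarrow> real"
  assumes "sobolev_dominated p" "hilbert_seminorm p"
  shows "continuous_seminorm_on_comp n p"
proof -
  define U where "U = {f \<in> borchers. p f < 1}"
  have "openin borchers_topology {f \<in> topspace borchers_topology. p f \<in> {..<1}}"
    using assms(1) unfolding sobolev_dominated_def by (intro openin_continuous_map_preimage) auto
  then have "borchers_open U"
    by (simp add: U_def topspace_borchers_topology openin_borchers_topology)
  moreover have "(\<lambda>xs. 0) \<in> U"
    using hilbert_seminorm_scale[OF assms(2) borchers_zero, of 0] borchers_zero by (simp add: U_def)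
  ultimately obtain Q where Q: "finite Q" "Q \<subseteq> direct_sum_seminorms"
    "{g \<in> borchers. \<forall>q\<in>Q. q (\<lambda>xs. g xs - 0) < 1} \<subseteq> U" by (rule borchers_openE)
  have "\<forall>q\<in>Q. \<exists>CN. fst CN \<ge> 0 \<and> (\<forall>f\<in>borchers_comp n. q f \<le> fst CN * schwartz_norm n (snd CN) f)"
  proof
    fix q assume "q \<in> Q"
    then have "continuous_seminorm_on_comp n q" using Q(2) by (auto simp: direct_sum_seminorms_def)
    then obtain C N where C: "\<forall>f\<in>borchers_comp n. q f \<le> C * schwartz_norm n N f"
      by (auto simp: continuous_seminorm_on_comp_def)
    have "q f \<le> \<bar>C\<bar> * schwartz_norm n N f" if "f \<in> borchers_comp n" for f
    proof -
      have "q f \<le> C * schwartz_norm n N f" using C that by blast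
      also have "\<dots> \<le> \<bar>C\<bar> * schwartz_norm n N f"
        using that by (intro mult_right_mono schwartz_norm_nonneg) (auto simp: borchers_comp_def borchersD)
      finally show ?thesis .
    qed
    then show "\<exists>CN. fst CN \<ge> 0 \<and> (\<forall>f\<in>borchers_comp n. q f \<le> fst CN * schwartz_norm n (snd CN) f)"
      by (intro exI[of _ "(\<bar>C\<bar>, N)"]) simp
  qed
  from bchoice[OF this] obtain c where c0: "\<And>q. q \<in> Q \<Longrightarrow> fst (c q) \<ge> 0"
    and c: "\<And>q f. q \<in> Q \<Longrightarrow> f \<in> borchers_comp n \<Longrightarrow> q f \<le> fst (c q) * schwartz_norm n (snd (c q)) f" by blast
  define C N where "C = (\<Sum>q\<in>Q. fst (c q))" and "N = (\<Sum>q\<in>Q. snd (c q))"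
  have "p f \<le> C * schwartz_norm n N f" if f: "f \<in> borchers_comp n" for f
  proof -
    have fb: "f \<in> borchers" and fs: "schwartz_comp n f" using f by (auto simp: borchers_comp_def borchersD)
    have q: "q f \<le> C * schwartz_norm n N f" if "q \<in> Q" for q
    proof -
      have "q f \<le> fst (c q) * schwartz_norm n (snd (c q)) f" by (rule c[OF that f])
      also have "\<dots> \<le> C * schwartz_norm n N f"
        unfolding C_def N_def
        by (intro mult_mono schwartz_norm_mono[OF fs] member_le_sum that c0 Q(1) sum_nonneg schwartz_norm_nonneg[OF fs]) auto
      finally show ?thesis .
    qed
    have R0: "C * schwartz_norm n N f \<ge> 0"
      unfolding C_def by (intro mult_nonneg_nonneg sum_nonneg c0 schwartz_norm_nonneg[OF fs])
    show ?thesis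
    proof (rule field_le_epsilon)
      fix e :: real assume e: "e > 0"
      \<comment> \<open>The margin \<open>e\<close> keeps \<open>R\<close> positive when the bound
        itself is 0, and makes the rescaled seminorms strictly smaller than 1.\<close>
      define R where "R = C * schwartz_norm n N f + e"
      have R: "R > 0" using R0 e by (simp add: R_def)
      let ?g = "\<lambda>xs. of_real (1 / R) * f xs"
      have gb: "?g \<in> borchers" using fb by (rule borchers_cmult)
      have "q ?g < 1" if "q \<in> Q" for q
      proof -
        have "borchers_seminorm q" using Q(2) that by (auto simp: direct_sum_seminorms_def)
        then have "q ?g = cmod (of_real (1 / R)) * q f" using fb unfolding borchers_seminorm_def by blast
        also have "\<dots> = q f / R" using R by (simp add: norm_divide)
        also have "\<dots> < 1" using q[OF that] R e by (simp add: R_def)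
        finally show ?thesis .
      qed
      then have "?g \<in> U" using gb by (intro subsetD[OF Q(3)]) simp
      then have "p ?g < 1" by (simp add: U_def)
      then have "p f / R < 1"
        unfolding hilbert_seminorm_scale[OF assms(2) fb] using R by (simp add: norm_divide)
      then show "p f \<le> C * schwartz_norm n N f + e" using R by (simp add: R_def)
    qed
  qed
  then show ?thesis by (auto simp: continuous_seminorm_on_comp_def)
qed

lemma construction_norm_on_comp:
  fixes p :: "('v::euclidean_space list \<Rightarrow> complex) \<Rightarrow> real"
  assumes "construction_norm p q" "sobolev_dominated p" "hilbert_seminorm p"
  shows "continuous_seminorm_on_comp n q"
proof -
  obtain C N where C: "\<And>f. f \<in> borchers_comp n \<Longrightarrow> p f \<le> C * schwartz_norm n N f"
    using sobolev_dominated_on_comp[OF assms(2,3), of n] by (auto simp: continuous_seminorm_on_comp_def)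
  show ?thesis
  proof (cases "borchers_norm p")
    case True
    then have "q f = p f" if "f \<in> borchers" for f using assms(1) that by (simp add: construction_norm_def)
    then show ?thesis unfolding continuous_seminorm_on_comp_def
      using C by (intro exI[of _ C] exI[of _ N]) (auto simp: borchers_comp_def)
  next
    case False
    then obtain r where r: "sobolev_direct_sum_norm r" "\<And>f. f \<in> borchers \<Longrightarrow> q f = sqrt ((p f)\<^sup>2 + (r f)\<^sup>2)"
      using assms(1) by (auto simp: construction_norm_def)
    then have "continuous_seminorm_on_comp n r" by (simp add: sobolev_direct_sum_norm_def)
    then obtain C' N' where C': "\<And>f. f \<in> borchers_comp n \<Longrightarrow> r f \<le> C' * schwartz_norm n N' f"
      by (auto simp: continuous_seminorm_on_comp_def)
    have "q f \<le> (\<bar>C\<bar> + \<bar>C'\<bar>) * schwartz_norm n (max N N') f" if f: "f \<in> borchers_comp n" for f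
    proof -
      have fb: "f \<in> borchers" and fs: "schwartz_comp n f" using f by (auto simp: borchers_comp_def borchersD)
      have n: "0 \<le> p f" "0 \<le> r f"
        using hilbert_seminorm_nonneg[OF assms(3) fb] hilbert_seminorm_nonneg[of r f] r(1) fb
        by (auto simp: sobolev_direct_sum_norm_def)
      have "q f \<le> p f + r f" unfolding r(2)[OF fb] using sqrt_sum_squares_le_sum[OF n] by simp
      also have "\<dots> \<le> C * schwartz_norm n N f + C' * schwartz_norm n N' f" by (rule add_mono[OF C[OF f] C'[OF f]])
      also have "\<dots> \<le> \<bar>C\<bar> * schwartz_norm n (max N N') f + \<bar>C'\<bar> * schwartz_norm n (max N N') f"
        by (intro add_mono mult_mono schwartz_norm_mono[OF fs] schwartz_norm_nonneg[OF fs]) auto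
      finally show ?thesis by (simp only: distrib_right)
    qed
    then show ?thesis by (auto simp: continuous_seminorm_on_comp_def)
  qed
qed

section \<open>Involution, tensor product and boosts\<close>

lemma list_norm_rev: "list_norm (rev xs) = list_norm xs"
  by (simp add: list_norm_def rev_map[symmetric] sum_list_rev)

lemma schwartz_star:
  fixes f :: "'v::euclidean_space list \<Rightarrow> complex"
  assumes "schwartz_comp n f" shows "schwartz_comp n (star f)"
proof (rule schwartz_compI)
  let ?K = "star ` {h :: 'v list \<Rightarrow> complex. schwartz_comp n h}"
  show "star f \<in> ?K" using assms by blast
  show "\<exists>g'\<in>?K. has_partial n i b g g'" if g: "g \<in> ?K" "i < n" "b \<in> Basis" for g i and b :: 'v
  proof -
    from g(1) obtain h where h: "schwartz_comp n h" "g = star h" by blast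
    \<comment> \<open>Reversal exchanges argument \<open>i\<close> with argument
      \<open>n - 1 - i\<close>.\<close>
    define k where "k = n - i - 1"
    have k: "k < n" using g(2) by (simp add: k_def)
    have "has_partial n i b g (star (partial (k, b) h))"
      unfolding has_partial_def
    proof (intro allI impI)
      fix xs :: "'v list" assume xs: "length xs = n"
      have "((\<lambda>t. h ((rev xs)[k := rev xs ! k + t *\<^sub>R b])) has_vector_derivative partial (k, b) h (rev xs)) (at 0)"
        using schwartz_has_partial[OF h(1) k g(3)] xs by (simp add: has_partial_def)
      then have "((\<lambda>t. cnj (h ((rev xs)[k := rev xs ! k + t *\<^sub>R b]))) has_vector_derivative cnj (partial (k, b) h (rev xs))) (at 0)"
        by (rule bounded_linear.has_vector_derivative[OF bounded_linear_cnj])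
      moreover have "rev xs ! k = xs ! i" using xs g(2) by (simp add: k_def rev_nth)
      moreover have "rev (xs[i := v]) = (rev xs)[k := v]" for v
        using rev_update[of i xs v] xs g(2) by (simp add: k_def)
      ultimately show "((\<lambda>t. g (xs[i := xs ! i + t *\<^sub>R b])) has_vector_derivative star (partial (k, b) h) xs) (at 0)"
        by (simp add: h(2) star_def)
    qed
    then show ?thesis using schwartz_partial[OF h(1) k g(3)] by blast
  qed
  show "continuous_on UNIV (\<lambda>x. g (map x [0..<n]))" if g: "g \<in> ?K" for g
  proof -
    from g obtain h where h: "schwartz_comp n h" "g = star h" by blast
    have eq: "rev (map x [0..<n]) = map (\<lambda>k. x (n - 1 - k)) [0..<n]" for x :: "nat \<Rightarrow> 'v"
      by (rule nth_equalityI) (auto simp: rev_nth)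
    have *: "continuous_on UNIV (\<lambda>x :: nat \<Rightarrow> 'v. x (n - 1 - k))" for k
      by (rule continuous_on_product_then_coordinatewise[OF continuous_on_id])
    have "continuous_on UNIV (\<lambda>(x :: nat \<Rightarrow> 'v) (k::nat). x (n - 1 - k))"
      by (rule continuous_on_coordinates) (rule *)
    then have "continuous_on UNIV (\<lambda>x. h (map (\<lambda>k. x (n - 1 - k)) [0..<n]))"
      by (rule continuous_on_compose2[OF schwartz_continuous[OF h(1)]]) simp
    then show ?thesis unfolding h(2) star_def eq by (rule continuous_on_cnj)
  qed
  show "\<exists>B. \<forall>xs. length xs = n \<longrightarrow> (1 + list_norm xs) ^ N * cmod (g xs) \<le> B" if g: "g \<in> ?K" for g N
  proof -
    from g obtain h where h: "schwartz_comp n h" "g = star h" by blast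
    obtain B where B: "\<And>xs. length xs = n \<Longrightarrow> (1 + list_norm xs) ^ N * cmod (h xs) \<le> B"
      using schwartz_bound[OF h(1)] by blast
    have "(1 + list_norm xs) ^ N * cmod (g xs) \<le> B" if "length xs = n" for xs
      using B[of "rev xs"] that unfolding h(2) star_def complex_mod_cnj list_norm_rev by simp
    then show ?thesis by blast
  qed
qed

lemma star_borchers: "f \<in> borchers \<Longrightarrow> star f \<in> borchers"
proof -
  assume f: "f \<in> borchers"
  then obtain N where "\<forall>xs. N < length xs \<longrightarrow> f xs = 0" by (auto simp: borchers_def)
  then have "\<forall>xs. N < length xs \<longrightarrow> star f xs = 0" by (simp add: star_def)
  then show ?thesis unfolding borchers_def using schwartz_star[OF borchersD[OF f]] by blast
qed

text \<open>Products of this form are a closed class: a partial derivative in one of the first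
  \<open>j\<close> arguments falls on the first factor, any other on the second, with its index
  lowered by \<open>j\<close>.\<close>

lemma schwartz_elementary_tensor:
  fixes f h :: "'v::euclidean_space list \<Rightarrow> complex"
  assumes "schwartz_comp j f" "schwartz_comp (n - j) h" "j \<le> n"
  shows "schwartz_comp n (\<lambda>xs. f (take j xs) * h (drop j xs))"
proof (rule schwartz_compI)
  let ?t = "\<lambda>(f, h) xs. f (take j xs) * h (drop j xs) :: complex"
  let ?K = "?t ` ({f :: 'v list \<Rightarrow> complex. schwartz_comp j f} \<times> {h :: 'v list \<Rightarrow> complex. schwartz_comp (n - j) h})"
  have KI: "(\<lambda>xs. f (take j xs) * h (drop j xs)) \<in> ?K" if "schwartz_comp j f" "schwartz_comp (n - j) h"
    for f h :: "'v list \<Rightarrow> complex"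
    by (rule image_eqI[of _ _ "(f, h)"]) (use that in simp_all)
  show "(\<lambda>xs. f (take j xs) * h (drop j xs)) \<in> ?K" by (rule KI[OF assms(1,2)])
  have KE: thesis if "g \<in> ?K" "\<And>f h. schwartz_comp j f \<Longrightarrow> schwartz_comp (n - j) h \<Longrightarrow>
      g = (\<lambda>xs. f (take j xs) * h (drop j xs)) \<Longrightarrow> thesis" for g thesis
    using that(1) by (elim imageE SigmaE) (rule that(2), simp_all)
  show "\<exists>g'\<in>?K. has_partial n i b g g'" if g: "g \<in> ?K" "i < n" "b \<in> Basis" for g i and b :: 'v
  proof -
    obtain f h where fh: "schwartz_comp j f" "schwartz_comp (n - j) h" "g = (\<lambda>xs. f (take j xs) * h (drop j xs))"
      using g(1) by (rule KE)
    show ?thesis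
    proof (cases "i < j")
      case True
      have "has_partial n i b g (\<lambda>xs. partial (i, b) f (take j xs) * h (drop j xs))"
        unfolding has_partial_def
      proof (intro allI impI)
        fix xs :: "'v list" assume xs: "length xs = n"
        have "((\<lambda>t. f ((take j xs)[i := take j xs ! i + t *\<^sub>R b])) has_vector_derivative partial (i, b) f (take j xs)) (at 0)"
          using schwartz_has_partial[OF fh(1) True g(3)] xs assms(3) by (simp add: has_partial_def)
        then have "((\<lambda>t. f ((take j xs)[i := take j xs ! i + t *\<^sub>R b]) * h (drop j xs)) has_vector_derivative
            partial (i, b) f (take j xs) * h (drop j xs)) (at 0)"
          by (rule has_vector_derivative_mult_left)
        then show "((\<lambda>t. g (xs[i := xs ! i + t *\<^sub>R b])) has_vector_derivative
            partial (i, b) f (take j xs) * h (drop j xs)) (at 0)"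
          using True by (simp add: fh(3) take_update_swap)
      qed
      then show ?thesis using KI[OF schwartz_partial[OF fh(1) True g(3)] fh(2)] by blast
    next
      case False
      have ij: "i - j < n - j" using False g(2) by simp
      have "has_partial n i b g (\<lambda>xs. f (take j xs) * partial (i - j, b) h (drop j xs))"
        unfolding has_partial_def
      proof (intro allI impI)
        fix xs :: "'v list" assume xs: "length xs = n"
        have "((\<lambda>t. h ((drop j xs)[i - j := drop j xs ! (i - j) + t *\<^sub>R b])) has_vector_derivative partial (i - j, b) h (drop j xs)) (at 0)"
          using schwartz_has_partial[OF fh(2) ij g(3)] xs by (simp add: has_partial_def)
        then have "((\<lambda>t. f (take j xs) * h ((drop j xs)[i - j := drop j xs ! (i - j) + t *\<^sub>R b])) has_vector_derivative
            f (take j xs) * partial (i - j, b) h (drop j xs)) (at 0)"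
          by (rule has_vector_derivative_mult_right)
        then show "((\<lambda>t. g (xs[i := xs ! i + t *\<^sub>R b])) has_vector_derivative
            f (take j xs) * partial (i - j, b) h (drop j xs)) (at 0)"
          using False xs assms(3) by (simp add: fh(3) drop_update_swap)
      qed
      then show ?thesis using KI[OF fh(1) schwartz_partial[OF fh(2) ij g(3)]] by blast
    qed
  qed
  show "continuous_on UNIV (\<lambda>x. g (map x [0..<n]))" if g: "g \<in> ?K" for g
  proof -
    obtain f h where fh: "schwartz_comp j f" "schwartz_comp (n - j) h" "g = (\<lambda>xs. f (take j xs) * h (drop j xs))"
      using g(1) by (rule KE)
    have t: "take j (map x [0..<n]) = map x [0..<j]" for x :: "nat \<Rightarrow> 'v"
      using assms(3) by (simp add: take_map)
    have d: "drop j (map x [0..<n]) = map (\<lambda>k. x (j + k)) [0..<n - j]" for x :: "nat \<Rightarrow> 'v"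
      by (rule nth_equalityI) auto
    have *: "continuous_on UNIV (\<lambda>x :: nat \<Rightarrow> 'v. x (j + k))" for k
      by (rule continuous_on_product_then_coordinatewise[OF continuous_on_id])
    have "continuous_on UNIV (\<lambda>(x :: nat \<Rightarrow> 'v) (k::nat). x (j + k))"
      by (rule continuous_on_coordinates) (rule *)
    then have "continuous_on UNIV (\<lambda>x. h (map (\<lambda>k. x (j + k)) [0..<n - j]))"
      by (rule continuous_on_compose2[OF schwartz_continuous[OF fh(2)]]) simp
    then show ?thesis unfolding fh(3) t d by (rule continuous_on_mult[OF schwartz_continuous[OF fh(1)]])
  qed
  show "\<exists>B. \<forall>xs. length xs = n \<longrightarrow> (1 + list_norm xs) ^ N * cmod (g xs) \<le> B" if g: "g \<in> ?K" for g N
  proof -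
    obtain f h where fh: "schwartz_comp j f" "schwartz_comp (n - j) h" "g = (\<lambda>xs. f (take j xs) * h (drop j xs))"
      using g(1) by (rule KE)
    obtain A where A: "A > 0" "\<And>xs. length xs = j \<Longrightarrow> (1 + list_norm xs) ^ N * cmod (f xs) \<le> A"
      using schwartz_bound[OF fh(1)] by blast
    obtain B where B: "B > 0" "\<And>xs. length xs = n - j \<Longrightarrow> (1 + list_norm xs) ^ N * cmod (h xs) \<le> B"
      using schwartz_bound[OF fh(2)] by blast
    have "(1 + list_norm xs) ^ N * cmod (g xs) \<le> A * B" if xs: "length xs = n" for xs
    proof -
      let ?a = "list_norm (take j xs)" and ?b = "list_norm (drop j xs)"
      have "(list_norm xs)\<^sup>2 \<le> (?a + ?b)\<^sup>2"
        using list_norm_append[of "take j xs" "drop j xs"] by (simp add: power2_sum)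
      then have "list_norm xs \<le> ?a + ?b" by (rule power2_le_imp_le) (simp add: add_nonneg_nonneg)
      \<comment> \<open>The weight of the whole list is at most the product of the weights of its
        two parts, so the two bounds multiply.\<close>
      also have "\<dots> \<le> (1 + ?a) * (1 + ?b) - 1" by (simp add: algebra_simps)
      finally have "(1 + list_norm xs) ^ N \<le> ((1 + ?a) * (1 + ?b)) ^ N" by (intro power_mono) simp_all
      then have "(1 + list_norm xs) ^ N * cmod (g xs) \<le> ((1 + ?a) * (1 + ?b)) ^ N * cmod (g xs)"
        by (rule mult_right_mono) simp
      also have "\<dots> = ((1 + ?a) ^ N * cmod (f (take j xs))) * ((1 + ?b) ^ N * cmod (h (drop j xs)))"
        by (simp only: fh(3) norm_mult power_mult_distrib mult_ac)
      also have "\<dots> \<le> A * B" by (intro mult_mono A(2) B(2)) (use xs assms(3) A(1) in simp_all)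
      finally show ?thesis .
    qed
    then show ?thesis by blast
  qed
qed

lemma tensor_borchers:
  assumes "f \<in> borchers" "h \<in> borchers" shows "tensor f h \<in> borchers"
proof -
  have "schwartz_comp n (tensor f h)" for n
  proof (rule schwartz_cong)
    show "schwartz_comp n (\<lambda>xs. \<Sum>j\<le>n. f (take j xs) * h (drop j xs))"
      by (intro schwartz_sum schwartz_elementary_tensor borchersD assms) simp
  qed (simp add: tensor_def)
  moreover obtain N where N: "\<And>xs. N < length xs \<Longrightarrow> f xs = 0" using assms(1) by (auto simp: borchers_def)
  obtain N' where N': "\<And>xs. N' < length xs \<Longrightarrow> h xs = 0" using assms(2) by (auto simp: borchers_def)
  have "tensor f h xs = 0" if "N + N' < length xs" for xs
    unfolding tensor_def
  proof (rule sum.neutral, rule ballI)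
    fix j assume j: "j \<in> {..length xs}"
    show "f (take j xs) * h (drop j xs) = 0"
    proof (cases "N < j")
      case True then show ?thesis using N[of "take j xs"] j by simp
    next
      case False then show ?thesis using N'[of "drop j xs"] that by simp
    qed
  qed
  ultimately show ?thesis unfolding borchers_def by blast
qed

lemma tensor_map: "tensor (\<lambda>xs. f (map \<Lambda> xs)) (\<lambda>xs. h (map \<Lambda> xs)) = (\<lambda>xs. tensor f h (map \<Lambda> xs))"
  by (simp add: tensor_def take_map drop_map)

lemma star_map: "star (\<lambda>xs. f (map \<Lambda> xs)) = (\<lambda>xs. star f (map \<Lambda> xs))"
  by (simp add: star_def rev_map)

text \<open>Together with \<open>W (star f) = cnj (W f)\<close> this makes the form on the algebra
  Hermitian. Reversing the list exchanges initial and final segments, so the summation index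
  \<open>j\<close> turns into \<open>length xs - j\<close>.\<close>

lemma star_tensor_star: "star (tensor (star f) g) = tensor (star g) f"
proof
  fix xs
  have "star (tensor (star f) g) xs = (\<Sum>j\<le>length xs. f (rev (take j (rev xs))) * cnj (g (drop j (rev xs))))"
    by (simp add: star_def tensor_def)
  also have "\<dots> = (\<Sum>j\<le>length xs. f (drop (length xs - j) xs) * cnj (g (rev (take (length xs - j) xs))))"
    by (simp add: take_rev drop_rev)
  also have "\<dots> = (\<Sum>j\<le>length xs. f (drop j xs) * cnj (g (rev (take j xs))))"
    by (rule sum.nat_diff_reindex[of "\<lambda>j. f (drop j xs) * cnj (g (rev (take j xs)))" "Suc (length xs)", unfolded lessThan_Suc_atMost diff_Suc_Suc, simplified])
  also have "\<dots> = tensor (star g) f xs" by (simp add: tensor_def star_def mult.commute)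
  finally show "star (tensor (star f) g) xs = tensor (star g) f xs" .
qed

text \<open>Written as the identity plus corrections along two axes, from which components, norm
  bounds and derivatives are read off without matrix entries.\<close>

lemma boost_apply:
  fixes j :: "'s::finite"
  shows "boost j t *v x = x + ((cosh t - 1) * x $ None + sinh t * x $ Some j) *\<^sub>R axis None 1
    + (sinh t * x $ None + (cosh t - 1) * x $ Some j) *\<^sub>R axis (Some j) 1"
proof -
  let ?b = "\<lambda>x :: real ^ 's option. \<chi> \<mu>. if \<mu> = None then x $ None * cosh t + x $ Some j * sinh t
     else if \<mu> = Some j then x $ None * sinh t + x $ Some j * cosh t else x $ \<mu>"
  have "linear ?b" by (rule linearI) (auto simp: vec_eq_iff algebra_simps)
  from matrix_vector_mul(2)[OF this, THEN fun_cong] have "boost j t *v x = ?b x" unfolding boost_def .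
  also have "\<dots> = x + ((cosh t - 1) * x $ None + sinh t * x $ Some j) *\<^sub>R axis None 1
    + (sinh t * x $ None + (cosh t - 1) * x $ Some j) *\<^sub>R axis (Some j) 1"
    by (auto simp: vec_eq_iff axis_def algebra_simps)
  finally show ?thesis .
qed

lemma boost_components:
  "(boost j t *v x) $ None = cosh t * x $ None + sinh t * x $ Some j"
  "(boost j t *v x) $ Some j = sinh t * x $ None + cosh t * x $ Some j"
  "i \<noteq> j \<Longrightarrow> (boost j t *v x) $ Some i = x $ Some i"
  by (simp_all add: boost_apply axis_def algebra_simps)

lemma option_vec_eqI:
  assumes "x $ None = y $ None" "\<And>i. x $ Some i = y $ Some i" shows "x = (y :: real ^ 's::finite option)"
  unfolding vec_eq_iff
proof
  fix \<mu> show "x $ \<mu> = y $ \<mu>" using assms by (cases \<mu>) auto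
qed

lemma boost_boost: "boost j s *v (boost j t *v x) = boost j (s + t) *v x"
proof (rule option_vec_eqI)
  show "(boost j s *v (boost j t *v x)) $ None = (boost j (s + t) *v x) $ None"
    by (simp add: boost_components cosh_add sinh_add algebra_simps)
  show "(boost j s *v (boost j t *v x)) $ Some i = (boost j (s + t) *v x) $ Some i" for i
    by (cases "i = j") (simp_all add: boost_components cosh_add sinh_add algebra_simps)
qed

lemma boost_zero: "boost j 0 *v x = x"
  by (simp add: boost_apply)

lemma boost_mult: "boost j s ** boost j t = boost j (s + t)"
  unfolding matrix_eq by (simp add: matrix_vector_mul_assoc[symmetric] boost_boost)

lemma boost_zero_matrix: "boost j 0 = mat 1"
  unfolding matrix_eq by (simp add: boost_zero)

text \<open>\<open>matrix_inv\<close> is a choice of some inverse; the inverse given by the group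
  law pins it down.\<close>

lemma matrix_inv_boost: "matrix_inv (boost j t) = boost j (- t)"
proof -
  have i: "boost j t ** boost j (- t) = mat 1" "boost j (- t) ** boost j t = mat 1"
    by (simp_all add: boost_mult boost_zero_matrix)
  have "matrix_inv (boost j t) ** boost j t = mat 1"
    unfolding matrix_inv_def by (rule someI2[of _ "boost j (- t)"]) (use i in simp_all)
  then have "matrix_inv (boost j t) ** boost j t ** boost j (- t) = boost j (- t)" by simp
  then show ?thesis using i(1) by (simp add: matrix_mul_assoc[symmetric])
qed

lemma mink_boost: "mink (boost j t *v x) (boost j t *v y) = mink x y"
proof -
  have split: "mink x y = x $ None * y $ None - x $ Some j * y $ Some j - (\<Sum>i\<in>UNIV - {j}. x $ Some i * y $ Some i)" for x y
    by (simp add: mink_def sum.remove[of UNIV j])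
  have "(\<Sum>i\<in>UNIV - {j}. (boost j t *v x) $ Some i * (boost j t *v y) $ Some i) = (\<Sum>i\<in>UNIV - {j}. x $ Some i * y $ Some i)"
    by (intro sum.cong refl) (simp add: boost_components)
  moreover have "(cosh t * a + sinh t * b) * (cosh t * c + sinh t * d) - (sinh t * a + cosh t * b) * (sinh t * c + cosh t * d) = a * c - b * d"
    for a b c d :: real
  proof -
    have "(cosh t * a + sinh t * b) * (cosh t * c + sinh t * d) - (sinh t * a + cosh t * b) * (sinh t * c + cosh t * d)
        = ((cosh t)\<^sup>2 - (sinh t)\<^sup>2) * (a * c - b * d)" by (simp add: algebra_simps power2_eq_square)
    then show ?thesis by (simp add: cosh_square_eq)
  qed
  ultimately show ?thesis unfolding split by (simp add: boost_components)
qed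

text \<open>The reflection of the \<open>j\<close>-th axis conjugates the boost to its inverse, so that the
  determinant squares to 1; it is moreover a square.\<close>

lemma det_boost:
  fixes j :: "'s::finite"
  shows "det (boost j t) = 1"
proof -
  define P where "P = matrix (\<lambda>x :: real ^ 's option. \<chi> \<mu>. if \<mu> = Some j then - x $ \<mu> else x $ \<mu>)"
  have P: "P *v x = (\<chi> \<mu>. if \<mu> = Some j then - x $ \<mu> else x $ \<mu>)" for x
    unfolding P_def
    by (rule matrix_vector_mul(2)[THEN fun_cong]) (rule linearI; auto simp: vec_eq_iff)
  have PP: "P ** P = mat 1"
    unfolding matrix_eq by (simp add: matrix_vector_mul_assoc[symmetric] P vec_eq_iff)
  have conj: "boost j (- s) = P ** boost j s ** P" for s
    unfolding matrix_eq
  proof (rule allI, rule option_vec_eqI)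
    fix x :: "real ^ 's option"
    show "(boost j (- s) *v x) $ None = ((P ** boost j s ** P) *v x) $ None"
      by (simp add: matrix_vector_mul_assoc[symmetric] P boost_components)
    show "(boost j (- s) *v x) $ Some i = ((P ** boost j s ** P) *v x) $ Some i" for i
      by (cases "i = j") (simp_all add: matrix_vector_mul_assoc[symmetric] P boost_components)
  qed
  have detP: "det P * det P = 1" using arg_cong[OF PP, of det] by (simp add: det_mul)
  have sq: "det (boost j s) * det (boost j s) = 1" for s
  proof -
    have "det (boost j (- s)) = det (boost j s) * (det P * det P)" unfolding conj by (simp add: det_mul mult_ac)
    moreover have "det (boost j s) * det (boost j (- s)) = 1"
      unfolding det_mul[symmetric] by (simp add: boost_mult boost_zero_matrix)
    ultimately show ?thesis using detP by simp
  qed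
  have "det (boost j t) = det (boost j (t / 2)) * det (boost j (t / 2))"
    unfolding det_mul[symmetric] by (simp add: boost_mult)
  then show ?thesis using sq by simp
qed

lemma boost_lorentz: "boost j t \<in> proper_orthochronous_lorentz"
proof -
  have "boost j t $ None $ None = cosh t" by (simp add: boost_def matrix_def axis_def)
  then show ?thesis
    using cosh_real_ge_1[of t] by (simp add: proper_orthochronous_lorentz_def mink_boost det_boost)
qed

lemma poincare_boost: "poincare (boost j t) 0 f = (\<lambda>xs. f (map (\<lambda>x. boost j (- t) *v x) xs))"
  by (simp add: poincare_def matrix_inv_boost)

text \<open>Functions are moved by the inverse matrix, hence the argument \<open>- t\<close>. In 5 =
  1 + 2 + 2 the summands belong to \<open>x\<close> and to the two axis corrections, each made of
  two terms of size at most exp |t| |x|.\<close>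

lemma linear_group_boost:
  fixes j :: "'s::finite"
  shows "linear_group (\<lambda>t x. boost j (- t) *v x) (\<lambda>x. (- x $ Some j) *\<^sub>R axis None (1::real) + (- x $ None) *\<^sub>R axis (Some j) (1::real)) 5"
proof (rule linear_group.intro)
  fix s t :: real and x :: "real ^ 's option"
  show "linear (\<lambda>x. boost j (- t) *v x)" by (rule matrix_vector_mul_linear)
  show "boost j (- 0) *v x = x" by (simp add: boost_zero)
  show "boost j (- (s + t)) *v x = boost j (- s) *v (boost j (- t) *v x)" by (simp add: boost_boost)
  show "(1::real) \<le> 5" by simp
  have comp: "\<bar>x $ i\<bar> \<le> norm x" for i by (rule component_le_norm_cart)
  have ax: "norm (axis i (1::real)) = 1" for i :: "'s option" by (rule norm_Basis) (simp add: axis_in_Basis_iff)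
  have tri: "norm (u + a *\<^sub>R axis None (1::real) + b *\<^sub>R axis (Some j) (1::real)) \<le> norm u + \<bar>a\<bar> + \<bar>b\<bar>" for u :: "real ^ 's option" and a b
    using norm_triangle_ineq[of "u + a *\<^sub>R axis None (1::real)" "b *\<^sub>R axis (Some j) (1::real)"]
      norm_triangle_ineq[of u "a *\<^sub>R axis None (1::real)"] by (simp add: ax)
  show "norm ((- x $ Some j) *\<^sub>R axis None (1::real) + (- x $ None) *\<^sub>R axis (Some j) (1::real)) \<le> 5 * norm x"
  proof -
    have "norm ((- x $ Some j) *\<^sub>R axis None (1::real) + (- x $ None) *\<^sub>R axis (Some j) (1::real)) \<le> \<bar>- x $ Some j\<bar> + \<bar>- x $ None\<bar>"
      using tri[of 0 "- x $ Some j" "- x $ None"] by (simp only: add_0 norm_zero)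
    also have "\<dots> \<le> norm x + norm x"
      by (rule add_mono) (simp_all add: comp)
    also have "\<dots> \<le> 5 * norm x" by simp
    finally show ?thesis .
  qed
  show "norm (boost j (- t) *v x) \<le> 5 * exp \<bar>t\<bar> * norm x"
  proof -
    have c: "\<bar>cosh (- t) - 1\<bar> \<le> exp \<bar>t\<bar>"
    proof -
      have "cosh t \<le> exp \<bar>t\<bar>" by (cases "t \<ge> 0") (simp_all add: cosh_def)
      then show ?thesis using cosh_real_ge_1[of t] exp_gt_zero[of "\<bar>t\<bar>"] by simp
    qed
    have s: "\<bar>sinh (- t)\<bar> \<le> exp \<bar>t\<bar>"
    proof -
      have bound: "\<bar>(a - b) / 2\<bar> \<le> E" if "a \<le> E" "b \<le> E" "a > 0" "b > 0" for a b E :: real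
      proof (rule abs_leI)
        have "a - b \<le> 2 * E" "b - a \<le> 2 * E" using that by linarith+
        then show "(a - b) / 2 \<le> E" "- ((a - b) / 2) \<le> E" by (simp_all add: field_simps)
      qed
      have "\<bar>(exp (- t) - exp t) / 2\<bar> \<le> exp \<bar>t\<bar>" by (rule bound) simp_all
      then show ?thesis by (simp add: sinh_def abs_minus_commute)
    qed
    have lin: "\<bar>a * y + b * z\<bar> \<le> 2 * exp \<bar>t\<bar> * norm x"
      if "\<bar>a\<bar> \<le> exp \<bar>t\<bar>" "\<bar>b\<bar> \<le> exp \<bar>t\<bar>" "\<bar>y\<bar> \<le> norm x" "\<bar>z\<bar> \<le> norm x" for a b y z :: real
    proof -
      have "\<bar>a * y\<bar> \<le> exp \<bar>t\<bar> * norm x" "\<bar>b * z\<bar> \<le> exp \<bar>t\<bar> * norm x"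
        unfolding abs_mult using that by (intro mult_mono; simp)+
      then show ?thesis by linarith
    qed
    have "norm (boost j (- t) *v x) \<le> norm x + 2 * exp \<bar>t\<bar> * norm x + 2 * exp \<bar>t\<bar> * norm x"
      unfolding boost_apply
      using tri[of x] lin[OF c s comp[of None] comp[of "Some j"]] lin[OF s c comp[of None] comp[of "Some j"]]
      by (meson add_mono order_refl order_trans)
    also have "\<dots> \<le> 1 * exp \<bar>t\<bar> * norm x + 2 * exp \<bar>t\<bar> * norm x + 2 * exp \<bar>t\<bar> * norm x"
      using mult_right_mono[of 1 "exp \<bar>t\<bar>" "norm x"] by (simp add: mult.commute)
    finally show ?thesis by (simp add: algebra_simps)
  qed
  have "((\<lambda>t. x + ((cosh (- t) - 1) * x $ None + sinh (- t) * x $ Some j) *\<^sub>R axis None (1::real)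
    + (sinh (- t) * x $ None + (cosh (- t) - 1) * x $ Some j) *\<^sub>R axis (Some j) (1::real)) has_vector_derivative
     (- (sinh (- t) * x $ None + cosh (- t) * x $ Some j)) *\<^sub>R axis None (1::real)
     + (- (cosh (- t) * x $ None + sinh (- t) * x $ Some j)) *\<^sub>R axis (Some j) (1::real)) (at t)"
    by (auto intro!: derivative_eq_intros simp: has_vector_derivative_def[symmetric] algebra_simps)
  then show "((\<lambda>t. boost j (- t) *v x) has_vector_derivative
      (- (boost j (- t) *v x) $ Some j) *\<^sub>R axis None (1::real) + (- (boost j (- t) *v x) $ None) *\<^sub>R axis (Some j) (1::real)) (at t)"
    unfolding boost_components by (simp only: boost_apply)
qed

lemma (in linear_group) smear_point_mass_borchers:
  "f \<in> borchers \<Longrightarrow> smear (point_mass t) (\<lambda>_. 1) f = (\<lambda>xs. f (map (L t) xs))"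
  using smear_point_mass[OF borchersD] by blast

section \<open>One-parameter groups that preserve an indefinite form\<close>

text \<open>The binomial coefficient is at most 2^(n+k). The factorials in shifted and in composed
  exponential series are thus paid for by a factor 2 in the radius.\<close>

lemma fact_add_le: "fact (n + k) \<le> (fact n * fact k * 2 ^ (n + k) :: real)"
proof -
  have "fact (n + k) = fact n * fact k * ((n + k) choose k)"
    using binomial_fact_lemma[of k "n + k"] by (simp add: mult.commute)
  also have "\<dots> \<le> fact n * fact k * 2 ^ (n + k)"
    by (rule mult_left_mono[OF binomial_le_pow2]) simp
  finally have "real (fact (n + k)) \<le> real (fact n * fact k * 2 ^ (n + k))" by (rule of_nat_mono)
  then show ?thesis by simp
qed

text \<open>A bounded, nondegenerate, possibly indefinite form and a group that preserves it. As to
  norms, \<open>U\<close> is only assumed to have locally bounded orbits; neither continuity nor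
  boundedness of the operators is demanded.\<close>

locale indefinite_flow =
  fixes D :: "'h::complex_hilbert_space set" and B :: "'h \<Rightarrow> 'h \<Rightarrow> complex" and U :: "real \<Rightarrow> 'h \<Rightarrow> 'h"
    and c :: real
  assumes D_add: "\<And>v w. v \<in> D \<Longrightarrow> w \<in> D \<Longrightarrow> v + w \<in> D"
    and D_scale: "\<And>a v. v \<in> D \<Longrightarrow> a *\<^sub>C v \<in> D"
    and D_dense: "closure D = UNIV"
    and B_add_right: "\<And>u v w. B u (v + w) = B u v + B u w"
    and B_scale_right: "\<And>a u v. B u (a *\<^sub>C v) = a * B u v"
    and B_commute: "\<And>v w. B w v = cnj (B v w)"
    and B_bound: "\<And>v w. cmod (B v w) \<le> c * norm v * norm w"
    and B_nondegenerate: "\<And>w. (\<And>v. B v w = 0) \<Longrightarrow> w = 0"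
    and U_D: "\<And>t v. v \<in> D \<Longrightarrow> U t v \<in> D"
    and U_add: "\<And>t v w. v \<in> D \<Longrightarrow> w \<in> D \<Longrightarrow> U t (v + w) = U t v + U t w"
    and U_scale: "\<And>t a v. v \<in> D \<Longrightarrow> U t (a *\<^sub>C v) = a *\<^sub>C U t v"
    and U_zero: "\<And>v. v \<in> D \<Longrightarrow> U 0 v = v"
    and U_group: "\<And>s t v. v \<in> D \<Longrightarrow> U s (U t v) = U (s + t) v"
    and U_B: "\<And>t v w. v \<in> D \<Longrightarrow> w \<in> D \<Longrightarrow> B (U t v) (U t w) = B v w"
    and U_bounded: "\<And>v r. v \<in> D \<Longrightarrow> \<exists>C. \<forall>t. \<bar>t\<bar> \<le> r \<longrightarrow> norm (U t v) \<le> C"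
begin

abbreviation "A \<equiv> generator U"
abbreviation "domA \<equiv> generator_dom D U"
abbreviation "an \<equiv> entire_analytic_vectors domA A"
abbreviation "Uc \<equiv> exp_series A"

lemma B_add_left: "B (u + v) w = B u w + B v w"
  by (metis B_add_right B_commute complex_cnj_add)

lemma B_scale_left: "B (a *\<^sub>C u) w = cnj a * B u w"
  by (metis B_scale_right B_commute complex_cnj_mult)

lemma bounded_bilinear_B: "bounded_bilinear B"
proof
  show "\<exists>K. \<forall>a b. norm (B a b) \<le> norm a * norm b * K"
    using B_bound by (intro exI[of _ c]) (simp add: mult_ac)
  show "B (r *\<^sub>R a) b = r *\<^sub>R B a b" for r a b
    by (simp add: scaleC_of_real[symmetric] B_scale_left scaleR_conv_of_real)
  show "B a (r *\<^sub>R b) = r *\<^sub>R B a b" for r a b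
    by (simp add: scaleC_of_real[symmetric] B_scale_right scaleR_conv_of_real)
qed (simp_all add: B_add_left B_add_right)

lemmas tendsto_B = bounded_bilinear.tendsto[OF bounded_bilinear_B]
lemmas continuous_on_B = bounded_bilinear.continuous_on[OF bounded_bilinear_B]
lemmas B_diff_left = bounded_bilinear.diff_left[OF bounded_bilinear_B]
lemmas B_diff_right = bounded_bilinear.diff_right[OF bounded_bilinear_B]
lemmas B_zero_right = bounded_bilinear.zero_right[OF bounded_bilinear_B]

lemma B_sum_right: "B w (\<Sum>n\<in>I. f n) = (\<Sum>n\<in>I. B w (f n))"
  by (induction I rule: infinite_finite_induct) (auto simp: B_add_right B_zero_right)

text \<open>Nondegeneracy reduces equality of vectors to form values on a dense set, where the group
  can be moved to the test vector.\<close>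

lemma B_eq_on_dense:
  assumes "closure S = UNIV" "\<And>w. w \<in> S \<Longrightarrow> B w x = B w y" shows "x = y"
proof -
  have "B w x = B w y" for w
    by (rule eq_on_dense[OF assms(1), where f = "\<lambda>w. B w x" and g = "\<lambda>w. B w y"])
       (auto intro!: continuous_on_B continuous_on_id continuous_on_const assms(2))
  then have "x - y = 0" by (intro B_nondegenerate) (simp add: B_diff_right)
  then show ?thesis by simp
qed

lemma B_U: "v \<in> D \<Longrightarrow> w \<in> D \<Longrightarrow> B w (U t v) = B (U (- t) w) v"
  using U_B[of w "U (- t) v"] U_B[of "U (- t) w" v t] by (simp add: U_D U_group U_zero)

section \<open>The generator and its symmetry\<close>

abbreviation quotient :: "real \<Rightarrow> 'h \<Rightarrow> 'h" where
  "quotient t v \<equiv> (1 / (\<i> * complex_of_real t)) *\<^sub>C (U t v - v)"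

lemma generator_tendsto:
  assumes "v \<in> domA" shows "((\<lambda>t. quotient t v) \<longlongrightarrow> A v) (at 0)"
proof -
  obtain w where w: "((\<lambda>t. quotient t v) \<longlongrightarrow> w) (at 0)"
    using assms unfolding generator_dom_def by blast
  moreover have "A v = w" unfolding generator_def by (rule tendsto_Lim[OF _ w]) simp
  ultimately show ?thesis by simp
qed

lemma generatorI:
  assumes "v \<in> D" and w: "((\<lambda>t. quotient t v) \<longlongrightarrow> w) (at 0)"
  shows "v \<in> domA" "A v = w"
proof -
  show "v \<in> domA" using assms unfolding generator_dom_def by blast
  show "A v = w" unfolding generator_def by (rule tendsto_Lim[OF _ w]) simp
qed

lemma dom_D: "v \<in> domA \<Longrightarrow> v \<in> D"
  by (simp add: generator_dom_def)

lemma generator_add: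
  assumes "v \<in> domA" "w \<in> domA" shows "v + w \<in> domA" "A (v + w) = A v + A w"
proof -
  have "((\<lambda>t. quotient t v + quotient t w) \<longlongrightarrow> A v + A w) (at 0)"
    by (intro tendsto_add generator_tendsto assms)
  moreover have "quotient t v + quotient t w = quotient t (v + w)" for t
    using dom_D[OF assms(1)] dom_D[OF assms(2)]
    by (simp add: U_add scaleC_add_right[symmetric] algebra_simps)
  ultimately have l: "((\<lambda>t. quotient t (v + w)) \<longlongrightarrow> A v + A w) (at 0)" by simp
  have d: "v + w \<in> D" using assms by (intro D_add dom_D)
  show "v + w \<in> domA" "A (v + w) = A v + A w" using generatorI[OF d l] by blast+
qed

lemma generator_scale:
  assumes "v \<in> domA" shows "a *\<^sub>C v \<in> domA" "A (a *\<^sub>C v) = a *\<^sub>C A v"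
proof -
  have "((\<lambda>t. a *\<^sub>C quotient t v) \<longlongrightarrow> a *\<^sub>C A v) (at 0)"
    by (intro tendsto_scaleC tendsto_const generator_tendsto assms)
  moreover have "a *\<^sub>C quotient t v = quotient t (a *\<^sub>C v)" for t
    using dom_D[OF assms] by (simp add: U_scale scaleC_diff_right[symmetric] scaleC_scaleC mult.commute)
  ultimately have l: "((\<lambda>t. quotient t (a *\<^sub>C v)) \<longlongrightarrow> a *\<^sub>C A v) (at 0)" by simp
  have d: "a *\<^sub>C v \<in> D" using assms by (intro D_scale dom_D)
  show "a *\<^sub>C v \<in> domA" "A (a *\<^sub>C v) = a *\<^sub>C A v" using generatorI[OF d l] by blast+
qed

text \<open>For the form, the adjoint of the difference quotient at \<open>t\<close> is the one at
  \<open>- t\<close>: the conjugate of 1 / (i t) is 1 / (i (-t)), and \<open>U t\<close> is moved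
  across as \<open>U (- t)\<close>.\<close>

lemma generator_symmetric:
  assumes "v \<in> domA" "w \<in> domA" shows "B w (A v) = B (A w) v"
proof -
  note D = dom_D[OF assms(1)] dom_D[OF assms(2)]
  have 1: "((\<lambda>t. B w (quotient t v)) \<longlongrightarrow> B w (A v)) (at 0)"
    by (intro tendsto_B tendsto_const generator_tendsto assms)
  have "((\<lambda>t. quotient (- t) w) \<longlongrightarrow> A w) (at 0)"
    using generator_tendsto[OF assms(2)] filterlim_filtermap[of "\<lambda>t. quotient t w" "nhds (A w)" uminus "at 0"]
    by (simp add: filtermap_at_minus)
  then have "((\<lambda>t. B (quotient (- t) w) v) \<longlongrightarrow> B (A w) v) (at 0)"
    by (intro tendsto_B tendsto_const)
  moreover have "B (quotient (- t) w) v = B w (quotient t v)" for t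
    by (simp add: B_scale_left B_scale_right B_diff_left B_diff_right B_U[OF D])
  ultimately have "((\<lambda>t. B w (quotient t v)) \<longlongrightarrow> B (A w) v) (at 0)" by simp
  from tendsto_unique[OF _ 1 this] show ?thesis by simp
qed

section \<open>Entire analytic vectors and the exponential series\<close>

lemma an_dom: "v \<in> an \<Longrightarrow> (A ^^ n) v \<in> domA"
  by (simp add: entire_analytic_vectors_def)

lemma an_summable: "v \<in> an \<Longrightarrow> summable (\<lambda>n. (z ^ n / fact n) *\<^sub>C (A ^^ n) v)"
  by (simp add: entire_analytic_vectors_def)

lemma anI:
  assumes "\<And>n. (A ^^ n) v \<in> domA" "\<And>r. r > 0 \<Longrightarrow> summable (\<lambda>n. r ^ n / fact n * norm ((A ^^ n) v))"
  shows "v \<in> an"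
proof -
  have "summable (\<lambda>n. (z ^ n / fact n) *\<^sub>C (A ^^ n) v)" for z :: complex
  proof (rule summable_comparison_test')
    \<comment> \<open>The 1 is added because the hypothesis speaks of positive radii, while
      \<open>z\<close> may be 0.\<close>
    show "summable (\<lambda>n. (cmod z + 1) ^ n / fact n * norm ((A ^^ n) v))"
      by (rule assms(2)) (simp add: add_nonneg_pos)
    show "norm ((z ^ n / fact n) *\<^sub>C (A ^^ n) v) \<le> (cmod z + 1) ^ n / fact n * norm ((A ^^ n) v)" for n
      by (auto simp: norm_scaleC norm_divide norm_power intro!: mult_right_mono divide_right_mono power_mono)
  qed
  then show ?thesis using assms(1) by (simp add: entire_analytic_vectors_def)
qed

text \<open>The terms of a convergent series are bounded; at the real point \<open>r\<close> this is
  a Cauchy estimate for the powers of the generator. As \<open>r\<close> is arbitrary, the ratio of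
  a dominating geometric series can be made as small as desired.\<close>

lemma an_bound:
  assumes "v \<in> an" "r > 0"
  obtains K where "K \<ge> 0" "\<And>n. norm ((A ^^ n) v) \<le> K * fact n / r ^ n"
proof -
  have "Bseq (\<lambda>n. (complex_of_real r ^ n / fact n) *\<^sub>C (A ^^ n) v)"
    using an_summable[OF assms(1)] summable_LIMSEQ_zero convergent_imp_Bseq convergent_def by blast
  then obtain K where K: "K > 0" "\<And>n. norm ((complex_of_real r ^ n / fact n) *\<^sub>C (A ^^ n) v) \<le> K"
    unfolding Bseq_def by blast
  show ?thesis
  proof (rule that[of K])
    show "norm ((A ^^ n) v) \<le> K * fact n / r ^ n" for n
      using K(2)[of n] assms(2) by (simp add: norm_scaleC norm_divide norm_power field_simps)
  qed (use K in simp)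
qed

lemma an_abs_summable:
  assumes "v \<in> an" "r \<ge> 0"
  shows "summable (\<lambda>n. r ^ n / fact n * norm ((A ^^ n) v))"
proof -
  \<comment> \<open>The ratio r / (2 r + 1) is at most 1/2, and the 1 keeps the radius positive at r
    = 0.\<close>
  have "2 * r + 1 > 0" using assms(2) by simp
  from an_bound[OF assms(1) this] obtain K where K: "K \<ge> 0" "\<And>n. norm ((A ^^ n) v) \<le> K * fact n / (2 * r + 1) ^ n" by blast
  show ?thesis
  proof (rule summable_comparison_test')
    show "summable (\<lambda>n. K * (1 / 2) ^ n)" by (intro summable_mult summable_geometric) simp
    fix n
    have "r ^ n / fact n * norm ((A ^^ n) v) \<le> r ^ n / fact n * (K * fact n / (2 * r + 1) ^ n)"
      by (rule mult_left_mono[OF K(2)]) (use assms(2) in simp)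
    also have "\<dots> = K * (r / (2 * r + 1)) ^ n" by (simp add: power_divide)
    also have "\<dots> \<le> K * (1 / 2) ^ n"
      by (intro mult_left_mono power_mono K(1)) (use assms(2) in \<open>simp_all add: field_simps\<close>)
    finally show "norm (r ^ n / fact n * norm ((A ^^ n) v)) \<le> K * (1 / 2) ^ n"
      using assms(2) by simp
  qed
qed

text \<open>Shifting the series by \<open>k\<close> costs the factor (n + k)! / n! \<le> k! 2^(n+k);
  the radius 4 r + 1 then leaves the ratio 2 r / (4 r + 1) \<le> 1/2.\<close>

lemma an_generator:
  assumes "v \<in> an" shows "(A ^^ k) v \<in> an"
proof (rule anI)
  show "(A ^^ n) ((A ^^ k) v) \<in> domA" for n
    using an_dom[OF assms, of "n + k"] by (simp add: funpow_add)
  fix r :: real assume r: "r > 0"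
  then have r': "4 * r + 1 > 0" by simp
  from an_bound[OF assms this] obtain K where K: "K \<ge> 0" "\<And>n. norm ((A ^^ n) v) \<le> K * fact n / (4 * r + 1) ^ n" by blast
  let ?s = "4 * r + 1"
  show "summable (\<lambda>n. r ^ n / fact n * norm ((A ^^ n) ((A ^^ k) v)))"
  proof (rule summable_comparison_test')
    show "summable (\<lambda>n. (K * fact k * 2 ^ k / ?s ^ k) * (1 / 2) ^ n)" by (intro summable_mult summable_geometric) simp
    fix n
    have f: "fact (n + k) / fact n \<le> (fact k * 2 ^ (n + k) :: real)"
      using fact_add_le[of n k] by (simp add: divide_le_eq mult_ac)
    have "r ^ n / fact n * norm ((A ^^ n) ((A ^^ k) v)) \<le> r ^ n / fact n * (K * fact (n + k) / ?s ^ (n + k))"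
      using K(2)[of "n + k"] r by (intro mult_left_mono) (simp_all add: funpow_add)
    also have "\<dots> = (K * r ^ n / ?s ^ (n + k)) * (fact (n + k) / fact n)" by (simp add: mult_ac)
    also have "\<dots> \<le> (K * r ^ n / ?s ^ (n + k)) * (fact k * 2 ^ (n + k))"
      by (rule mult_left_mono[OF f]) (use K(1) r in simp)
    also have "\<dots> = (K * fact k * 2 ^ k / ?s ^ k) * (2 * r / ?s) ^ n"
      by (simp add: power_add power_divide power_mult_distrib mult_ac)
    also have "\<dots> \<le> (K * fact k * 2 ^ k / ?s ^ k) * (1 / 2) ^ n"
      by (intro mult_left_mono power_mono) (use K(1) r in \<open>simp_all add: field_simps\<close>)
    finally show "norm (r ^ n / fact n * norm ((A ^^ n) ((A ^^ k) v))) \<le> (K * fact k * 2 ^ k / ?s ^ k) * (1 / 2) ^ n"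
      using r by simp
  qed
qed

lemma generator_power_add:
  assumes "v \<in> an" "w \<in> an" shows "(A ^^ n) (v + w) = (A ^^ n) v + (A ^^ n) w"
  by (induction n) (simp_all add: generator_add an_dom assms)

lemma generator_power_scale:
  assumes "v \<in> an" shows "(A ^^ n) (a *\<^sub>C v) = a *\<^sub>C (A ^^ n) v"
  by (induction n) (simp_all add: generator_scale an_dom assms)

lemma an_add: assumes "v \<in> an" "w \<in> an" shows "v + w \<in> an"
proof -
  have "(z ^ n / fact n) *\<^sub>C (A ^^ n) (v + w) = (z ^ n / fact n) *\<^sub>C (A ^^ n) v + (z ^ n / fact n) *\<^sub>C (A ^^ n) w"
    for z :: complex and n
    by (simp add: generator_power_add assms scaleC_add_right)
  moreover have "(A ^^ n) (v + w) \<in> domA" for n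
    by (simp add: generator_power_add assms generator_add an_dom)
  ultimately show ?thesis
    using summable_add[OF an_summable[OF assms(1)] an_summable[OF assms(2)]]
    unfolding entire_analytic_vectors_def by simp
qed

lemma an_scale: assumes "v \<in> an" shows "a *\<^sub>C v \<in> an"
proof (rule anI)
  show "(A ^^ n) (a *\<^sub>C v) \<in> domA" for n
    by (simp add: generator_power_scale assms generator_scale an_dom)
  fix r :: real assume "r > 0"
  then have "summable (\<lambda>n. cmod a * (r ^ n / fact n * norm ((A ^^ n) v)))"
    by (intro summable_mult an_abs_summable assms) simp
  then show "summable (\<lambda>n. r ^ n / fact n * norm ((A ^^ n) (a *\<^sub>C v)))"
    by (simp add: generator_power_scale assms norm_scaleC mult_ac)
qed

lemma Uc_sums: "v \<in> an \<Longrightarrow> (\<lambda>n. ((\<i> * z) ^ n / fact n) *\<^sub>C (A ^^ n) v) sums Uc z v"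
  unfolding exp_series_def using an_summable by (rule summable_sums)

lemma Uc_add:
  assumes "v \<in> an" "w \<in> an" shows "Uc z (v + w) = Uc z v + Uc z w"
  using sums_add[OF Uc_sums[OF assms(1), of z] Uc_sums[OF assms(2), of z]]
  unfolding exp_series_def by (simp add: generator_power_add assms scaleC_add_right sums_iff)

lemma Uc_scale:
  assumes "v \<in> an" shows "Uc z (a *\<^sub>C v) = a *\<^sub>C Uc z v"
proof -
  have "(\<lambda>n. a *\<^sub>C (((\<i> * z) ^ n / fact n) *\<^sub>C (A ^^ n) v)) sums (a *\<^sub>C Uc z v)"
    by (rule bounded_linear.sums[OF bounded_bilinear.bounded_linear_right[OF bounded_bilinear_scaleC] Uc_sums[OF assms]])
  then show ?thesis
    unfolding exp_series_def by (simp add: generator_power_scale assms scaleC_scaleC mult.commute sums_iff)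
qed

lemma generator_power_symmetric:
  assumes "v \<in> an" "w \<in> an" shows "B w ((A ^^ n) v) = B ((A ^^ n) w) v"
  using assms(2)
proof (induction n arbitrary: w)
  case (Suc n)
  have "B w (A ((A ^^ n) v)) = B (A w) ((A ^^ n) v)"
    using generator_symmetric[of "(A ^^ n) v" w] an_dom[OF assms(1)] an_dom[OF Suc.prems, of 0] by simp
  also have "\<dots> = B ((A ^^ n) (A w)) v" using Suc.IH[of "A w"] an_generator[OF Suc.prems, of 1] by simp
  finally show ?case by (simp add: funpow_swap1)
qed simp

text \<open>Term by term: the generator is symmetric for \<open>B\<close>, and the conjugate of
  \<open>\<i> * - cnj z\<close> is \<open>\<i> * z\<close>. Boundedness of \<open>B\<close> allows
  the passage to the sums.\<close>

lemma Uc_adjoint: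
  assumes "v \<in> an" "w \<in> an" shows "B w (Uc z v) = B (Uc (- cnj z) w) v"
proof -
  have 1: "(\<lambda>n. B w (((\<i> * z) ^ n / fact n) *\<^sub>C (A ^^ n) v)) sums B w (Uc z v)"
    by (rule bounded_linear.sums[OF bounded_bilinear.bounded_linear_right[OF bounded_bilinear_B] Uc_sums[OF assms(1)]])
  have 2: "(\<lambda>n. B (((\<i> * - cnj z) ^ n / fact n) *\<^sub>C (A ^^ n) w) v) sums B (Uc (- cnj z) w) v"
    by (rule bounded_linear.sums[OF bounded_bilinear.bounded_linear_left[OF bounded_bilinear_B] Uc_sums[OF assms(2)]])
  have "B (((\<i> * - cnj z) ^ n / fact n) *\<^sub>C (A ^^ n) w) v = B w (((\<i> * z) ^ n / fact n) *\<^sub>C (A ^^ n) v)" for n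
    by (simp add: B_scale_left B_scale_right generator_power_symmetric assms)
  with 2 have "(\<lambda>n. B w (((\<i> * z) ^ n / fact n) *\<^sub>C (A ^^ n) v)) sums B (Uc (- cnj z) w) v" by simp
  with 1 show ?thesis by (rule sums_unique2)
qed

text \<open>At s \<noteq> 0 only a weak derivative is within reach: as \<open>U s\<close> is not
  known to be continuous, it is moved to the test vector and the limit is taken at 0.\<close>

lemma orbit_derivative:
  assumes "v \<in> domA" "w \<in> D" and that: "A v \<in> D"
  shows "((\<lambda>s. B w (U s v)) has_vector_derivative \<i> * B w (U s (A v))) (at s)"
  unfolding has_vector_derivative_quotient
proof -
  have "((\<lambda>h. \<i> * B (U (- s) w) (quotient h v)) \<longlongrightarrow> \<i> * B (U (- s) w) (A v)) (at 0)"
    by (intro tendsto_mult tendsto_const tendsto_B generator_tendsto assms)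
  moreover have "\<forall>\<^sub>F h in at 0. \<i> * B (U (- s) w) (quotient h v) = (1 / h) *\<^sub>R (B w (U (s + h) v) - B w (U s v))"
    unfolding eventually_at_filter
  proof (intro always_eventually allI impI)
    fix h :: real assume "h \<noteq> 0"
    have "B w (U (s + h) v) = B (U (- s) w) (U h v)"
      using B_U[of "U h v" w s] dom_D[OF assms(1)] assms(2) by (simp add: U_D U_group)
    moreover have "B w (U s v) = B (U (- s) w) v" using B_U[of v w s] dom_D[OF assms(1)] assms(2) by simp
    ultimately show "\<i> * B (U (- s) w) (quotient h v) = (1 / h) *\<^sub>R (B w (U (s + h) v) - B w (U s v))"
      using \<open>h \<noteq> 0\<close> by (simp add: B_scale_right B_diff_right scaleR_conv_of_real)
  qed
  moreover have "B w (U s (A v)) = B (U (- s) w) (A v)" using B_U[OF that assms(2)] .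
  ultimately show "((\<lambda>h. (1 / h) *\<^sub>R (B w (U (s + h) v) - B w (U s v))) \<longlongrightarrow> \<i> * B w (U s (A v))) (at 0)"
    by (simp add: tendsto_cong)
qed

text \<open>Taylor's formula for \<open>s \<mapsto> B w (U s v)\<close>, in the form that the \<open>s\<close>-derivative of the Taylor
  polynomial with centre \<open>s\<close> and fixed end point \<open>t\<close> consists of the remainder term only.\<close>

lemma taylor_derivative:
  assumes "v \<in> an" "w \<in> D"
  shows "((\<lambda>s. \<Sum>k<Suc m. ((\<i> * of_real (t - s)) ^ k / fact k) * B w (U s ((A ^^ k) v))) has_vector_derivative
    ((\<i> * of_real (t - s)) ^ m / fact m) * (\<i> * B w (U s ((A ^^ Suc m) v)))) (at s)"
proof (induction m)
  case 0
  have "v \<in> domA" "A v \<in> D" using an_dom[OF assms(1), of 0] an_dom[OF assms(1), of 1] dom_D by simp_all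
  from orbit_derivative[OF this(1) assms(2) this(2)] show ?case by simp
next
  case (Suc m)
  have d: "(A ^^ Suc m) v \<in> domA" "A ((A ^^ Suc m) v) \<in> D"
    using an_dom[OF assms(1), of "Suc m"] an_dom[OF assms(1), of "Suc (Suc m)"] dom_D by simp_all
  have p: "((\<lambda>s. (\<i> * of_real (t - s)) ^ Suc m / fact (Suc m)) has_vector_derivative
      - \<i> * ((\<i> * of_real (t - s)) ^ m / fact m)) (at s)"
  proof -
    have "((\<lambda>x::complex. (\<i> * (of_real t - x)) ^ Suc m / fact (Suc m)) has_field_derivative
        - \<i> * ((\<i> * (of_real t - of_real s)) ^ m / fact m)) (at (of_real s))"
      by (auto intro!: derivative_eq_intros simp del: power_Suc of_nat_Suc fact_Suc)
         (use of_nat_neq_0[of m, where 'a = complex] in \<open>simp add: fact_Suc\<close>)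
    from has_vector_derivative_real_field[OF this] show ?thesis by simp
  qed
  have "((\<lambda>s. ((\<i> * of_real (t - s)) ^ Suc m / fact (Suc m)) * B w (U s ((A ^^ Suc m) v))) has_vector_derivative
      ((\<i> * of_real (t - s)) ^ Suc m / fact (Suc m)) * (\<i> * B w (U s (A ((A ^^ Suc m) v)))) +
      (- \<i> * ((\<i> * of_real (t - s)) ^ m / fact m)) * B w (U s ((A ^^ Suc m) v))) (at s)"
    by (rule has_vector_derivative_mult[OF p orbit_derivative[OF d(1) assms(2) d(2)]])
  from has_vector_derivative_add[OF Suc.IH this] show ?case
    by (simp only: sum.lessThan_Suc[of _ "Suc m"]) (simp add: algebra_simps)
qed

text \<open>The Taylor polynomial with moving centre \<open>s\<close> equals
  \<open>B w (U t v)\<close> at s = t and a partial sum of the series at s = 0. Its derivative, the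
  remainder term, bounds the difference; it is controlled by the local bound on the orbit of the
  test vector \<open>w\<close>.\<close>

lemma Uc_real:
  assumes "v \<in> an" shows "Uc (of_real t) v = U t v"
proof (rule B_eq_on_dense[OF D_dense])
  fix w assume w: "w \<in> D"
  define P where "P = (\<lambda>m s. \<Sum>k<Suc m. ((\<i> * of_real (t - s)) ^ k / fact k) * B w (U s ((A ^^ k) v)))"
  obtain C where C: "\<And>s. \<bar>s\<bar> \<le> \<bar>t\<bar> \<Longrightarrow> norm (U s w) \<le> C" using U_bounded[OF w] by blast
  have C0: "C \<ge> 0" by (rule order_trans[OF norm_ge_zero C[of 0]]) simp
  have c0: "\<bar>c\<bar> \<ge> 0" by simp
  have Bb: "cmod (B w (U s x)) \<le> \<bar>c\<bar> * C * norm x" if "\<bar>s\<bar> \<le> \<bar>t\<bar>" "x \<in> D" for s x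
  proof -
    have "cmod (B w (U s x)) = cmod (B (U (- s) w) x)" using B_U[OF that(2) w] by simp
    also have "\<dots> \<le> c * norm (U (- s) w) * norm x" by (rule B_bound)
    also have "\<dots> \<le> \<bar>c\<bar> * C * norm x"
      using C[of "- s"] that(1) by (intro mult_right_mono mult_mono) simp_all
    finally show ?thesis .
  qed
  have diff: "cmod (P m t - P m 0) \<le> (\<bar>c\<bar> * C) * ((2 * \<bar>t\<bar>) ^ Suc m / fact (Suc m) * norm ((A ^^ Suc m) v))" for m
  proof -
    have "cmod (P m t - P m 0) \<le> (\<bar>t\<bar> ^ m / fact m * (\<bar>c\<bar> * C * norm ((A ^^ Suc m) v))) * \<bar>t - 0\<bar>"
    proof (rule vector_derivative_mean_bound[where S = "closed_segment 0 t"])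
      fix s assume s: "s \<in> closed_segment 0 t"
      then have st: "\<bar>s\<bar> \<le> \<bar>t\<bar>" "\<bar>t - s\<bar> \<le> \<bar>t\<bar>" by (auto simp: closed_segment_eq_real_ivl split: if_splits)
      show "(P m has_vector_derivative ((\<i> * of_real (t - s)) ^ m / fact m) * (\<i> * B w (U s ((A ^^ Suc m) v)))) (at s)"
        unfolding P_def by (rule taylor_derivative[OF assms w])
      have "cmod (((\<i> * of_real (t - s)) ^ m / fact m) * (\<i> * B w (U s ((A ^^ Suc m) v))))
          = \<bar>t - s\<bar> ^ m / fact m * cmod (B w (U s ((A ^^ Suc m) v)))"
        by (simp add: norm_mult norm_divide norm_power del: of_real_diff funpow.simps)
      also have "\<dots> \<le> \<bar>t\<bar> ^ m / fact m * (\<bar>c\<bar> * C * norm ((A ^^ Suc m) v))"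
        by (intro mult_mono divide_right_mono power_mono Bb st dom_D an_dom[OF assms]) (simp_all add: C0)
      finally show "cmod (((\<i> * of_real (t - s)) ^ m / fact m) * (\<i> * B w (U s ((A ^^ Suc m) v))))
        \<le> \<bar>t\<bar> ^ m / fact m * (\<bar>c\<bar> * C * norm ((A ^^ Suc m) v))" .
    qed auto
    also have "\<dots> = (\<bar>c\<bar> * C * norm ((A ^^ Suc m) v)) * (real (Suc m) * \<bar>t\<bar> ^ Suc m / fact (Suc m))"
      by (simp del: funpow.simps of_nat_Suc)
    \<comment> \<open>The factor m + 1 is absorbed into 2^(m+1), so that the bound is a multiple of
      a term of the absolutely convergent series at radius 2 |t|.\<close>
    also have "\<dots> \<le> (\<bar>c\<bar> * C * norm ((A ^^ Suc m) v)) * (2 ^ Suc m * \<bar>t\<bar> ^ Suc m / fact (Suc m))"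
    proof -
      have "real (Suc m) \<le> 2 ^ Suc m" using of_nat_less_two_power[of "Suc m"] by (rule less_imp_le)
      then show ?thesis
        by (intro mult_left_mono divide_right_mono mult_right_mono) (simp_all add: C0)
    qed
    finally show ?thesis by (simp only: power_mult_distrib times_divide_eq_left times_divide_eq_right mult_ac)
  qed
  have "(\<lambda>m. (2 * \<bar>t\<bar>) ^ m / fact m * norm ((A ^^ m) v)) \<longlonglongrightarrow> 0"
    by (rule summable_LIMSEQ_zero[OF an_abs_summable[OF assms]]) simp
  from tendsto_mult_right_zero[OF LIMSEQ_Suc[OF this], of "\<bar>c\<bar> * C"]
  have "(\<lambda>m. P m t - P m 0) \<longlonglongrightarrow> 0"
    by (rule Lim_null_comparison[rotated]) (intro always_eventually allI diff)
  moreover have "P m t = B w (U t v)" for m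
  proof -
    have "P m t = (\<Sum>k<Suc m. if k = 0 then B w (U t v) else 0)"
      unfolding P_def by (intro sum.cong) (auto simp: power_0_left)
    then show ?thesis by simp
  qed
  ultimately have 1: "(\<lambda>m. B w (U t v) - P m 0) \<longlonglongrightarrow> 0" by simp
  have "(\<lambda>m. B w (\<Sum>k<Suc m. ((\<i> * of_real t) ^ k / fact k) *\<^sub>C (A ^^ k) v)) \<longlonglongrightarrow> B w (Uc (of_real t) v)"
    using Uc_sums[OF assms, of "of_real t"] unfolding sums_def
    by (intro tendsto_B tendsto_const LIMSEQ_Suc)
  moreover have "B w (\<Sum>k<Suc m. ((\<i> * of_real t) ^ k / fact k) *\<^sub>C (A ^^ k) v) = P m 0" for m
    unfolding P_def B_sum_right by (intro sum.cong refl) (simp add: B_scale_right U_zero dom_D an_dom[OF assms])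
  ultimately have 2: "(\<lambda>m. P m 0) \<longlonglongrightarrow> B w (Uc (of_real t) v)" by simp
  have "(\<lambda>m. B w (U t v) - P m 0 + P m 0) \<longlonglongrightarrow> 0 + B w (Uc (of_real t) v)"
    by (rule tendsto_add[OF 1 2])
  then have "(\<lambda>m::nat. B w (U t v)) \<longlonglongrightarrow> B w (Uc (of_real t) v)" by simp
  then show "B w (Uc (of_real t) v) = B w (U t v)" by (metis LIMSEQ_unique tendsto_const)
qed

text \<open>For a fixed analytic test vector the adjoint identity is a closed condition on pairs, so
  it persists on the closure of the graph; density of the test vectors then determines the second
  entry from the first.\<close>

lemma Uc_closed_graph:
  assumes "closure an = UNIV" shows "single_valued (closure (op_graph an (Uc z)))"
proof (rule single_valuedI)
  have *: "B w y = B (Uc (- cnj z) w) x" if "(x, y) \<in> closure (op_graph an (Uc z))" "w \<in> an" for x y w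
  proof -
    let ?S = "{p. B w (snd p) = B (Uc (- cnj z) w) (fst p)}"
    have "closed ?S"
      by (intro closed_Collect_eq continuous_on_B continuous_on_const continuous_on_fst continuous_on_snd continuous_on_id)
    moreover have "op_graph an (Uc z) \<subseteq> ?S" using Uc_adjoint that(2) by (auto simp: op_graph_def)
    ultimately have "closure (op_graph an (Uc z)) \<subseteq> ?S" by (rule closure_minimal[rotated])
    then show ?thesis using that(1) by auto
  qed
  fix x y y' assume "(x, y) \<in> closure (op_graph an (Uc z))" "(x, y') \<in> closure (op_graph an (Uc z))"
  then show "y = y'" by (intro B_eq_on_dense[OF assms]) (simp add: *)
qed

section \<open>Additivity from a dense invariant set of analytic vectors\<close>

context
  fixes N :: "'h set"
  assumes N_an: "N \<subseteq> an" and N_dense: "closure N = UNIV"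
    and N_Uc: "\<And>w z. w \<in> N \<Longrightarrow> Uc z w \<in> N"
    and N_group: "\<And>w z z'. w \<in> N \<Longrightarrow> Uc z (Uc z' w) = Uc (z + z') w"
begin

lemma an_dense: "closure an = UNIV"
  using closure_mono[OF N_an] N_dense by auto

lemma N_invariant_dense: "closure {\<Psi>\<in>an. \<forall>z. Uc z \<Psi> \<in> an} = UNIV"
proof -
  have "N \<subseteq> {\<Psi>\<in>an. \<forall>z. Uc z \<Psi> \<in> an}" using N_an N_Uc by blast
  from closure_mono[OF this] show ?thesis using N_dense by auto
qed

text \<open>Both parameters are moved to the test vector, which stays in \<open>N\<close>, where the
  group law is known; their sum is then moved back.\<close>

lemma Uc_adjoint_twice:
  assumes "v \<in> an" "w \<in> N" shows "B (Uc (- cnj z) w) (Uc z' v) = B w (Uc (z + z') v)"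
proof -
  have "B (Uc (- cnj z) w) (Uc z' v) = B (Uc (- cnj z') (Uc (- cnj z) w)) v"
    using Uc_adjoint[OF assms(1)] N_Uc assms(2) N_an by blast
  also have "\<dots> = B (Uc (- cnj (z + z')) w) v" by (simp add: N_group[OF assms(2)] add.commute)
  also have "\<dots> = B w (Uc (z + z') v)" using Uc_adjoint[OF assms(1)] assms(2) N_an by (metis subsetD)
  finally show ?thesis .
qed

lemma Uc_group:
  assumes "v \<in> an" "Uc z' v \<in> an" shows "Uc z (Uc z' v) = Uc (z + z') v"
proof (rule B_eq_on_dense[OF N_dense])
  fix w assume w: "w \<in> N"
  then have "B w (Uc z (Uc z' v)) = B (Uc (- cnj z) w) (Uc z' v)"
    using Uc_adjoint[OF assms(2)] N_an by blast
  then show "B w (Uc z (Uc z' v)) = B w (Uc (z + z') v)" using Uc_adjoint_twice[OF assms(1) w] by simp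
qed

text \<open>The partial sums of the series for \<open>U(z') v\<close> are analytic vectors. Their images under \<open>U(z)\<close>
  form a Cauchy sequence, whose limit is identified by testing it with the form.\<close>

lemma Uc_graph_closure:
  assumes v: "v \<in> an" shows "(Uc z' v, Uc (z + z') v) \<in> closure (op_graph an (Uc z))"
proof -
  define \<psi> where "\<psi> = (\<lambda>n. ((\<i> * z') ^ n / fact n) *\<^sub>C (A ^^ n) v)"
  \<comment> \<open>The binomial coefficient doubles both ratios; 2 |z| / r and 2 |z'| / r have to
    be at most 1/2.\<close>
  define r where "r = 4 * (cmod z + cmod z') + 1"
  have r: "r > 0" "4 * cmod z \<le> r" "4 * cmod z' \<le> r" by (simp_all add: r_def add_nonneg_pos)
  from an_bound[OF v r(1)] obtain K where K: "K \<ge> 0" "\<And>n. norm ((A ^^ n) v) \<le> K * fact n / r ^ n" by blast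
  have \<psi>_an: "\<psi> n \<in> an" for n unfolding \<psi>_def by (intro an_scale an_generator v)
  have s_an: "(\<Sum>n<m. \<psi> n) \<in> an" for m
    by (induction m) (auto intro: an_add \<psi>_an an_scale[OF v, of 0, simplified])
  have Us: "Uc z (\<Sum>n<m. \<psi> n) = (\<Sum>n<m. Uc z (\<psi> n))" for m
  proof (induction m)
    case 0 show ?case using Uc_scale[OF v, of z 0] by simp
  next
    case (Suc m) then show ?case by (simp add: Uc_add s_an \<psi>_an)
  qed
  have bound: "norm (Uc z (\<psi> n)) \<le> 2 * K * (1 / 2) ^ n" for n
  proof -
    have tm: "norm (((\<i> * z) ^ k / fact k) *\<^sub>C (A ^^ k) (\<psi> n)) \<le> K * (1 / 2) ^ n * (1 / 2) ^ k" for k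
    proof -
      have kn: "(A ^^ k) (\<psi> n) = ((\<i> * z') ^ n / fact n) *\<^sub>C (A ^^ (k + n)) v"
        unfolding \<psi>_def by (simp add: generator_power_scale an_generator v funpow_add)
      have f: "fact (k + n) / (fact k * fact n) \<le> (2 ^ (k + n) :: real)"
        using fact_add_le[of k n] by (simp add: divide_le_eq mult_ac)
      have "norm (((\<i> * z) ^ k / fact k) *\<^sub>C (A ^^ k) (\<psi> n)) = cmod z ^ k / fact k * (cmod z' ^ n / fact n) * norm ((A ^^ (k + n)) v)"
        unfolding kn by (simp add: norm_scaleC norm_mult norm_divide norm_power)
      also have "\<dots> \<le> cmod z ^ k / fact k * (cmod z' ^ n / fact n) * (K * fact (k + n) / r ^ (k + n))"
        by (rule mult_left_mono[OF K(2)]) simp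
      also have "\<dots> = K * cmod z ^ k * cmod z' ^ n / r ^ (k + n) * (fact (k + n) / (fact k * fact n))"
        by (simp add: mult_ac)
      also have "\<dots> \<le> K * cmod z ^ k * cmod z' ^ n / r ^ (k + n) * 2 ^ (k + n)"
        by (rule mult_left_mono[OF f]) (use K(1) r(1) in simp)
      also have "\<dots> = K * (2 * cmod z' / r) ^ n * (2 * cmod z / r) ^ k"
        by (simp add: power_add power_divide power_mult_distrib mult_ac)
      also have "\<dots> \<le> K * (1 / 2) ^ n * (1 / 2) ^ k"
        by (intro mult_mono mult_nonneg_nonneg power_mono K(1)) (use r K(1) in \<open>simp_all add: field_simps\<close>)
      finally show ?thesis .
    qed
    have "norm (Uc z (\<psi> n)) \<le> (\<Sum>k. K * (1 / 2) ^ n * (1 / 2) ^ k)"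
      unfolding exp_series_def by (rule norm_suminf_le[OF tm]) (intro summable_mult summable_geometric, simp)
    also have "\<dots> = 2 * K * (1 / 2) ^ n" by (subst suminf_mult) (simp_all add: suminf_geometric)
    finally show ?thesis .
  qed
  have "summable (\<lambda>n. 2 * K * (1 / 2) ^ n)" by (rule summable_mult, rule summable_geometric) simp
  then have "summable (\<lambda>n. Uc z (\<psi> n))" by (rule summable_comparison_test') (rule bound)
  then obtain y where y: "(\<lambda>m. Uc z (\<Sum>n<m. \<psi> n)) \<longlonglongrightarrow> y" unfolding Us summable_def sums_def by blast
  have lim: "(\<lambda>m. \<Sum>n<m. \<psi> n) \<longlonglongrightarrow> Uc z' v"
    using Uc_sums[OF v, of z'] unfolding \<psi>_def sums_def .
  have "y = Uc (z + z') v"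
  proof (rule B_eq_on_dense[OF N_dense])
    fix w assume w: "w \<in> N"
    have "(\<lambda>m. B w (Uc z (\<Sum>n<m. \<psi> n))) \<longlonglongrightarrow> B w y" by (intro tendsto_B tendsto_const y)
    moreover have "(\<lambda>m. B (Uc (- cnj z) w) (\<Sum>n<m. \<psi> n)) \<longlonglongrightarrow> B (Uc (- cnj z) w) (Uc z' v)"
      by (intro tendsto_B tendsto_const lim)
    moreover have "B w (Uc z (\<Sum>n<m. \<psi> n)) = B (Uc (- cnj z) w) (\<Sum>n<m. \<psi> n)" for m
      using Uc_adjoint[OF s_an] w N_an by blast
    ultimately have "B w y = B (Uc (- cnj z) w) (Uc z' v)" by (simp add: LIMSEQ_unique)
    then show "B w y = B w (Uc (z + z') v)" using Uc_adjoint_twice[OF v w] by simp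
  qed
  then have "(\<lambda>m. (\<Sum>n<m. \<psi> n, Uc z (\<Sum>n<m. \<psi> n))) \<longlonglongrightarrow> (Uc z' v, Uc (z + z') v)"
    using lim y by (intro tendsto_Pair) simp_all
  moreover have "(\<Sum>n<m. \<psi> n, Uc z (\<Sum>n<m. \<psi> n)) \<in> op_graph an (Uc z)" for m
    using s_an by (simp add: op_graph_def)
  ultimately show ?thesis unfolding closure_sequential by (intro exI[of _ "\<lambda>m. (\<Sum>n<m. \<psi> n, Uc z (\<Sum>n<m. \<psi> n))"]) blast
qed

end

end

section \<open>Entire test functions\<close>

text \<open>Decay is uniform on horizontal strips and not only on the real line: complex translates
  then belong to the class, and by Cauchy's inequalities derivatives do as well.\<close>

definition test_function :: "(complex \<Rightarrow> complex) \<Rightarrow> bool" where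
  "test_function g \<longleftrightarrow> g holomorphic_on UNIV \<and>
     (\<forall>R. \<forall>K::nat. \<exists>C. \<forall>w. \<bar>Im w\<bar> \<le> R \<longrightarrow> cmod (g w) \<le> C * exp (- (K * \<bar>Re w\<bar>)))"

lemma test_function_holomorphic: "test_function g \<Longrightarrow> g holomorphic_on S"
  unfolding test_function_def by (auto intro: holomorphic_on_subset)

lemma test_functionE:
  assumes "test_function g"
  obtains C where "C \<ge> 0" "\<And>w. \<bar>Im w\<bar> \<le> R \<Longrightarrow> cmod (g w) \<le> C * exp (- (real K * \<bar>Re w\<bar>))"
proof -
  obtain C where C: "\<And>w. \<bar>Im w\<bar> \<le> R \<Longrightarrow> cmod (g w) \<le> C * exp (- (real K * \<bar>Re w\<bar>))"
    using assms unfolding test_function_def by blast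
  have "cmod (g w) \<le> \<bar>C\<bar> * exp (- (real K * \<bar>Re w\<bar>))" if "\<bar>Im w\<bar> \<le> R" for w
    using C[OF that] by (rule order_trans) (rule mult_right_mono, simp_all)
  then show ?thesis by (intro that[of "\<bar>C\<bar>"]) simp_all
qed

lemma exp_abs_shift: "\<bar>x - y\<bar> \<le> r \<Longrightarrow> exp (- (real K * \<bar>x\<bar>)) \<le> exp (K * r) * exp (- (real K * \<bar>y::real\<bar>))"
proof -
  assume "\<bar>x - y\<bar> \<le> r"
  then have "real K * (\<bar>y\<bar> - r) \<le> real K * \<bar>x\<bar>" by (intro mult_left_mono) auto
  then show ?thesis by (simp add: exp_add[symmetric] right_diff_distrib)
qed

lemma test_function_linear:
  assumes "test_function g" "test_function h" shows "test_function (\<lambda>w. a * g w + h w)"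
  unfolding test_function_def
proof (intro conjI allI)
  show "(\<lambda>w. a * g w + h w) holomorphic_on UNIV"
    by (intro holomorphic_on_add holomorphic_on_mult holomorphic_on_const test_function_holomorphic assms)
  fix R and K :: nat
  obtain C where C: "\<And>w. \<bar>Im w\<bar> \<le> R \<Longrightarrow> cmod (g w) \<le> C * exp (- (real K * \<bar>Re w\<bar>))"
    using assms(1) by (rule test_functionE) blast
  obtain C' where C': "\<And>w. \<bar>Im w\<bar> \<le> R \<Longrightarrow> cmod (h w) \<le> C' * exp (- (real K * \<bar>Re w\<bar>))"
    using assms(2) by (rule test_functionE) blast
  have "cmod (a * g w + h w) \<le> (cmod a * C + C') * exp (- (real K * \<bar>Re w\<bar>))" if "\<bar>Im w\<bar> \<le> R" for w
  proof -
    have "cmod (a * g w + h w) \<le> cmod a * cmod (g w) + cmod (h w)"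
      using norm_triangle_ineq[of "a * g w" "h w"] by (simp only: norm_mult)
    also have "\<dots> \<le> cmod a * (C * exp (- (real K * \<bar>Re w\<bar>))) + C' * exp (- (real K * \<bar>Re w\<bar>))"
      by (intro add_mono mult_left_mono C C' that) simp
    finally show ?thesis by (simp add: algebra_simps)
  qed
  then show "\<exists>C. \<forall>w. \<bar>Im w\<bar> \<le> R \<longrightarrow> cmod (a * g w + h w) \<le> C * exp (- (real K * \<bar>Re w\<bar>))" by blast
qed

lemma test_function_zero: "test_function (\<lambda>w. 0)"
  unfolding test_function_def by (intro conjI holomorphic_on_const allI exI[of _ 0]) simp

lemma test_function_cmult: "test_function g \<Longrightarrow> test_function (\<lambda>w. a * g w)"
  using test_function_linear[OF _ test_function_zero] by simp

lemma test_function_shift: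
  assumes "test_function g" shows "test_function (\<lambda>w. g (w - a))"
  unfolding test_function_def
proof (intro conjI allI)
  show "(\<lambda>w. g (w - a)) holomorphic_on UNIV"
    by (rule holomorphic_on_compose_gen[unfolded comp_def, OF _ test_function_holomorphic[OF assms, of UNIV]])
       (auto intro!: holomorphic_intros)
  fix R and K :: nat
  obtain C where C: "C \<ge> 0" "\<And>w. \<bar>Im w\<bar> \<le> R + \<bar>Im a\<bar> \<Longrightarrow> cmod (g w) \<le> C * exp (- (real K * \<bar>Re w\<bar>))"
    using assms by (rule test_functionE) blast
  have "cmod (g (w - a)) \<le> (C * exp (K * \<bar>Re a\<bar>)) * exp (- (real K * \<bar>Re w\<bar>))" if "\<bar>Im w\<bar> \<le> R" for w
  proof -
    have "cmod (g (w - a)) \<le> C * exp (- (real K * \<bar>Re (w - a)\<bar>))" by (rule C(2)) (use that in simp)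
    also have "\<dots> \<le> C * (exp (K * \<bar>Re a\<bar>) * exp (- (real K * \<bar>Re w\<bar>)))"
      by (intro mult_left_mono exp_abs_shift C(1)) simp
    finally show ?thesis by (simp only: mult.assoc)
  qed
  then show "\<exists>C. \<forall>w. \<bar>Im w\<bar> \<le> R \<longrightarrow> cmod (g (w - a)) \<le> C * exp (- (real K * \<bar>Re w\<bar>))" by blast
qed

text \<open>The size on a disc is expressed by the decay at its centre, so that Cauchy's
  inequalities on discs keep the exponential weight.\<close>

lemma test_function_cball:
  assumes "test_function g"
  obtains C where "C \<ge> 0" "\<And>w x. \<bar>Im w\<bar> \<le> R \<Longrightarrow> cmod (x - w) \<le> r \<Longrightarrow> cmod (g x) \<le> C * exp (- (real K * \<bar>Re w\<bar>))"
proof -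
  obtain C where C: "C \<ge> 0" "\<And>w. \<bar>Im w\<bar> \<le> R + r \<Longrightarrow> cmod (g w) \<le> C * exp (- (real K * \<bar>Re w\<bar>))"
    using assms by (rule test_functionE) blast
  show ?thesis
  proof (rule that[of "C * exp (K * r)"])
    fix w x assume w: "\<bar>Im w\<bar> \<le> R" and x: "cmod (x - w) \<le> r"
    have d: "\<bar>Re x - Re w\<bar> \<le> r" "\<bar>Im x - Im w\<bar> \<le> r"
      using abs_Re_le_cmod[of "x - w"] abs_Im_le_cmod[of "x - w"] x by simp_all
    have "cmod (g x) \<le> C * exp (- (real K * \<bar>Re x\<bar>))" by (rule C(2)) (use d w in linarith)
    also have "\<dots> \<le> C * (exp (K * r) * exp (- (real K * \<bar>Re w\<bar>)))"
      by (intro mult_left_mono exp_abs_shift C(1) d)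
    finally show "cmod (g x) \<le> C * exp (K * r) * exp (- (real K * \<bar>Re w\<bar>))" by (simp only: mult.assoc)
  qed (use C(1) in simp)
qed

text \<open>\<open>C\<close> does not depend on \<open>n\<close>, and \<open>r\<close> is free:
  growth of the derivatives by at most n! / r^n for each \<open>r\<close> is what makes the smeared
  vectors entire analytic.\<close>

lemma test_function_higher_deriv_bound:
  assumes "test_function g" "r > 0"
  obtains C where "C \<ge> 0" "\<And>n w. \<bar>Im w\<bar> \<le> R \<Longrightarrow>
    cmod ((deriv ^^ n) g w) \<le> fact n / r ^ n * (C * exp (- (real K * \<bar>Re w\<bar>)))"
proof -
  obtain C where C: "C \<ge> 0" "\<And>w x. \<bar>Im w\<bar> \<le> R \<Longrightarrow> cmod (x - w) \<le> r \<Longrightarrow> cmod (g x) \<le> C * exp (- (real K * \<bar>Re w\<bar>))"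
    using test_function_cball[OF assms(1)] by blast
  show ?thesis
  proof (rule that[OF C(1)])
    fix n w assume w: "\<bar>Im w\<bar> \<le> R"
    have "cmod ((deriv ^^ n) g w) \<le> fact n * (C * exp (- (real K * \<bar>Re w\<bar>))) / r ^ n"
    proof (rule Cauchy_inequality[OF _ _ assms(2)])
      show "g holomorphic_on ball w r" by (rule test_function_holomorphic[OF assms(1)])
      show "continuous_on (cball w r) g"
        by (rule holomorphic_on_imp_continuous_on[OF test_function_holomorphic[OF assms(1)]])
      show "cmod (g x) \<le> C * exp (- (real K * \<bar>Re w\<bar>))" if "cmod (w - x) = r" for x
        by (rule C(2)[OF w]) (use that in \<open>simp add: norm_minus_commute\<close>)
    qed
    then show "cmod ((deriv ^^ n) g w) \<le> fact n / r ^ n * (C * exp (- (real K * \<bar>Re w\<bar>)))" by simp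
  qed
qed

lemma test_function_deriv:
  assumes "test_function g" shows "test_function (deriv g)"
  unfolding test_function_def
proof (intro conjI allI)
  show "deriv g holomorphic_on UNIV"
    by (rule holomorphic_deriv[OF test_function_holomorphic[OF assms] open_UNIV])
  fix R and K :: nat
  obtain C where "\<And>n w. \<bar>Im w\<bar> \<le> R \<Longrightarrow>
      cmod ((deriv ^^ n) g w) \<le> fact n / 1 ^ n * (C * exp (- (real K * \<bar>Re w\<bar>)))"
    using test_function_higher_deriv_bound[OF assms zero_less_one] by blast
  from this[of _ 1] show "\<exists>C. \<forall>w. \<bar>Im w\<bar> \<le> R \<longrightarrow> cmod (deriv g w) \<le> C * exp (- (real K * \<bar>Re w\<bar>))" by auto
qed

lemma test_function_higher_deriv: "test_function g \<Longrightarrow> test_function ((deriv ^^ n) g)"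
  by (induction n) (auto intro: test_function_deriv)

text \<open>Cauchy's inequalities bound the n-th term by B q^n with q = |\<zeta>| / r \<le> 1/2, so
  the tail is at most twice the bound of its first term. The constant \<open>B\<close> later carries
  the weight exp (-K |t|).\<close>

lemma entire_taylor_remainder:
  assumes g: "g holomorphic_on UNIV" and r: "r > 0" "2 * cmod \<zeta> \<le> r"
    and B: "\<And>x. cmod (x - w) \<le> r \<Longrightarrow> cmod (g x) \<le> B"
  shows "cmod (g (w + \<zeta>) - (\<Sum>n<m. (deriv ^^ n) g w / fact n * \<zeta> ^ n)) \<le> 2 * B * (cmod \<zeta> / r) ^ m"
proof -
  define q where "q = cmod \<zeta> / r"
  have q: "0 \<le> q" "q \<le> 1 / 2" using r by (simp_all add: q_def field_simps)
  have B0: "B \<ge> 0" by (rule order_trans[OF norm_ge_zero B[of w]]) (use r in simp)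
  let ?a = "\<lambda>n. (deriv ^^ n) g w / fact n * \<zeta> ^ n"
  have "?a sums g (w + \<zeta>)"
    using holomorphic_power_series[of g w "r + 1" "w + \<zeta>"] holomorphic_on_subset[OF g subset_UNIV] r
    by (simp add: dist_norm)
  then have "(\<lambda>n. ?a (n + m)) sums (g (w + \<zeta>) - (\<Sum>n<m. ?a n))" by (rule sums_split_initial_segment)
  then have eq: "g (w + \<zeta>) - (\<Sum>n<m. ?a n) = (\<Sum>n. ?a (n + m))" by (rule sums_unique)
  have a: "cmod (?a n) \<le> B * q ^ n" for n
  proof -
    have "cmod ((deriv ^^ n) g w) \<le> fact n * B / r ^ n"
    proof (rule Cauchy_inequality[OF _ _ r(1)])
      show "g holomorphic_on ball w r" by (rule holomorphic_on_subset[OF g subset_UNIV])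
      show "continuous_on (cball w r) g"
        by (rule holomorphic_on_imp_continuous_on[OF holomorphic_on_subset[OF g subset_UNIV]])
      show "cmod (g x) \<le> B" if "cmod (w - x) = r" for x
        by (rule B) (use that in \<open>simp add: norm_minus_commute\<close>)
    qed
    then have "cmod ((deriv ^^ n) g w) / fact n * cmod \<zeta> ^ n \<le> (fact n * B / r ^ n) / fact n * cmod \<zeta> ^ n"
      by (intro mult_right_mono divide_right_mono) simp_all
    then show ?thesis by (simp add: norm_mult norm_divide norm_power q_def power_divide)
  qed
  have "cmod (\<Sum>n. ?a (n + m)) \<le> (\<Sum>n. B * q ^ m * (1 / 2) ^ n)"
  proof (rule norm_suminf_le)
    show "summable (\<lambda>n. B * q ^ m * (1 / 2) ^ n)" by (rule summable_mult, rule summable_geometric) simp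
    fix n
    have "cmod (?a (n + m)) \<le> B * q ^ (n + m)" by (rule a)
    also have "\<dots> = B * q ^ m * q ^ n" by (simp add: power_add mult_ac)
    also have "\<dots> \<le> B * q ^ m * (1 / 2) ^ n"
      by (intro mult_left_mono power_mono mult_nonneg_nonneg B0 q zero_le_power)
    finally show "cmod (?a (n + m)) \<le> B * q ^ m * (1 / 2) ^ n" .
  qed
  also have "\<dots> = 2 * B * q ^ m" by (subst suminf_mult) (simp_all add: suminf_geometric)
  finally show ?thesis unfolding eq q_def .
qed

section \<open>Integrals of test functions and an approximate identity\<close>

lemma integrable_exp_minus_abs: "integrable lborel (\<lambda>t::real. exp (- \<bar>t\<bar>))"
proof -
  have "(\<integral>\<^sup>+ x. ennreal (exp (- x)) * indicator {0..} x \<partial>lborel) = ennreal (0 - (- exp (- 0)))"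
  proof (rule nn_integral_FTC_atLeast)
    show "((\<lambda>x::real. - exp (- x)) has_real_derivative exp (- x)) (at x)" for x
      by (auto intro!: derivative_eq_intros)
    have "((\<lambda>x::real. exp (- x)) \<longlongrightarrow> 0) at_top"
      by (rule filterlim_compose[OF exp_at_bot filterlim_uminus_at_bot_at_top])
    then show "((\<lambda>x::real. - exp (- x)) \<longlongrightarrow> 0) at_top" using tendsto_minus by fastforce
  qed auto
  then have fin: "(\<integral>\<^sup>+ x. ennreal (exp (- x) * indicator {0..} x) \<partial>lborel) < \<infinity>"
    by (simp add: ennreal_mult' ennreal_indicator)
  have int: "integrable lborel (\<lambda>x::real. exp (- x) * indicator {0..} x)"
    by (rule integrableI_nonneg[OF _ _ fin]) auto
  from lborel_integrable_real_affine[OF this, of "-1" 0]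
  have "integrable lborel (\<lambda>x::real. exp x * indicator {0..} (- x))" by simp
  \<comment> \<open>The point 0 is counted in both halves; the sum still dominates the
    function.\<close>
  from Bochner_Integration.integrable_add[OF int this]
  show ?thesis
    by (rule Bochner_Integration.integrable_bound) (auto simp: indicator_def)
qed

lemma test_function_measurable: "test_function g \<Longrightarrow> (\<lambda>t::real. g (of_real t)) \<in> borel_measurable borel"
  by (intro borel_measurable_continuous_onI continuous_on_compose2[OF holomorphic_on_imp_continuous_on[OF test_function_holomorphic, of g UNIV]]
      continuous_on_of_real continuous_on_id) auto

definition exp_abs_mass :: real where "exp_abs_mass = (LINT t|lborel. exp (- \<bar>t::real\<bar>))"

text \<open>Decay with exponent K + 1 against growth with exponent \<open>K\<close> leaves the fixed
  integrable function exp (- |t|), so one mass constant serves all \<open>K\<close>.\<close>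

lemma weighted_le_exp_abs:
  assumes "cmod (g t) \<le> B * exp (- (real (Suc K) * \<bar>t\<bar>))"
  shows "cmod (g t) * exp (real K * \<bar>t\<bar>) \<le> B * exp (- \<bar>t::real\<bar>)"
proof -
  have "cmod (g t) * exp (real K * \<bar>t\<bar>) \<le> B * exp (- (real (Suc K) * \<bar>t\<bar>)) * exp (real K * \<bar>t\<bar>)"
    by (rule mult_right_mono[OF assms]) simp
  also have "\<dots> = B * exp (- \<bar>t\<bar>)" by (simp add: mult.assoc exp_add[symmetric] algebra_simps)
  finally show ?thesis .
qed

lemma weight_test_function:
  assumes "test_function g" shows "weight lborel (\<lambda>t. g (of_real t))"
  unfolding weight_def
proof (intro conjI allI)
  show "(\<lambda>t::real. g (of_real t)) \<in> borel_measurable borel" by (rule test_function_measurable[OF assms])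
  fix K :: nat
  obtain C where C: "C \<ge> 0" "\<And>w. \<bar>Im w\<bar> \<le> 0 \<Longrightarrow> cmod (g w) \<le> C * exp (- (real (Suc K) * \<bar>Re w\<bar>))"
    using assms by (rule test_functionE) blast
  have int: "integrable lborel (\<lambda>t::real. C * exp (- \<bar>t\<bar>))"
    by (simp only: integrable_mult_right integrable_exp_minus_abs)
  show "integrable lborel (\<lambda>t. cmod (g (of_real t)) * exp (real K * \<bar>t\<bar>))"
  proof (rule Bochner_Integration.integrable_bound[OF int])
    have "(\<lambda>t::real. exp (real K * \<bar>t\<bar>)) \<in> borel_measurable borel"
      by (intro borel_measurable_continuous_onI continuous_intros)
    then show "(\<lambda>t. cmod (g (of_real t)) * exp (real K * \<bar>t\<bar>)) \<in> borel_measurable lborel"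
      using test_function_measurable[OF assms] by simp
    have "cmod (g (of_real t)) * exp (real K * \<bar>t\<bar>) \<le> C * exp (- \<bar>t\<bar>)" for t
      by (rule weighted_le_exp_abs[where g = "\<lambda>t. g (of_real t)"]) (use C(2)[of "of_real t"] in simp)
    then show "AE t in lborel. norm (cmod (g (of_real t)) * exp (real K * \<bar>t\<bar>)) \<le> norm (C * exp (- \<bar>t\<bar>))"
      using C(1) by (intro AE_I2) (simp add: abs_mult)
  qed
qed simp

lemma test_function_moment_le:
  assumes "test_function g" "\<And>t::real. cmod (g (of_real t)) \<le> B * exp (- (real (Suc K) * \<bar>t\<bar>))"
  shows "(LINT t|lborel. cmod (g (of_real t)) * exp (real K * \<bar>t\<bar>)) \<le> B * exp_abs_mass"
proof -
  have "(LINT t|lborel. cmod (g (of_real t)) * exp (real K * \<bar>t\<bar>)) \<le> (LINT t|lborel. B * exp (- \<bar>t::real\<bar>))"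
  proof (rule integral_mono)
    show "integrable lborel (\<lambda>t. cmod (g (of_real t)) * exp (real K * \<bar>t\<bar>))"
      using weight_test_function[OF assms(1)] unfolding weight_def by blast
    show "integrable lborel (\<lambda>t::real. B * exp (- \<bar>t\<bar>))"
      by (simp only: integrable_mult_right integrable_exp_minus_abs)
    show "cmod (g (of_real t)) * exp (real K * \<bar>t\<bar>) \<le> B * exp (- \<bar>t\<bar>)" for t
      by (rule weighted_le_exp_abs[where g = "\<lambda>t. g (of_real t)", OF assms(2)])
  qed
  then show ?thesis by (simp add: exp_abs_mass_def)
qed

lemma exp_abs_mass_nonneg: "0 \<le> exp_abs_mass"
  unfolding exp_abs_mass_def by (rule Bochner_Integration.integral_nonneg) simp

lemma test_function_gaussian: "test_function (\<lambda>w. exp (- w\<^sup>2))"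
  unfolding test_function_def
proof (intro conjI allI)
  show "(\<lambda>w. exp (- w\<^sup>2)) holomorphic_on UNIV" by (intro holomorphic_intros)
  fix R :: real and K :: nat
  \<comment> \<open>R^2 bounds the square of the imaginary part, and K^2 comes from K |x| \<le> x^2
    + K^2.\<close>
  have "cmod (exp (- w\<^sup>2)) \<le> exp (R\<^sup>2 + (real K)\<^sup>2) * exp (- (real K * \<bar>Re w\<bar>))" if "\<bar>Im w\<bar> \<le> R" for w
  proof -
    have "(Im w)\<^sup>2 \<le> R\<^sup>2" using power_mono[OF that, of 2] by simp
    moreover have "real K * \<bar>Re w\<bar> \<le> (Re w)\<^sup>2 + (real K)\<^sup>2"
    proof -
      have "0 \<le> real K * \<bar>Re w\<bar>" by simp
      moreover have "2 * (real K * \<bar>Re w\<bar>) \<le> (real K)\<^sup>2 + (Re w)\<^sup>2"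
        using sum_squares_bound[of "real K" "\<bar>Re w\<bar>"] by (simp only: power2_abs mult.assoc)
      ultimately show ?thesis by linarith
    qed
    ultimately have "- (Re w)\<^sup>2 + (Im w)\<^sup>2 \<le> R\<^sup>2 + (real K)\<^sup>2 + - (real K * \<bar>Re w\<bar>)" by linarith
    moreover have "Re (- w\<^sup>2) = - (Re w)\<^sup>2 + (Im w)\<^sup>2" by (simp add: power2_eq_square)
    ultimately show ?thesis unfolding norm_exp_eq_Re exp_add[symmetric] by simp
  qed
  then show "\<exists>C. \<forall>w. \<bar>Im w\<bar> \<le> R \<longrightarrow> cmod (exp (- w\<^sup>2)) \<le> C * exp (- (real K * \<bar>Re w\<bar>))" by blast
qed

text \<open>For m \<ge> 1 a dilation only improves the decay; the strip is widened to m R.\<close>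

lemma test_function_scale:
  assumes "test_function g" "m \<ge> 1" shows "test_function (\<lambda>w. g (of_real m * w))"
  unfolding test_function_def
proof (intro conjI allI)
  show "(\<lambda>w. g (of_real m * w)) holomorphic_on UNIV"
    by (rule holomorphic_on_compose_gen[unfolded comp_def, OF _ test_function_holomorphic[OF assms(1), of UNIV]])
       (auto intro!: holomorphic_intros)
  fix R and K :: nat
  obtain C where C: "C \<ge> 0" "\<And>w. \<bar>Im w\<bar> \<le> m * R \<Longrightarrow> cmod (g w) \<le> C * exp (- (real K * \<bar>Re w\<bar>))"
    using assms(1) by (rule test_functionE) blast
  have "cmod (g (of_real m * w)) \<le> C * exp (- (real K * \<bar>Re w\<bar>))" if "\<bar>Im w\<bar> \<le> R" for w
  proof -
    have "\<bar>Im (of_real m * w)\<bar> \<le> m * R" using that assms(2) by (simp add: abs_mult mult_left_mono)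
    then have "cmod (g (of_real m * w)) \<le> C * exp (- (real K * \<bar>Re (of_real m * w)\<bar>))" by (rule C(2))
    also have "\<dots> \<le> C * exp (- (real K * \<bar>Re w\<bar>))"
    proof (rule mult_left_mono[OF _ C(1)])
      have "1 * \<bar>Re w\<bar> \<le> m * \<bar>Re w\<bar>" by (rule mult_right_mono[OF assms(2)]) simp
      then have "real K * \<bar>Re w\<bar> \<le> real K * \<bar>Re (of_real m * w)\<bar>"
        using assms(2) by (intro mult_left_mono) (simp_all add: abs_mult)
      then show "exp (- (real K * \<bar>Re (of_real m * w)\<bar>)) \<le> exp (- (real K * \<bar>Re w\<bar>))" by simp
    qed
    finally show ?thesis .
  qed
  then show "\<exists>C. \<forall>w. \<bar>Im w\<bar> \<le> R \<longrightarrow> cmod (g (of_real m * w)) \<le> C * exp (- (real K * \<bar>Re w\<bar>))" by blast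
qed

text \<open>Normalised Gaussians at the scale 1 / (m + 1); of the normalising integral only that it
  is nonzero matters. The factor |t| in the moment supplies the gain 1 / (m + 1), and the
  exponential is harmless as |t| \<le> (m + 1) |t|.\<close>

lemma approximate_identity:
  obtains \<delta> :: "nat \<Rightarrow> complex \<Rightarrow> complex" where "\<And>m. test_function (\<delta> m)"
    "\<And>m. (LINT t|lborel. \<delta> m (of_real t)) = 1"
    "\<And>K::nat. (\<lambda>m. LINT t|lborel. cmod (\<delta> m (of_real t)) * (\<bar>t\<bar> * exp (real K * \<bar>t\<bar>))) \<longlonglongrightarrow> 0"
proof -
  define Z where "Z = (LINT t|lborel. exp (- (complex_of_real t)\<^sup>2))"
  have int: "integrable lborel (\<lambda>t::real. exp (- t\<^sup>2))"
  proof -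
    have "integrable lborel (\<lambda>t. cmod (exp (- (complex_of_real t)\<^sup>2)) * exp (real 0 * \<bar>t\<bar>))"
      using weight_test_function[OF test_function_gaussian] unfolding weight_def by blast
    moreover have "cmod (exp (- (complex_of_real t)\<^sup>2)) * exp (real 0 * \<bar>t\<bar>) = exp (- t\<^sup>2)" for t
      unfolding norm_exp_eq_Re by (simp add: power2_eq_square)
    ultimately show ?thesis by simp
  qed
  have "Z = of_real (LINT t|lborel. exp (- (t::real)\<^sup>2))"
    unfolding Z_def integral_complex_of_real[symmetric]
    by (intro Bochner_Integration.integral_cong refl) (simp add: exp_of_real[symmetric])
  moreover have "(LINT t|lborel. exp (- (t::real)\<^sup>2)) \<noteq> 0"
  proof
    assume "(LINT t|lborel. exp (- (t::real)\<^sup>2)) = 0"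
    then have "AE t in lborel. exp (- (t::real)\<^sup>2) = 0"
      using integral_nonneg_eq_0_iff_AE[OF int] by simp
    then have "AE t::real in lborel. False" by simp
    then have "emeasure lborel (UNIV :: real set) = 0" by (simp add: AE_iff_null null_sets_def)
    then show False by simp
  qed
  ultimately have Z: "Z \<noteq> 0" by simp
  define g where "g = (\<lambda>w. (1 / Z) * exp (- w\<^sup>2))"
  have g: "test_function g" unfolding g_def by (rule test_function_cmult[OF test_function_gaussian])
  have g1: "(LINT t|lborel. g (of_real t)) = 1" using Z by (simp add: g_def Z_def)
  define \<delta> where "\<delta> = (\<lambda>m w. of_real (real (Suc m)) * g (of_real (real (Suc m)) * w))"
  show ?thesis
  proof (rule that[of \<delta>])
    show \<delta>: "test_function (\<delta> m)" for m
      unfolding \<delta>_def by (intro test_function_cmult test_function_scale g) simp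
    show "(LINT t|lborel. \<delta> m (of_real t)) = 1" for m
    proof -
      have "(LINT t|lborel. g (of_real t)) = \<bar>real (Suc m)\<bar> *\<^sub>R (LINT t|lborel. g (of_real (0 + real (Suc m) * t)))"
        by (rule lborel_integral_real_affine) simp
      then show ?thesis unfolding g1 \<delta>_def by (simp add: scaleR_conv_of_real)
    qed
    fix K :: nat
    define F where "F = (\<lambda>t. cmod (g (of_real t)) * (\<bar>t\<bar> * exp (real K * \<bar>t\<bar>)))"
    have F: "integrable lborel F" unfolding F_def by (rule weight_integrable_abs[OF weight_test_function[OF g]])
    have le: "(LINT t|lborel. cmod (\<delta> m (of_real t)) * (\<bar>t\<bar> * exp (real K * \<bar>t\<bar>))) \<le> (1 / real (Suc m)) * (LINT t|lborel. F t)" for m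
    proof -
      let ?m = "real (Suc m)"
      have "(LINT t|lborel. cmod (\<delta> m (of_real t)) * (\<bar>t\<bar> * exp (real K * \<bar>t\<bar>))) \<le> (LINT t|lborel. F (0 + ?m * t))"
      proof (rule integral_mono)
        show "integrable lborel (\<lambda>t. cmod (\<delta> m (of_real t)) * (\<bar>t\<bar> * exp (real K * \<bar>t\<bar>)))"
          by (rule weight_integrable_abs[OF weight_test_function[OF \<delta>]])
        show "integrable lborel (\<lambda>t. F (0 + ?m * t))" by (rule lborel_integrable_real_affine[OF F]) simp
        fix t :: real
        have "1 * \<bar>t\<bar> \<le> ?m * \<bar>t\<bar>" by (rule mult_right_mono) simp_all
        then have "real K * \<bar>t\<bar> \<le> real K * \<bar>?m * t\<bar>" by (intro mult_left_mono) (simp_all add: abs_mult)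
        then have e: "exp (real K * \<bar>t\<bar>) \<le> exp (real K * \<bar>?m * t\<bar>)" by simp
        \<comment> \<open>The prefactor m + 1 of \<open>\<delta>\<close> is moved to |t|; the
          substitution then yields 1 / (m + 1) times a fixed moment of \<open>g\<close>.\<close>
        have "cmod (\<delta> m (of_real t)) * (\<bar>t\<bar> * exp (real K * \<bar>t\<bar>)) = cmod (g (of_real (?m * t))) * (\<bar>?m * t\<bar> * exp (real K * \<bar>t\<bar>))"
          unfolding \<delta>_def norm_mult norm_of_real abs_mult of_real_mult by (simp only: abs_of_nat mult_ac)
        also have "\<dots> \<le> F (0 + ?m * t)"
          unfolding F_def add_0 by (rule mult_left_mono[OF mult_left_mono[OF e]]) simp_all
        finally show "cmod (\<delta> m (of_real t)) * (\<bar>t\<bar> * exp (real K * \<bar>t\<bar>)) \<le> F (0 + ?m * t)" .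
      qed
      also have "\<dots> = (1 / ?m) * (LINT t|lborel. F t)"
        using lborel_integral_real_affine[of ?m F 0] by (simp add: field_simps)
      finally show ?thesis .
    qed
    have nonneg: "0 \<le> (LINT t|lborel. cmod (\<delta> m (of_real t)) * (\<bar>t\<bar> * exp (real K * \<bar>t\<bar>)))" for m
      by (rule Bochner_Integration.integral_nonneg) simp
    have "(\<lambda>m. inverse (real (Suc m)) * (LINT t|lborel. F t)) \<longlonglongrightarrow> 0 * (LINT t|lborel. F t)"
      by (rule tendsto_mult[OF LIMSEQ_inverse_real_of_nat tendsto_const])
    then have lim: "(\<lambda>m. (1 / real (Suc m)) * (LINT t|lborel. F t)) \<longlonglongrightarrow> 0" by (simp only: inverse_eq_divide mult_zero_left)
    show "(\<lambda>m. LINT t|lborel. cmod (\<delta> m (of_real t)) * (\<bar>t\<bar> * exp (real K * \<bar>t\<bar>))) \<longlonglongrightarrow> 0"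
      by (rule tendsto_sandwich[OF _ _ tendsto_const lim]) (intro always_eventually allI nonneg le)+
  qed
qed

section \<open>The boosts of the associated quantum field theory\<close>

locale boosted_qft = indefinite_metric_qft W p q \<iota> form1 \<pi> \<eta>\<^sub>2 abs_\<eta>\<^sub>2 sign_\<eta>\<^sub>2 J \<eta>\<^sub>0 ip \<eta>
  for W :: "('s::finite minkowski list \<Rightarrow> complex) \<Rightarrow> complex"
    and p q :: "('s minkowski list \<Rightarrow> complex) \<Rightarrow> real"
    and \<iota> :: "('s minkowski list \<Rightarrow> complex) \<Rightarrow> 'h1::complex_hilbert_space"
    and form1 :: "'h1 \<Rightarrow> 'h1 \<Rightarrow> complex"
    and \<pi> :: "'h1 \<Rightarrow> 'h2::complex_hilbert_space"
    and \<eta>\<^sub>2 abs_\<eta>\<^sub>2 sign_\<eta>\<^sub>2 :: "'h2 \<Rightarrow> 'h2"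
    and J :: "'h2 \<Rightarrow> 'h::complex_hilbert_space"
    and \<eta>\<^sub>0 :: "'h \<Rightarrow> 'h"
    and ip :: "'h \<Rightarrow> 'h \<Rightarrow> complex"
    and \<eta> :: "'h \<Rightarrow> 'h" +
  fixes j :: 's
  assumes W_invariant: "\<And>L a f. L \<in> proper_orthochronous_lorentz \<Longrightarrow> f \<in> borchers \<Longrightarrow> W (poincare L a f) = W f"
    and W_star: "\<And>f. f \<in> borchers \<Longrightarrow> W (star f) = cnj (W f)"
    and p_hilbert: "hilbert_seminorm p" and p_dominated: "sobolev_dominated p"
begin

definition V :: "('s minkowski list \<Rightarrow> complex) \<Rightarrow> 'h" where "V f = J (\<pi> (\<iota> f))"

text \<open>The scalar product of the type gives continuity of the indefinite form;
  \<open>form_eq_ip\<close> rewrites it with \<open>ip\<close> and \<open>\<eta>\<close>, which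
  gives its symmetry and nondegeneracy.\<close>

definition form :: "'h \<Rightarrow> 'h \<Rightarrow> complex" where "form v w = cinner v (\<eta>\<^sub>0 w)"

definition U :: "real \<Rightarrow> 'h \<Rightarrow> 'h" where "U t = poincare_rep V (boost j t) 0"

abbreviation L :: "real \<Rightarrow> 's minkowski \<Rightarrow> 's minkowski" where "L t x \<equiv> boost j (- t) *v x"

abbreviation \<alpha> :: "real \<Rightarrow> ('s minkowski list \<Rightarrow> complex) \<Rightarrow> 's minkowski list \<Rightarrow> complex" where
  "\<alpha> t f \<equiv> (\<lambda>xs. f (map (L t) xs))"

sublocale boosts: linear_group L "\<lambda>x. (- x $ Some j) *\<^sub>R axis None 1 + (- x $ None) *\<^sub>R axis (Some j) 1" 5
  by (rule linear_group_boost)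

section \<open>Action on the Borchers algebra and the indefinite form\<close>

lemma alpha_borchers: "f \<in> borchers \<Longrightarrow> \<alpha> t f \<in> borchers"
  using boosts.smear_borchers[OF _ weight_point_mass] boosts.smear_point_mass_borchers by metis

lemma alpha_alpha: "\<alpha> s (\<alpha> t f) = \<alpha> (s + t) f"
  by (simp add: comp_def boost_boost add.commute)

lemma alpha_zero: "\<alpha> 0 f = f"
  using boosts.L_at_0 by (intro ext) (simp only:)

lemma W_alpha: "f \<in> borchers \<Longrightarrow> W (\<alpha> t f) = W f"
  using W_invariant[OF boost_lorentz, of f j t 0] by (simp only: poincare_boost)

lemma V_add: "f \<in> borchers \<Longrightarrow> g \<in> borchers \<Longrightarrow> V (\<lambda>xs. f xs + g xs) = V f + V g"
  by (simp add: V_def \<iota>_add clinear_add[OF \<pi>_linear] clinear_add[OF J_linear])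

lemma V_scale: "f \<in> borchers \<Longrightarrow> V (\<lambda>xs. a * f xs) = a *\<^sub>C V f"
  by (simp add: V_def \<iota>_scale clinear_scaleC[OF \<pi>_linear] clinear_scaleC[OF J_linear])

lemma V_sum:
  "(\<And>i. i \<in> I \<Longrightarrow> f i \<in> borchers) \<Longrightarrow> V (\<lambda>xs. \<Sum>i\<in>I. f i xs) = (\<Sum>i\<in>I. V (f i))"
proof (induction I rule: infinite_finite_induct)
  case (insert i I)
  then show ?case by (simp add: V_add borchers_sum)
qed (use V_scale[OF borchers_zero, of 0] in simp_all)

text \<open>On classes of test functions this is the reality of \<open>W\<close> under the
  involution; continuity and density extend it in one variable after the other.\<close>

lemma form1_hermitian: "form1 v w = cnj (form1 w v)"
proof -
  have c1: "continuous_on UNIV (\<lambda>v. form1 v w)" for w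
  proof -
    have "continuous_on UNIV (\<lambda>v. (\<lambda>(v, w). form1 v w) (v, w))"
      by (rule continuous_on_compose2[OF form1_continuous])
         (auto intro!: continuous_on_Pair continuous_on_id continuous_on_const)
    then show ?thesis by simp
  qed
  have c2: "continuous_on UNIV (\<lambda>w. form1 v w)" for v
  proof -
    have "continuous_on UNIV (\<lambda>w. (\<lambda>(v, w). form1 v w) (v, w))"
      by (rule continuous_on_compose2[OF form1_continuous])
         (auto intro!: continuous_on_Pair continuous_on_id continuous_on_const)
    then show ?thesis by simp
  qed
  have base: "form1 (\<iota> f) (\<iota> g) = cnj (form1 (\<iota> g) (\<iota> f))" if "f \<in> borchers" "g \<in> borchers" for f g
    using W_star[OF tensor_borchers[OF star_borchers[OF that(2)] that(1)]] that
    by (simp add: form1_extends star_tensor_star)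
  have half: "form1 (\<iota> f) w = cnj (form1 w (\<iota> f))" if "f \<in> borchers" for f w
    by (rule eq_on_dense[OF \<iota>_dense, where f = "\<lambda>w. form1 (\<iota> f) w" and g = "\<lambda>w. cnj (form1 w (\<iota> f))"])
       (use base that in \<open>auto intro!: c1 c2 continuous_on_cnj\<close>)
  show ?thesis
    by (rule eq_on_dense[OF \<iota>_dense, where f = "\<lambda>v. form1 v w" and g = "\<lambda>v. cnj (form1 w v)"])
       (use half in \<open>auto intro!: c1 c2 continuous_on_cnj\<close>)
qed

text \<open>\<open>\<eta>\<^sub>2\<close> inherits symmetry from the Hermitian form on the first
  completion, and it is injective because the kernel of \<open>\<pi>\<close> is exactly the radical
  of that form.\<close>

lemma abs_sign_eq: "abs_\<eta>\<^sub>2 (sign_\<eta>\<^sub>2 x) = \<eta>\<^sub>2 x"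
proof (rule operator_abs_sign[OF _ _ abs_\<eta>\<^sub>2 sign_\<eta>\<^sub>2])
  show "cinner x (\<eta>\<^sub>2 y) = cinner (\<eta>\<^sub>2 x) y" for x y
  proof -
    obtain v w where "x = \<pi> v" "y = \<pi> w" using \<pi>_surj by (metis surjD)
    then show ?thesis using form1_hermitian[of v w] \<eta>\<^sub>2 cinner_commute by metis
  qed
  show "x = 0" if "\<eta>\<^sub>2 x = 0" for x
  proof -
    obtain w where w: "x = \<pi> w" using \<pi>_surj by (metis surjD)
    have "\<forall>v. form1 v w = 0" using \<eta>\<^sub>2[of _ w] that w by simp
    then show ?thesis using \<pi>_kernel w by blast
  qed
qed

lemma form_V: "f \<in> borchers \<Longrightarrow> g \<in> borchers \<Longrightarrow> form (V f) (V g) = W (tensor (star f) g)"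
  by (simp add: form_def V_def \<eta>\<^sub>0_extends J_isometric abs_sign_eq \<eta>\<^sub>2[symmetric] form1_extends)

lemma form_eq_ip: "form v w = ip v (\<eta> w)"
  by (simp add: form_def \<eta>_metric)

lemma form_eq_ip': "form v w = ip (\<eta> v) w"
  by (simp add: form_eq_ip \<eta>_selfadjoint)

lemma ip_nondegenerate:
  assumes "\<And>v. ip v x = 0" shows "x = 0"
proof -
  obtain c where "0 < c" "c * norm x \<le> sqrt (Re (ip x x))"
    using ip unfolding equivalent_scalar_product_def by blast
  then show ?thesis using assms by (simp add: mult_le_0_iff)
qed

lemma form_commute: "form w v = cnj (form v w)"
  using ip unfolding equivalent_scalar_product_def by (metis form_eq_ip form_eq_ip')

lemma \<eta>\<^sub>0_clinear: "clinear \<eta>\<^sub>0"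
  using \<eta>\<^sub>0_bounded by (simp add: bounded_clinear_def)

lemma \<eta>_zero: "\<eta> 0 = 0"
  by (rule ip_nondegenerate) (simp add: \<eta>_metric clinear_zero[OF \<eta>\<^sub>0_clinear])

lemma form_nondegenerate:
  assumes "\<And>v. form v w = 0" shows "w = 0"
proof -
  have "\<eta> w = 0" by (rule ip_nondegenerate) (use assms in \<open>simp add: form_eq_ip\<close>)
  then show ?thesis using \<eta>_involution[of w] \<eta>_zero by simp
qed

lemma D_dense: "closure (V ` borchers) = UNIV"
  using J_dense by (simp add: V_def image_image)

text \<open>The squared norm is the value of the form of \<open>abs_\<eta>\<^sub>2\<close> at
  \<open>\<pi> (\<iota> f)\<close>, which \<open>K\<close> bounds; the quotient map does not
  increase norms, as 0 lies in the radical.\<close>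

lemma V_norm_bound:
  obtains C where "C \<ge> 0" "\<And>f. f \<in> borchers \<Longrightarrow> norm (V f) \<le> C * q f"
proof -
  obtain K where K: "K > 0" "\<And>x. norm (abs_\<eta>\<^sub>2 x) \<le> K * norm x"
    using bounded_clinear_bound[OF conjunct1[OF abs_\<eta>\<^sub>2[unfolded is_operator_abs_def]]] by blast
  show ?thesis
  proof (rule that[of "sqrt K"])
    fix f :: "'s minkowski list \<Rightarrow> complex" assume f: "f \<in> borchers"
    let ?v = "\<pi> (\<iota> f)"
    have "(norm (V f))\<^sup>2 = Re (cinner ?v (abs_\<eta>\<^sub>2 ?v))"
      using J_isometric[of ?v ?v] by (metis V_def cinner_self Re_complex_of_real)
    also have "\<dots> \<le> norm ?v * norm (abs_\<eta>\<^sub>2 ?v)"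
      using complex_Re_le_cmod cinner_Cauchy_Schwarz order_trans by blast
    also have "\<dots> \<le> norm ?v * (K * norm ?v)" by (intro mult_left_mono K(2)) simp
    also have "\<dots> = (sqrt K * norm ?v)\<^sup>2" using K(1) by (simp add: power_mult_distrib power2_eq_square)
    finally have 1: "norm (V f) \<le> sqrt K * norm ?v" by (rule power2_le_imp_le) (use K(1) in simp)
    have "form1 w 0 = 0" for w
      using \<eta>\<^sub>2[of w 0] \<pi>_kernel clinear_zero[OF \<pi>_linear] by blast
    then have "norm ?v \<le> dist (\<iota> f) 0" unfolding \<pi>_quotient_norm by (intro infdist_le) simp
    then have "norm ?v \<le> q f" using \<iota>_isometric[OF f] by simp
    then have "sqrt K * norm ?v \<le> sqrt K * q f" using K(1) by (intro mult_left_mono) simp_all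
    with 1 show "norm (V f) \<le> sqrt K * q f" by linarith
  qed (use K(1) in simp)
qed

text \<open>Sobolev domination yields a constant and an order for each degree \<open>n\<close>,
  without uniformity in \<open>n\<close>. The vector is therefore split into its finitely many
  components.\<close>

lemma V_schwartz_bound:
  obtains C N where "\<And>n. C n \<ge> 0" "\<And>f m. f \<in> borchers \<Longrightarrow> (\<And>xs. m < length xs \<Longrightarrow> f xs = 0) \<Longrightarrow>
    norm (V f) \<le> (\<Sum>n\<le>m. C n * schwartz_norm n (N n) f)"
proof -
  obtain A where A: "A \<ge> 0" "\<And>f. f \<in> borchers \<Longrightarrow> norm (V f) \<le> A * q f" using V_norm_bound by blast
  have "\<forall>n. \<exists>C N. \<forall>f\<in>borchers_comp n. q f \<le> C * schwartz_norm n N f"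
    using construction_norm_on_comp[OF q p_dominated p_hilbert]
    unfolding continuous_seminorm_on_comp_def by blast
  then obtain C N where C: "\<And>n f. f \<in> borchers_comp n \<Longrightarrow> q f \<le> C n * schwartz_norm n (N n) f" by metis
  show ?thesis
  proof (rule that[of "\<lambda>n. A * \<bar>C n\<bar>" N])
    fix f :: "'s minkowski list \<Rightarrow> complex" and m
    assume f: "f \<in> borchers" and z: "\<And>xs. m < length xs \<Longrightarrow> f xs = 0"
    have fc: "component n f \<in> borchers_comp n" "component n f \<in> borchers" for n
      using component_in_comp[OF f] by (auto simp: borchers_comp_def)
    have "V f = (\<Sum>n\<le>m. V (component n f))"
      by (subst sum_components[OF z, of m]) (simp_all only: V_sum[OF fc(2)])
    then have "norm (V f) \<le> (\<Sum>n\<le>m. norm (V (component n f)))" by (simp only: norm_sum)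
    also have "\<dots> \<le> (\<Sum>n\<le>m. A * \<bar>C n\<bar> * schwartz_norm n (N n) f)"
    proof (rule sum_mono)
      fix n
      have "norm (V (component n f)) \<le> A * q (component n f)" by (rule A(2)[OF fc(2)])
      also have "\<dots> \<le> A * (C n * schwartz_norm n (N n) (component n f))"
        by (rule mult_left_mono[OF C[OF fc(1)] A(1)])
      also have "\<dots> \<le> A * (\<bar>C n\<bar> * schwartz_norm n (N n) f)"
        unfolding component_schwartz_norm
        by (intro mult_left_mono mult_right_mono A(1) schwartz_norm_nonneg borchersD[OF f]) simp
      finally show "norm (V (component n f)) \<le> A * \<bar>C n\<bar> * schwartz_norm n (N n) f" by (simp only: mult.assoc)
    qed
    finally show "norm (V f) \<le> (\<Sum>n\<le>m. A * \<bar>C n\<bar> * schwartz_norm n (N n) f)" .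
  qed (use A(1) in simp)
qed

text \<open>Smearing does not raise the highest degree of \<open>f\<close>, so finitely many
  Schwartz norm estimates suffice; \<open>C\<close> and \<open>K\<close> depend on \<open>f\<close>
  but not on the measure or the weight.\<close>

lemma V_smear_bound:
  assumes f: "f \<in> borchers"
  obtains C and K :: nat where "C \<ge> 0"
    "\<And>M G. weight M G \<Longrightarrow> norm (V (boosts.smear M G f)) \<le> C * (LINT t|M. cmod (G t) * exp (real K * \<bar>t\<bar>))"
proof -
  obtain m where m: "\<And>xs. m < length xs \<Longrightarrow> f xs = 0" using f by (auto simp: borchers_def)
  obtain C N where C: "\<And>n. C n \<ge> 0" "\<And>f m. f \<in> borchers \<Longrightarrow> (\<And>xs. m < length xs \<Longrightarrow> f xs = 0) \<Longrightarrow>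
    norm (V f) \<le> (\<Sum>n\<le>m. C n * schwartz_norm n (N n) f)" using V_schwartz_bound by blast
  have "\<forall>n. \<exists>ck :: real \<times> nat. fst ck \<ge> 0 \<and> (\<forall>M G. weight M G \<longrightarrow>
      schwartz_norm n (N n) (boosts.smear M G f) \<le> fst ck * (LINT t|M. cmod (G t) * exp (real (snd ck) * \<bar>t\<bar>)))"
  proof
    fix n
    obtain c and k :: nat where "c \<ge> 0" "\<And>M G. weight M G \<Longrightarrow>
        schwartz_norm n (N n) (boosts.smear M G f) \<le> c * (LINT t|M. cmod (G t) * exp (real k * \<bar>t\<bar>))"
      using boosts.smear_schwartz_norm[OF borchersD[OF f, of n], where N = "N n"] by blast
    then show "\<exists>ck :: real \<times> nat. fst ck \<ge> 0 \<and> (\<forall>M G. weight M G \<longrightarrow>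
        schwartz_norm n (N n) (boosts.smear M G f) \<le> fst ck * (LINT t|M. cmod (G t) * exp (real (snd ck) * \<bar>t\<bar>)))"
      by (intro exI[of _ "(c, k)"]) simp
  qed
  from choice[OF this] obtain ck :: "nat \<Rightarrow> real \<times> nat" where ck: "\<forall>n. fst (ck n) \<ge> 0 \<and> (\<forall>M G. weight M G \<longrightarrow>
      schwartz_norm n (N n) (boosts.smear M G f) \<le> fst (ck n) * (LINT t|M. cmod (G t) * exp (real (snd (ck n)) * \<bar>t\<bar>)))" ..
  define c k where "c = (\<lambda>n. fst (ck n))" and "k = (\<lambda>n. snd (ck n))"
  have c: "c n \<ge> 0" "weight M G \<Longrightarrow>
      schwartz_norm n (N n) (boosts.smear M G f) \<le> c n * (LINT t|M. cmod (G t) * exp (real (k n) * \<bar>t\<bar>))" for n M G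
    using ck[rule_format, of n] unfolding c_def k_def by blast+
  define K where "K = (\<Sum>n\<le>m. k n)"
  show ?thesis
  proof (rule that[of "\<Sum>n\<le>m. C n * c n" K])
    show "(\<Sum>n\<le>m. C n * c n) \<ge> 0" by (intro sum_nonneg mult_nonneg_nonneg C c)
    fix M G assume G: "weight M G"
    let ?I = "\<lambda>k. LINT t|M. cmod (G t) * exp (real k * \<bar>t\<bar>)"
    have "boosts.smear M G f xs = 0" if "m < length xs" for xs
      using m[of "map _ xs"] that by (simp add: boosts.smear_def)
    then have "norm (V (boosts.smear M G f)) \<le> (\<Sum>n\<le>m. C n * schwartz_norm n (N n) (boosts.smear M G f))"
      by (rule C(2)[OF boosts.smear_borchers[OF f G]])
    also have "\<dots> \<le> (\<Sum>n\<le>m. C n * (c n * ?I K))"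
    proof (rule sum_mono, rule mult_left_mono[OF _ C(1)])
      fix n assume "n \<in> {..m}"
      then have "k n \<le> K" unfolding K_def by (intro member_le_sum) simp_all
      then have "c n * ?I (k n) \<le> c n * ?I K" by (intro mult_left_mono weight_moment_mono[OF G] c(1))
      with c(2)[OF G, of n] show "schwartz_norm n (N n) (boosts.smear M G f) \<le> c n * ?I K" by linarith
    qed
    also have "\<dots> = (\<Sum>n\<le>m. C n * c n) * ?I K" by (simp only: sum_distrib_right mult.assoc)
    finally show "norm (V (boosts.smear M G f)) \<le> (\<Sum>n\<le>m. C n * c n) * ?I K" .
  qed
qed

lemma form_alpha:
  assumes "f \<in> borchers" "g \<in> borchers" shows "form (V (\<alpha> t f)) (V (\<alpha> t g)) = form (V f) (V g)"
proof -
  have "tensor (star (\<alpha> t f)) (\<alpha> t g) = \<alpha> t (tensor (star f) g)" by (simp only: star_map tensor_map)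
  then show ?thesis
    using assms by (simp only: form_V alpha_borchers W_alpha tensor_borchers star_borchers)
qed

lemma form_zero_on_dense:
  assumes "\<And>h. h \<in> borchers \<Longrightarrow> form (V h) v = form (V h) w" shows "v = w"
proof -
  have "form u v = form u w" for u
    by (rule eq_on_dense[OF D_dense, where f = "\<lambda>u. form u v" and g = "\<lambda>u. form u w"])
       (use assms in \<open>auto simp: form_def intro!: continuous_on_cinner continuous_on_id continuous_on_const\<close>)
  then have "v - w = 0"
    by (intro form_nondegenerate) (simp add: form_def clinear_diff[OF \<eta>\<^sub>0_clinear] cinner_diff_right)
  then show ?thesis by simp
qed

text \<open>\<open>poincare_rep\<close> picks a representative, so independence of the choice has to
  be shown. This is not a norm estimate: after the boost two representatives have the same form
  values with every class, and the form is nondegenerate.\<close>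

lemma U_V:
  assumes f: "f \<in> borchers" shows "U t (V f) = V (\<alpha> t f)"
proof -
  define g where "g = inv_into borchers V (V f)"
  have g: "g \<in> borchers" "V g = V f"
    unfolding g_def by (rule inv_into_into[OF imageI[OF f]], rule f_inv_into_f[OF imageI[OF f]])
  have "V (\<alpha> t g) = V (\<alpha> t f)"
  proof (rule form_zero_on_dense)
    fix h :: "'s minkowski list \<Rightarrow> complex" assume h: "h \<in> borchers"
    have "form (V h) (V (\<alpha> t f)) = form (V (\<alpha> (- t) h)) (V f)" if f: "f \<in> borchers" for f
      using form_alpha[OF alpha_borchers[OF h, of "- t"] f, of t] unfolding alpha_alpha
      by (simp only: right_minus alpha_zero)
    from this[OF f] this[OF g(1)] g(2) show "form (V h) (V (\<alpha> t g)) = form (V h) (V (\<alpha> t f))" by simp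
  qed
  then show ?thesis by (simp add: U_def poincare_rep_def poincare_boost g_def[symmetric])
qed

lemma flow: "\<exists>c. indefinite_flow (V ` borchers) form U c"
proof -
  obtain c where c: "c > 0" "\<And>x. norm (\<eta>\<^sub>0 x) \<le> c * norm x" using bounded_clinear_bound[OF \<eta>\<^sub>0_bounded] by blast
  have "indefinite_flow (V ` borchers) form U c"
  proof (rule indefinite_flow.intro)
    fix v w :: 'h and a s t r
    show "v + w \<in> V ` borchers" if "v \<in> V ` borchers" "w \<in> V ` borchers"
    proof -
      from that obtain f g where "f \<in> borchers" "g \<in> borchers" "v = V f" "w = V g" by blast
      then have "v + w = V (\<lambda>xs. f xs + g xs)" "(\<lambda>xs. f xs + g xs) \<in> borchers"
        by (simp_all add: V_add borchers_add)
      then show ?thesis by blast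
    qed
    show "a *\<^sub>C v \<in> V ` borchers" if "v \<in> V ` borchers"
    proof -
      from that obtain f where "f \<in> borchers" "v = V f" by blast
      then have "a *\<^sub>C v = V (\<lambda>xs. a * f xs)" "(\<lambda>xs. a * f xs) \<in> borchers"
        by (simp_all add: V_scale borchers_cmult)
      then show ?thesis by blast
    qed
    show "closure (V ` borchers) = UNIV" by (rule D_dense)
    show "form u (v + w) = form u v + form u w" for u
      by (simp add: form_def clinear_add[OF \<eta>\<^sub>0_clinear] cinner_add_right)
    show "form u (a *\<^sub>C v) = a * form u v" for u
      by (simp add: form_def clinear_scaleC[OF \<eta>\<^sub>0_clinear] cinner_scaleC_right)
    show "form w v = cnj (form v w)" by (rule form_commute)
    show "cmod (form v w) \<le> c * norm v * norm w"
    proof -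
      have "cmod (form v w) \<le> norm v * norm (\<eta>\<^sub>0 w)" unfolding form_def by (rule cinner_Cauchy_Schwarz)
      also have "\<dots> \<le> norm v * (c * norm w)" by (rule mult_left_mono[OF c(2)]) simp
      finally show ?thesis by (simp only: mult_ac)
    qed
    show "w = 0" if "\<And>v. form v w = 0" by (rule form_nondegenerate[OF that])
    show "U t v \<in> V ` borchers" if v: "v \<in> V ` borchers"
    proof -
      from v obtain f where f: "f \<in> borchers" "v = V f" by blast
      then have "U t v = V (\<alpha> t f)" by (simp only: U_V)
      then show ?thesis using alpha_borchers[OF f(1)] by blast
    qed
    show "U t (v + w) = U t v + U t w" if vw: "v \<in> V ` borchers" "w \<in> V ` borchers"
    proof -
      from vw obtain f g where fg: "f \<in> borchers" "g \<in> borchers" "v = V f" "w = V g" by blast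
      have "U t (V (\<lambda>xs. f xs + g xs)) = V (\<lambda>xs. \<alpha> t f xs + \<alpha> t g xs)" by (rule U_V[OF borchers_add[OF fg(1,2)]])
      then show ?thesis using fg by (simp only: V_add U_V alpha_borchers)
    qed
    show "U t (a *\<^sub>C v) = a *\<^sub>C U t v" if v: "v \<in> V ` borchers"
    proof -
      from v obtain f where f: "f \<in> borchers" "v = V f" by blast
      have "U t (V (\<lambda>xs. a * f xs)) = V (\<lambda>xs. a * \<alpha> t f xs)" by (rule U_V[OF borchers_cmult[OF f(1)]])
      then show ?thesis using f by (simp only: V_scale U_V alpha_borchers)
    qed
    show "U 0 v = v" if v: "v \<in> V ` borchers"
    proof -
      from v obtain f where f: "f \<in> borchers" "v = V f" by blast
      then show ?thesis using U_V[OF f(1), of 0] unfolding alpha_zero by simp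
    qed
    show "U s (U t v) = U (s + t) v" if v: "v \<in> V ` borchers"
    proof -
      from v obtain f where f: "f \<in> borchers" "v = V f" by blast
      then show ?thesis using U_V[OF alpha_borchers[OF f(1)], of s t] unfolding alpha_alpha by (simp only: U_V)
    qed
    show "form (U t v) (U t w) = form v w" if vw: "v \<in> V ` borchers" "w \<in> V ` borchers"
    proof -
      from vw obtain f g where fg: "f \<in> borchers" "g \<in> borchers" "v = V f" "w = V g" by blast
      then show ?thesis by (simp only: U_V form_alpha)
    qed
    show "\<exists>C. \<forall>t. \<bar>t\<bar> \<le> r \<longrightarrow> norm (U t v) \<le> C" if v: "v \<in> V ` borchers"
    proof -
      from v obtain f where f: "f \<in> borchers" "v = V f" by blast
      obtain C and K :: nat where C: "C \<ge> 0" "\<And>M G. weight M G \<Longrightarrow>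
          norm (V (boosts.smear M G f)) \<le> C * (LINT t|M. cmod (G t) * exp (real K * \<bar>t\<bar>))"
        using V_smear_bound[OF f(1)] by blast
      \<comment> \<open>The smearing bound is applied to the point mass at \<open>t\<close>, whose
        exponential moment is exp (K |t|).\<close>
      have "norm (U t v) \<le> C * exp (real K * r)" if "\<bar>t\<bar> \<le> r" for t
      proof -
        have "(\<lambda>s::real. cmod (1::complex) * exp (real K * \<bar>s\<bar>)) \<in> borel_measurable borel"
          by (intro borel_measurable_continuous_onI continuous_intros)
        then have I: "(LINT s|point_mass t. cmod (1::complex) * exp (real K * \<bar>s\<bar>)) = exp (real K * \<bar>t\<bar>)"
          by (subst integral_point_mass) simp_all
        have "norm (U t v) \<le> C * exp (real K * \<bar>t\<bar>)"
          using C(2)[OF weight_point_mass, of t] unfolding boosts.smear_point_mass_borchers[OF f(1)] I f(2) U_V[OF f(1)] .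
        also have "\<dots> \<le> C * exp (real K * r)"
        proof (rule mult_left_mono[OF _ C(1)])
          have "real K * \<bar>t\<bar> \<le> real K * r" by (rule mult_left_mono[OF that]) simp
          then show "exp (real K * \<bar>t\<bar>) \<le> exp (real K * r)" by (simp only: exp_le_cancel_iff)
        qed
        finally show ?thesis .
      qed
      then show ?thesis by blast
    qed
  qed
  then show ?thesis by blast
qed

text \<open>A bound of the form is only known to exist; choosing one turns the existence statement
  into an instance of the locale.\<close>

definition flow_const :: real where "flow_const = (SOME c. indefinite_flow (V ` borchers) form U c)"

sublocale flow: indefinite_flow "V ` borchers" form U flow_const
  unfolding flow_const_def by (rule someI_ex[OF flow])

subsection \<open>Smeared vectors\<close>

text \<open>Only the values of \<open>g\<close> on the real line enter; \<open>g\<close> is kept as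
  a function on the complex plane so that complex translates and derivatives of the weight make
  sense.\<close>

definition \<Phi> :: "('s minkowski list \<Rightarrow> complex) \<Rightarrow> (complex \<Rightarrow> complex) \<Rightarrow> 'h" where
  "\<Phi> f g = V (boosts.smear lborel (\<lambda>t. g (of_real t)) f)"

lemma smear_test_borchers:
  "f \<in> borchers \<Longrightarrow> test_function g \<Longrightarrow> boosts.smear lborel (\<lambda>t. g (of_real t)) f \<in> borchers"
  by (rule boosts.smear_borchers[OF _ weight_test_function])

lemma \<Phi>_in_D: "f \<in> borchers \<Longrightarrow> test_function g \<Longrightarrow> \<Phi> f g \<in> V ` borchers"
  unfolding \<Phi>_def by (intro imageI smear_test_borchers)

lemma \<Phi>_linear:
  assumes f: "f \<in> borchers" and g: "test_function g" "test_function h"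
  shows "\<Phi> f (\<lambda>w. a * g w + h w) = a *\<^sub>C \<Phi> f g + \<Phi> f h"
proof -
  have "boosts.smear lborel (\<lambda>t. a * g (of_real t) + h (of_real t)) f xs
      = a * boosts.smear lborel (\<lambda>t. g (of_real t)) f xs + boosts.smear lborel (\<lambda>t. h (of_real t)) f xs" for xs
  proof -
    have i: "integrable lborel (\<lambda>t. g (of_real t) * f (map (L t) xs))" "integrable lborel (\<lambda>t. h (of_real t) * f (map (L t) xs))"
      by (rule boosts.smear_integrable[OF weight_test_function borchersD[OF f] refl]; fact)+
    have "(LINT t|lborel. (a * g (of_real t) + h (of_real t)) * f (map (L t) xs))
        = (LINT t|lborel. a * (g (of_real t) * f (map (L t) xs)) + h (of_real t) * f (map (L t) xs))"
      by (simp only: distrib_right mult.assoc)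
    also have "\<dots> = (LINT t|lborel. a * (g (of_real t) * f (map (L t) xs))) + (LINT t|lborel. h (of_real t) * f (map (L t) xs))"
      by (rule Bochner_Integration.integral_add[OF _ i(2)]) (simp only: integrable_mult_right i(1))
    finally show ?thesis unfolding boosts.smear_def by simp
  qed
  then have "boosts.smear lborel (\<lambda>t. a * g (of_real t) + h (of_real t)) f
    = (\<lambda>xs. a * boosts.smear lborel (\<lambda>t. g (of_real t)) f xs + boosts.smear lborel (\<lambda>t. h (of_real t)) f xs)" by blast
  then show ?thesis
    unfolding \<Phi>_def by (simp only: V_add V_scale borchers_cmult smear_test_borchers f g)
qed

lemma \<Phi>_zero: "f \<in> borchers \<Longrightarrow> \<Phi> f (\<lambda>w. 0) = 0"
  using \<Phi>_linear[OF _ test_function_zero test_function_zero, of f 1] by simp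

lemma \<Phi>_cmult: "f \<in> borchers \<Longrightarrow> test_function g \<Longrightarrow> \<Phi> f (\<lambda>w. a * g w) = a *\<^sub>C \<Phi> f g"
  using \<Phi>_linear[OF _ _ test_function_zero, of f g a] by (simp add: \<Phi>_zero)

text \<open>The norm is controlled by a weighted supremum of \<open>g\<close> on the real line, with
  \<open>C\<close> and \<open>K\<close> depending on \<open>f\<close> only. Limits of smeared
  vectors thus become limits of weights.\<close>

lemma \<Phi>_bound:
  assumes "f \<in> borchers"
  obtains C and K :: nat where "C \<ge> 0"
    "\<And>g B. test_function g \<Longrightarrow> (\<And>t::real. cmod (g (of_real t)) \<le> B * exp (- (real K * \<bar>t\<bar>))) \<Longrightarrow> norm (\<Phi> f g) \<le> C * B"
proof -
  obtain C and K :: nat where C: "C \<ge> 0" "\<And>M G. weight M G \<Longrightarrow>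
      norm (V (boosts.smear M G f)) \<le> C * (LINT t|M. cmod (G t) * exp (real K * \<bar>t\<bar>))"
    using V_smear_bound[OF assms] by blast
  show ?thesis
  proof (rule that[of "C * exp_abs_mass" "Suc K"])
    show "C * exp_abs_mass \<ge> 0" using C(1) exp_abs_mass_nonneg by simp
    fix g B assume g: "test_function g" "\<And>t::real. cmod (g (of_real t)) \<le> B * exp (- (real (Suc K) * \<bar>t\<bar>))"
    have "norm (\<Phi> f g) \<le> C * (LINT t|lborel. cmod (g (of_real t)) * exp (real K * \<bar>t\<bar>))"
      unfolding \<Phi>_def by (rule C(2)[OF weight_test_function[OF g(1)]])
    also have "\<dots> \<le> C * (B * exp_abs_mass)" by (rule mult_left_mono[OF test_function_moment_le[OF g] C(1)])
    finally show "norm (\<Phi> f g) \<le> C * exp_abs_mass * B" by (simp only: mult_ac)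
  qed
qed

text \<open>By the group law and the translation invariance of Lebesgue measure, moving
  \<open>f\<close> along the orbit amounts to translating the weight.\<close>

lemma U_\<Phi>:
  assumes "f \<in> borchers" "test_function g"
  shows "U h (\<Phi> f g) = \<Phi> f (\<lambda>w. g (w - of_real h))"
proof -
  have "\<alpha> h (boosts.smear lborel (\<lambda>t. g (of_real t)) f) = boosts.smear lborel (\<lambda>t. g (of_real t - of_real h)) f"
  proof
    fix xs
    have "boosts.smear lborel (\<lambda>t. g (of_real t - of_real h)) f xs
        = \<bar>1\<bar> *\<^sub>R (LINT t|lborel. g (of_real (h + 1 * t) - of_real h) * f (map (L (h + 1 * t)) xs))"
      unfolding boosts.smear_def by (rule lborel_integral_real_affine) simp
    also have "\<dots> = boosts.smear lborel (\<lambda>t. g (of_real t)) f (map (L h) xs)"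
      by (simp add: boosts.smear_def comp_def boost_boost add.commute)
    finally show "\<alpha> h (boosts.smear lborel (\<lambda>t. g (of_real t)) f) xs = boosts.smear lborel (\<lambda>t. g (of_real t - of_real h)) f xs" by simp
  qed
  then show ?thesis unfolding \<Phi>_def U_V[OF smear_test_borchers[OF assms]] by (simp only:)
qed

text \<open>The error of the difference quotient is itself a smeared vector, with weight
  \<open>e\<close>, and a second-order Taylor estimate divided by |h| makes it small. As
  \<open>U h\<close> turns g(w) into g(w - h), the limit has the weight - g' / i = i g'.\<close>

lemma generator_\<Phi>:
  assumes f: "f \<in> borchers" and g: "test_function g"
  shows "\<Phi> f g \<in> flow.domA" "flow.A (\<Phi> f g) = \<Phi> f (\<lambda>w. \<i> * deriv g w)"
proof -
  obtain C and K :: nat where C: "C \<ge> 0"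
    "\<And>g B. test_function g \<Longrightarrow> (\<And>t::real. cmod (g (of_real t)) \<le> B * exp (- (real K * \<bar>t\<bar>))) \<Longrightarrow> norm (\<Phi> f g) \<le> C * B"
    using \<Phi>_bound[OF f] by blast
  obtain B where B: "B \<ge> 0" "\<And>w x. \<bar>Im w\<bar> \<le> 0 \<Longrightarrow> cmod (x - w) \<le> 1 \<Longrightarrow> cmod (g x) \<le> B * exp (- (real K * \<bar>Re w\<bar>))"
    using test_function_cball[OF g] by blast
  note g' = test_function_deriv[OF g]
  have le: "norm (flow.quotient h (\<Phi> f g) - \<Phi> f (\<lambda>w. \<i> * deriv g w)) \<le> C * (2 * B) * \<bar>h\<bar>" if h: "h \<noteq> 0" "\<bar>h\<bar> \<le> 1 / 2" for h
  proof -
    note sh = test_function_shift[OF g, of "of_real h"]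
    let ?c = "1 / (\<i> * complex_of_real h)"
    define e where "e = (\<lambda>w. ?c * ((-1) * g w + g (w - of_real h)) + (- \<i>) * deriv g w)"
    have e: "test_function e"
      unfolding e_def
      by (rule test_function_linear[OF test_function_linear[OF g sh] test_function_cmult[OF g']])
    have \<Phi>e: "\<Phi> f e = flow.quotient h (\<Phi> f g) - \<Phi> f (\<lambda>w. \<i> * deriv g w)"
      unfolding e_def U_\<Phi>[OF f g] \<Phi>_linear[OF f test_function_linear[OF g sh] test_function_cmult[OF g']]
        \<Phi>_linear[OF f g sh] \<Phi>_cmult[OF f g']
      by (simp only: scaleC_minus_one scaleC_minus_left) (simp add: algebra_simps)
    have "cmod (e (of_real t)) \<le> (2 * B * \<bar>h\<bar>) * exp (- (real K * \<bar>t\<bar>))" for t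
    proof -
      let ?b = "B * exp (- (real K * \<bar>t\<bar>))"
      \<comment> \<open>The Taylor estimate is used with radius 1 and two terms, which is why |h|
        \<le> 1/2 is imposed.\<close>
      have "cmod (g (of_real t + (- of_real h)) - (\<Sum>n<2. (deriv ^^ n) g (of_real t) / fact n * (- of_real h) ^ n))
          \<le> 2 * ?b * (cmod (- of_real h) / 1) ^ 2"
        by (rule entire_taylor_remainder[OF test_function_holomorphic[OF g] zero_less_one])
           (use h(2) B(2)[of "of_real t"] in simp_all)
      then have r: "cmod (g (of_real t - of_real h) - g (of_real t) + of_real h * deriv g (of_real t)) \<le> 2 * ?b * \<bar>h\<bar>\<^sup>2"
        by (simp add: numeral_2_eq_2 algebra_simps)
      have "e (of_real t) = ?c * (g (of_real t - of_real h) - g (of_real t) + of_real h * deriv g (of_real t))"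
        using h(1) by (simp add: e_def field_simps)
      then have "cmod (e (of_real t)) = (1 / \<bar>h\<bar>) * cmod (g (of_real t - of_real h) - g (of_real t) + of_real h * deriv g (of_real t))"
        by (simp only: norm_mult norm_divide norm_one norm_ii norm_of_real mult_1)
      also have "\<dots> \<le> (1 / \<bar>h\<bar>) * (2 * ?b * \<bar>h\<bar>\<^sup>2)" by (rule mult_left_mono[OF r]) simp
      also have "\<dots> = (2 * B * \<bar>h\<bar>) * exp (- (real K * \<bar>t\<bar>))"
      proof -
        have "(1 / a) * (2 * (B * x) * a\<^sup>2) = 2 * B * a * x" if "a \<noteq> 0" for a x :: real
          using that by (simp add: power2_eq_square)
        then show ?thesis using h(1) abs_eq_0 by blast
      qed
      finally show ?thesis .
    qed
    from C(2)[OF e this] show ?thesis unfolding \<Phi>e by (simp only: mult.assoc)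
  qed
  have "((\<lambda>h. flow.quotient h (\<Phi> f g) - \<Phi> f (\<lambda>w. \<i> * deriv g w)) \<longlongrightarrow> 0) (at 0)"
  proof (rule Lim_null_comparison)
    have "((\<lambda>h::real. C * (2 * B) * \<bar>h\<bar>) \<longlongrightarrow> C * (2 * B) * \<bar>0\<bar>) (at 0)" by (intro tendsto_intros)
    then show "((\<lambda>h::real. C * (2 * B) * \<bar>h\<bar>) \<longlongrightarrow> 0) (at 0)" by simp
    show "\<forall>\<^sub>F h in at 0. norm (flow.quotient h (\<Phi> f g) - \<Phi> f (\<lambda>w. \<i> * deriv g w)) \<le> C * (2 * B) * \<bar>h\<bar>"
      unfolding eventually_at by (rule exI[of _ "1 / 2"]) (use le in \<open>auto simp: dist_real_def\<close>)
  qed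
  then have lim: "((\<lambda>h. flow.quotient h (\<Phi> f g)) \<longlongrightarrow> \<Phi> f (\<lambda>w. \<i> * deriv g w)) (at 0)" by (rule LIM_zero_cancel)
  show "\<Phi> f g \<in> flow.domA" "flow.A (\<Phi> f g) = \<Phi> f (\<lambda>w. \<i> * deriv g w)"
    by (rule flow.generatorI[OF \<Phi>_in_D[OF f g] lim])+
qed

lemma generator_power_\<Phi>:
  assumes f: "f \<in> borchers" and g: "test_function g"
  shows "(flow.A ^^ n) (\<Phi> f g) = \<Phi> f (\<lambda>w. \<i> ^ n * (deriv ^^ n) g w)"
proof (induction n)
  case 0 show ?case by simp
next
  case (Suc n)
  note gn = test_function_higher_deriv[OF g]
  have "flow.A (\<Phi> f (\<lambda>w. \<i> ^ n * (deriv ^^ n) g w)) = \<Phi> f (\<lambda>w. \<i> * deriv (\<lambda>w. \<i> ^ n * (deriv ^^ n) g w) w)"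
    by (rule generator_\<Phi>(2)[OF f test_function_cmult[OF gn]])
  moreover have "deriv (\<lambda>w. \<i> ^ n * (deriv ^^ n) g w) w = \<i> ^ n * deriv ((deriv ^^ n) g) w" for w
    using test_function_holomorphic[OF gn[of n], of UNIV] by (intro deriv_cmult) (simp add: holomorphic_on_imp_differentiable_at)
  ultimately show ?case by (simp add: Suc mult.assoc)
qed

text \<open>Cauchy's inequalities with radius 2 r bound the n-th power of the generator by a
  multiple of n! / (2 r)^n, so the series at \<open>r\<close> is dominated by a geometric one of
  ratio 1/2.\<close>

lemma \<Phi>_analytic:
  assumes f: "f \<in> borchers" and g: "test_function g" shows "\<Phi> f g \<in> flow.an"
proof (rule flow.anI)
  show "(flow.A ^^ n) (\<Phi> f g) \<in> flow.domA" for n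
    unfolding generator_power_\<Phi>[OF assms]
    by (rule generator_\<Phi>(1)[OF f test_function_cmult[OF test_function_higher_deriv[OF g]]])
  fix r :: real assume r: "r > 0"
  then have r2: "2 * r > 0" by simp
  obtain C and K :: nat where C: "C \<ge> 0"
    "\<And>g B. test_function g \<Longrightarrow> (\<And>t::real. cmod (g (of_real t)) \<le> B * exp (- (real K * \<bar>t\<bar>))) \<Longrightarrow> norm (\<Phi> f g) \<le> C * B"
    using \<Phi>_bound[OF f] by blast
  obtain B where B: "B \<ge> 0" "\<And>n w. \<bar>Im w\<bar> \<le> 0 \<Longrightarrow>
      cmod ((deriv ^^ n) g w) \<le> fact n / (2 * r) ^ n * (B * exp (- (real K * \<bar>Re w\<bar>)))"
    using test_function_higher_deriv_bound[OF g r2] by blast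
  show "summable (\<lambda>n. r ^ n / fact n * norm ((flow.A ^^ n) (\<Phi> f g)))"
  proof (rule summable_comparison_test')
    show "summable (\<lambda>n. C * B * (1 / 2) ^ n)" by (rule summable_mult, rule summable_geometric) simp
    fix n
    have "norm (\<Phi> f (\<lambda>w. \<i> ^ n * (deriv ^^ n) g w)) \<le> C * (fact n / (2 * r) ^ n * B)"
    proof (rule C(2)[OF test_function_cmult[OF test_function_higher_deriv[OF g]]])
      show "cmod (\<i> ^ n * (deriv ^^ n) g (of_real t)) \<le> fact n / (2 * r) ^ n * B * exp (- (real K * \<bar>t\<bar>))" for t
        using B(2)[of "of_real t" n] by (simp add: norm_mult norm_power mult.assoc)
    qed
    then have "r ^ n / fact n * norm ((flow.A ^^ n) (\<Phi> f g)) \<le> r ^ n / fact n * (C * (fact n / (2 * r) ^ n * B))"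
      unfolding generator_power_\<Phi>[OF assms] by (rule mult_left_mono) (use r in simp)
    also have "\<dots> = C * B * (1 / 2) ^ n" using r by (simp add: power_mult_distrib power_divide)
    finally show "norm (r ^ n / fact n * norm ((flow.A ^^ n) (\<Phi> f g))) \<le> C * B * (1 / 2) ^ n" using r by simp
  qed
qed

text \<open>As (i z)^n i^n = (-z)^n, the partial sums are smeared with the Taylor polynomials of g(w
  - z) around \<open>w\<close>, which converge in the weighted supremum on the real line.\<close>

lemma Uc_\<Phi>:
  assumes f: "f \<in> borchers" and g: "test_function g"
  shows "flow.Uc z (\<Phi> f g) = \<Phi> f (\<lambda>w. g (w - z))"
proof -
  obtain C and K :: nat where C: "C \<ge> 0"
    "\<And>g B. test_function g \<Longrightarrow> (\<And>t::real. cmod (g (of_real t)) \<le> B * exp (- (real K * \<bar>t\<bar>))) \<Longrightarrow> norm (\<Phi> f g) \<le> C * B"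
    using \<Phi>_bound[OF f] by blast
  \<comment> \<open>With this radius the Taylor ratio |z| / r is at most 1/2; the 1 covers z =
    0.\<close>
  define r where "r = 2 * cmod z + 1"
  have r: "r > 0" "2 * cmod (- z) \<le> r" by (simp_all add: r_def add_nonneg_pos)
  obtain B where B: "B \<ge> 0" "\<And>w x. \<bar>Im w\<bar> \<le> 0 \<Longrightarrow> cmod (x - w) \<le> r \<Longrightarrow> cmod (g x) \<le> B * exp (- (real K * \<bar>Re w\<bar>))"
    using test_function_cball[OF g] by blast
  define T where "T = (\<lambda>m w. \<Sum>n<m. (deriv ^^ n) g w / fact n * (- z) ^ n)"
  have T_Suc: "T (Suc m) = (\<lambda>w. (- z) ^ m / fact m * (deriv ^^ m) g w + T m w)" for m
    by (simp add: T_def mult_ac add_ac)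
  have T: "test_function (T m)" for m
  proof (induction m)
    case 0 show ?case by (simp add: T_def test_function_zero)
  next
    case (Suc m) then show ?case
      unfolding T_Suc by (rule test_function_linear[OF test_function_higher_deriv[OF g]])
  qed
  have sum: "(\<Sum>n<m. ((\<i> * z) ^ n / fact n) *\<^sub>C (flow.A ^^ n) (\<Phi> f g)) = \<Phi> f (T m)" for m
  proof (induction m)
    case 0 show ?case by (simp add: T_def \<Phi>_zero[OF f])
  next
    case (Suc m)
    have "(\<i> * z) * \<i> = - z" by (simp add: complex_eq_iff)
    then have i: "(\<i> * z) ^ m * \<i> ^ m = (- z) ^ m" by (simp only: power_mult_distrib[symmetric])
    have "((\<i> * z) ^ m / fact m) *\<^sub>C (flow.A ^^ m) (\<Phi> f g) = ((- z) ^ m / fact m) *\<^sub>C \<Phi> f ((deriv ^^ m) g)"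
      unfolding generator_power_\<Phi>[OF assms] \<Phi>_cmult[OF f test_function_higher_deriv[OF g]] scaleC_scaleC
      by (simp only: times_divide_eq_left i)
    then show ?case
      unfolding T_Suc \<Phi>_linear[OF f test_function_higher_deriv[OF g] T] by (simp add: Suc)
  qed
  have "(\<lambda>m. \<Phi> f (T m) - \<Phi> f (\<lambda>w. g (w - z))) \<longlonglongrightarrow> 0"
  proof (rule Lim_null_comparison)
    have "(\<lambda>m. C * (2 * B) * (cmod (- z) / r) ^ m) \<longlonglongrightarrow> C * (2 * B) * 0"
      by (intro tendsto_mult tendsto_const LIMSEQ_power_zero) (use r in \<open>simp add: r_def\<close>)
    then show "(\<lambda>m. C * (2 * B) * (cmod (- z) / r) ^ m) \<longlonglongrightarrow> 0" by simp
    show "\<forall>\<^sub>F m in sequentially. norm (\<Phi> f (T m) - \<Phi> f (\<lambda>w. g (w - z))) \<le> C * (2 * B) * (cmod (- z) / r) ^ m"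
    proof (intro always_eventually allI)
      fix m
      note sh = test_function_shift[OF g, of z]
      have "norm (\<Phi> f (\<lambda>w. (-1) * g (w - z) + T m w)) \<le> C * (2 * B * (cmod (- z) / r) ^ m)"
      proof (rule C(2)[OF test_function_linear[OF sh T]])
        fix t :: real
        have "cmod (g (of_real t + - z) - (\<Sum>n<m. (deriv ^^ n) g (of_real t) / fact n * (- z) ^ n))
            \<le> 2 * (B * exp (- (real K * \<bar>t\<bar>))) * (cmod (- z) / r) ^ m"
          by (rule entire_taylor_remainder[OF test_function_holomorphic[OF g] r])
             (use B(2)[of "of_real t"] in simp)
        moreover have "cmod ((-1) * g (of_real t - z) + T m (of_real t)) = cmod (g (of_real t + - z) - T m (of_real t))"
          using norm_minus_commute[of "g (of_real t - z)" "T m (of_real t)"] by simp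
        ultimately show "cmod ((-1) * g (of_real t - z) + T m (of_real t)) \<le> 2 * B * (cmod (- z) / r) ^ m * exp (- (real K * \<bar>t\<bar>))"
          by (simp add: T_def mult_ac add_ac)
      qed
      then show "norm (\<Phi> f (T m) - \<Phi> f (\<lambda>w. g (w - z))) \<le> C * (2 * B) * (cmod (- z) / r) ^ m"
        unfolding \<Phi>_linear[OF f sh T] by (simp add: scaleC_minus_one mult.assoc)
    qed
  qed
  then have "(\<lambda>m. \<Phi> f (T m)) \<longlonglongrightarrow> \<Phi> f (\<lambda>w. g (w - z))" by (rule LIM_zero_cancel)
  then have "(\<lambda>n. ((\<i> * z) ^ n / fact n) *\<^sub>C (flow.A ^^ n) (\<Phi> f g)) sums \<Phi> f (\<lambda>w. g (w - z))"
    unfolding sums_def sum .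
  then show ?thesis using flow.Uc_sums[OF \<Phi>_analytic[OF assms], of z] by (rule sums_unique2[rotated])
qed

section \<open>Density of the smeared vectors and consequences for all analytic vectors\<close>

definition smeared_vectors :: "'h set" where
  "smeared_vectors = {\<Phi> f g | f g. f \<in> borchers \<and> test_function g}"

lemma smeared_vectors_analytic: "smeared_vectors \<subseteq> flow.an"
  unfolding smeared_vectors_def using \<Phi>_analytic by blast

lemma smeared_vectors_Uc: "w \<in> smeared_vectors \<Longrightarrow> flow.Uc z w \<in> smeared_vectors"
  unfolding smeared_vectors_def using Uc_\<Phi> test_function_shift by blast

lemma smeared_vectors_group:
  assumes "w \<in> smeared_vectors" shows "flow.Uc z (flow.Uc z' w) = flow.Uc (z + z') w"
proof -
  obtain f g where f: "f \<in> borchers" and g: "test_function g" and w: "w = \<Phi> f g"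
    using assms unfolding smeared_vectors_def by blast
  show ?thesis
    unfolding w Uc_\<Phi>[OF f g] Uc_\<Phi>[OF f test_function_shift[OF g]] by (simp add: algebra_simps)
qed

text \<open>Smearing with narrow Gaussians changes \<open>f\<close> little in each of the finitely
  many Schwartz norms that control \<open>V f\<close>: the change is bounded by moments with a
  factor |t|, which tend to 0.\<close>

lemma smeared_vectors_dense: "closure smeared_vectors = UNIV"
proof -
  have "V f \<in> closure smeared_vectors" if f: "f \<in> borchers" for f
  proof -
    obtain \<delta> :: "nat \<Rightarrow> complex \<Rightarrow> complex" where \<delta>: "\<And>m. test_function (\<delta> m)"
      "\<And>m. (LINT t|lborel. \<delta> m (of_real t)) = 1"
      "\<And>K::nat. (\<lambda>m. LINT t|lborel. cmod (\<delta> m (of_real t)) * (\<bar>t\<bar> * exp (real K * \<bar>t\<bar>))) \<longlonglongrightarrow> 0"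
      using approximate_identity by blast
    let ?I = "\<lambda>m k. LINT t|lborel. cmod (\<delta> m (of_real t)) * (\<bar>t\<bar> * exp (real k * \<bar>t\<bar>))"
    let ?d = "\<lambda>m xs. boosts.smear lborel (\<lambda>t. \<delta> m (of_real t)) f xs + (-1) * f xs"
    obtain l where l: "\<And>xs. l < length xs \<Longrightarrow> f xs = 0" using f by (auto simp: borchers_def)
    obtain C N where C: "\<And>n. C n \<ge> 0" "\<And>f m. f \<in> borchers \<Longrightarrow> (\<And>xs. m < length xs \<Longrightarrow> f xs = 0) \<Longrightarrow>
      norm (V f) \<le> (\<Sum>n\<le>m. C n * schwartz_norm n (N n) f)" using V_schwartz_bound by blast
    have "\<forall>n. \<exists>ck :: real \<times> nat. \<forall>M G. weight M G \<longrightarrow> (LINT t|M. G t) = 1 \<longrightarrow>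
        schwartz_norm n (N n) (\<lambda>xs. boosts.smear M G f xs + (-1) * f xs) \<le> fst ck * (LINT t|M. cmod (G t) * (\<bar>t\<bar> * exp (real (snd ck) * \<bar>t\<bar>)))"
    proof
      fix n
      obtain c and k :: nat where "c \<ge> 0" "\<And>M G. weight M G \<Longrightarrow> (LINT t|M. G t) = 1 \<Longrightarrow>
          schwartz_norm n (N n) (\<lambda>xs. boosts.smear M G f xs + (-1) * f xs) \<le> c * (LINT t|M. cmod (G t) * (\<bar>t\<bar> * exp (real k * \<bar>t\<bar>)))"
        by (rule boosts.smear_difference_schwartz_norm[OF borchersD[OF f, of n], where N = "N n"]) (rule that)
      then show "\<exists>ck :: real \<times> nat. \<forall>M G. weight M G \<longrightarrow> (LINT t|M. G t) = 1 \<longrightarrow>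
          schwartz_norm n (N n) (\<lambda>xs. boosts.smear M G f xs + (-1) * f xs) \<le> fst ck * (LINT t|M. cmod (G t) * (\<bar>t\<bar> * exp (real (snd ck) * \<bar>t\<bar>)))"
        by (intro exI[of _ "(c, k)"]) simp
    qed
    from choice[OF this] obtain ck :: "nat \<Rightarrow> real \<times> nat" where ck: "\<forall>n. \<forall>M G. weight M G \<longrightarrow> (LINT t|M. G t) = 1 \<longrightarrow>
        schwartz_norm n (N n) (\<lambda>xs. boosts.smear M G f xs + (-1) * f xs) \<le> fst (ck n) * (LINT t|M. cmod (G t) * (\<bar>t\<bar> * exp (real (snd (ck n)) * \<bar>t\<bar>)))" ..
    define c k where "c = (\<lambda>n. fst (ck n))" and "k = (\<lambda>n. snd (ck n))"
    have c: "schwartz_norm n (N n) (\<lambda>xs. boosts.smear M G f xs + (-1) * f xs) \<le> c n * (LINT t|M. cmod (G t) * (\<bar>t\<bar> * exp (real (k n) * \<bar>t\<bar>)))"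
      if "weight M G" "(LINT t|M. G t) = 1" for n M G
      using ck that unfolding c_def k_def by blast
    have "(\<lambda>m. \<Phi> f (\<delta> m) - V f) \<longlonglongrightarrow> 0"
    proof (rule Lim_null_comparison)
      have "(\<lambda>m. \<Sum>n\<le>l. C n * (c n * ?I m (k n))) \<longlonglongrightarrow> (\<Sum>n\<le>l. C n * (c n * 0))"
        by (intro tendsto_sum tendsto_mult tendsto_const \<delta>(3))
      then show "(\<lambda>m. \<Sum>n\<le>l. C n * (c n * ?I m (k n))) \<longlonglongrightarrow> 0" by simp
      show "\<forall>\<^sub>F m in sequentially. norm (\<Phi> f (\<delta> m) - V f) \<le> (\<Sum>n\<le>l. C n * (c n * ?I m (k n)))"
      proof (intro always_eventually allI)
        fix m
        have sb: "boosts.smear lborel (\<lambda>t. \<delta> m (of_real t)) f \<in> borchers" by (rule smear_test_borchers[OF f \<delta>(1)])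
        have db: "?d m \<in> borchers" by (rule borchers_add[OF sb borchers_cmult[OF f]])
        have "?d m xs = 0" if "l < length xs" for xs
          using l[of "map _ xs"] l[of xs] that by (simp add: boosts.smear_def)
        then have "norm (V (?d m)) \<le> (\<Sum>n\<le>l. C n * schwartz_norm n (N n) (?d m))" by (rule C(2)[OF db])
        also have "\<dots> \<le> (\<Sum>n\<le>l. C n * (c n * ?I m (k n)))"
          by (intro sum_mono mult_left_mono c[OF weight_test_function[OF \<delta>(1)] \<delta>(2)] C(1))
        also have "V (?d m) = \<Phi> f (\<delta> m) - V f"
          unfolding \<Phi>_def V_add[OF sb borchers_cmult[OF f]] V_scale[OF f] by (simp add: scaleC_minus_one)
        finally show "norm (\<Phi> f (\<delta> m) - V f) \<le> (\<Sum>n\<le>l. C n * (c n * ?I m (k n)))" .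
      qed
    qed
    then have "(\<lambda>m. \<Phi> f (\<delta> m)) \<longlonglongrightarrow> V f" by (rule LIM_zero_cancel)
    moreover have "\<Phi> f (\<delta> m) \<in> smeared_vectors" for m
      unfolding smeared_vectors_def using f \<delta>(1) by blast
    ultimately show ?thesis
      unfolding closure_sequential by (intro exI[of _ "\<lambda>m. \<Phi> f (\<delta> m)"]) simp
  qed
  then have "closure (V ` borchers) \<subseteq> closure smeared_vectors" by (intro closure_minimal) auto
  then show ?thesis using D_dense by auto
qed

lemmas smeared = smeared_vectors_analytic smeared_vectors_dense smeared_vectors_Uc smeared_vectors_group

lemma analytic_dense: "closure flow.an = UNIV"
  by (rule flow.an_dense[OF smeared])

lemma invariant_dense: "closure {\<Psi>\<in>flow.an. \<forall>z. flow.Uc z \<Psi> \<in> flow.an} = UNIV"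
  by (rule flow.N_invariant_dense[OF smeared])

lemma Uc_group:
  assumes "v \<in> flow.an" "flow.Uc z' v \<in> flow.an"
  shows "flow.Uc z (flow.Uc z' v) = flow.Uc (z + z') v"
  by (rule flow.Uc_group[OF smeared assms])

lemma Uc_graph_closure:
  assumes "v \<in> flow.an"
  shows "(flow.Uc z' v, flow.Uc (z + z') v) \<in> closure (op_graph flow.an (flow.Uc z))"
  by (rule flow.Uc_graph_closure[OF smeared assms])

text \<open>Supplies the uniqueness behind the \<open>THE\<close> in \<open>adjoint_op\<close>:
  \<open>\<eta>\<close> converts \<open>ip\<close> into the form, for which density of the analytic
  vectors decides.\<close>

lemma ip_eq_on_analytic:
  assumes "\<And>v. v \<in> flow.an \<Longrightarrow> ip u v = ip u' v" shows "u = u'"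
proof -
  have "ip u v = form (\<eta> u) v" for u v by (simp add: form_eq_ip' \<eta>_involution)
  then have *: "form v (\<eta> u) = form v (\<eta> u')" if "v \<in> flow.an" for v
    using assms[OF that] form_commute by metis
  have "\<eta> u = \<eta> u'" by (rule flow.B_eq_on_dense[OF analytic_dense]) (rule *)
  then show ?thesis using \<eta>_involution by metis
qed

text \<open>\<open>\<eta>\<close> turns the scalar product into the form, for which
  \<open>Uc (- cnj z)\<close> is the adjoint of \<open>Uc z\<close> on analytic vectors; the outer
  \<open>\<eta>\<close> of the \<open>\<eta>\<close>-adjoint undoes the one left over by this
  conversion.\<close>

lemma eta_adjoint_Uc:
  assumes "\<Psi> \<in> flow.an"
  shows "\<Psi> \<in> eta_adjoint_dom ip \<eta> flow.an (flow.Uc z)"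
    "eta_adjoint ip \<eta> flow.an (flow.Uc z) \<Psi> = flow.Uc (- cnj z) \<Psi>"
proof -
  have *: "ip (\<eta> \<Psi>) (flow.Uc z v) = ip (\<eta> (flow.Uc (- cnj z) \<Psi>)) v" if "v \<in> flow.an" for v
    using flow.Uc_adjoint[OF that assms] by (simp add: form_eq_ip')
  then show "\<Psi> \<in> eta_adjoint_dom ip \<eta> flow.an (flow.Uc z)"
    unfolding eta_adjoint_dom_def adjoint_dom_def by blast
  have "adjoint_op ip flow.an (flow.Uc z) (\<eta> \<Psi>) = \<eta> (flow.Uc (- cnj z) \<Psi>)"
    unfolding adjoint_op_def
  proof (rule the_equality)
    show "\<forall>v\<in>flow.an. ip (\<eta> \<Psi>) (flow.Uc z v) = ip (\<eta> (flow.Uc (- cnj z) \<Psi>)) v" using * by blast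
    show "u = \<eta> (flow.Uc (- cnj z) \<Psi>)" if "\<forall>v\<in>flow.an. ip (\<eta> \<Psi>) (flow.Uc z v) = ip u v" for u
      by (rule ip_eq_on_analytic) (use that * in metis)
  qed
  then show "eta_adjoint ip \<eta> flow.an (flow.Uc z) \<Psi> = flow.Uc (- cnj z) \<Psi>"
    by (simp add: eta_adjoint_def \<eta>_involution)
qed

end

text \<open>Additivity is stated so that it makes sense although \<open>Uc z \<Psi>\<close> is not
  known to stay in \<open>D_anal\<close>: equality where the composite is in the domain, a dense
  subset on which it always is, and for all of \<open>D_anal\<close> membership in the closure of
  the graph, which is single-valued and hence again the graph of an operator.\<close>

theorem theorem4p8:
  fixes W :: "('s::finite minkowski list \<Rightarrow> complex) \<Rightarrow> complex"
    and p q :: "('s minkowski list \<Rightarrow> complex) \<Rightarrow> real"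
    and \<iota> :: "('s minkowski list \<Rightarrow> complex) \<Rightarrow> 'h1::complex_hilbert_space"
    and form1 :: "'h1 \<Rightarrow> 'h1 \<Rightarrow> complex"
    and \<pi> :: "'h1 \<Rightarrow> 'h2::complex_hilbert_space"
    and \<eta>\<^sub>2 abs_\<eta>\<^sub>2 sign_\<eta>\<^sub>2 :: "'h2 \<Rightarrow> 'h2"
    and J :: "'h2 \<Rightarrow> 'h::complex_hilbert_space"
    and \<eta>\<^sub>0 :: "'h \<Rightarrow> 'h"
    and ip :: "'h \<Rightarrow> 'h \<Rightarrow> complex"
    and \<eta> :: "'h \<Rightarrow> 'h"
    and j\<^sub>1 :: 's
    and V :: "('s minkowski list \<Rightarrow> complex) \<Rightarrow> 'h"
    and D D_anal :: "'h set"
    and U :: "real \<Rightarrow> 'h \<Rightarrow> 'h"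
    and A :: "'h \<Rightarrow> 'h"
    and Uc :: "complex \<Rightarrow> 'h \<Rightarrow> 'h"
  assumes A1: "W \<in> borchers_dual" "W unit_elem = 1"
    and A2: "\<And>L a f. L \<in> proper_orthochronous_lorentz \<Longrightarrow> f \<in> borchers \<Longrightarrow>
               W (poincare L a f) = W f"
    and A3: "spectral_ideal \<subseteq> {f \<in> borchers. W f = 0}"
    and A4: "locality_ideal \<subseteq> {f \<in> borchers. W f = 0}"
    and A5: "hilbert_seminorm p"
            "\<And>f g. f \<in> borchers \<Longrightarrow> g \<in> borchers \<Longrightarrow> cmod (W (tensor (star f) g)) \<le> p f * p g"
    and A6: "\<And>f g a. f \<in> borchers \<Longrightarrow> g \<in> borchers \<Longrightarrow> spacelike a \<Longrightarrow>
               ((\<lambda>t::real. W (tensor f (poincare (mat 1) (t *\<^sub>R a) g))) \<longlongrightarrow> W f * W g) at_top"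
    and A7: "\<And>f. f \<in> borchers \<Longrightarrow> W (star f) = cnj (W f)"
    and dominated: "sobolev_dominated p"
    and qft: "indefinite_metric_qft W p q \<iota> form1 \<pi> \<eta>\<^sub>2 abs_\<eta>\<^sub>2 sign_\<eta>\<^sub>2 J \<eta>\<^sub>0 ip \<eta>"
    and V: "V = (\<lambda>f. J (\<pi> (\<iota> f)))"
    and D: "D = V ` borchers"
    and U: "U = (\<lambda>t. poincare_rep V (boost j\<^sub>1 t) 0)"
    and A: "A = generator U"
    and D_anal: "D_anal = entire_analytic_vectors (generator_dom D U) A"
    and Uc: "Uc = exp_series A"
  shows "closure D_anal = UNIV \<and>
    (\<forall>t. \<forall>\<Psi>\<in>D_anal. Uc (complex_of_real t) \<Psi> = U t \<Psi>) \<and>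
    (\<forall>z\<^sub>1 z\<^sub>2. \<forall>\<Psi>\<in>D_anal. Uc z\<^sub>2 \<Psi> \<in> D_anal \<longrightarrow> Uc z\<^sub>1 (Uc z\<^sub>2 \<Psi>) = Uc (z\<^sub>1 + z\<^sub>2) \<Psi>) \<and>
    closure {\<Psi>\<in>D_anal. \<forall>z. Uc z \<Psi> \<in> D_anal} = UNIV \<and>
    (\<forall>z. single_valued (closure (op_graph D_anal (Uc z)))) \<and>
    (\<forall>z\<^sub>1 z\<^sub>2. \<forall>\<Psi>\<in>D_anal. (Uc z\<^sub>2 \<Psi>, Uc (z\<^sub>1 + z\<^sub>2) \<Psi>) \<in> closure (op_graph D_anal (Uc z\<^sub>1))) \<and>
    (\<forall>z. \<forall>\<Psi>\<in>D_anal. \<Psi> \<in> eta_adjoint_dom ip \<eta> D_anal (Uc z) \<and>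
       eta_adjoint ip \<eta> D_anal (Uc z) \<Psi> = Uc (- cnj z) \<Psi>)"
proof -
  interpret Q: boosted_qft W p q \<iota> form1 \<pi> \<eta>\<^sub>2 abs_\<eta>\<^sub>2 sign_\<eta>\<^sub>2 J \<eta>\<^sub>0 ip \<eta> j\<^sub>1
    by (rule boosted_qft.intro[OF qft], rule boosted_qft_axioms.intro) (fact A2 A7 A5(1) dominated)+
  have V': "V = Q.V" unfolding V Q.V_def ..
  have U': "U = Q.U" unfolding U V' Q.U_def ..
  have an: "D_anal = Q.flow.an" unfolding D_anal D A V' U' ..
  have Uc': "Uc = Q.flow.Uc" unfolding Uc A U' ..
  show ?thesis
    unfolding an Uc' U'
    by (intro conjI allI ballI impI)
       (rule Q.analytic_dense Q.flow.Uc_real Q.Uc_group Q.invariant_dense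
          Q.flow.Uc_closed_graph[OF Q.analytic_dense] Q.Uc_graph_closure Q.eta_adjoint_Uc; assumption?)+
qed

end
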